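(* The $\mathbb{Q}(v)$-algebra $\mathbf{S}(n,d)$ is the associative algebra (with $1$) given by generators $1_\lambda$ ($\lambda\in\Lambda(n,d)$), $E_i,F_i$ ($1\le i\le n-1$) (these generators corresponding to the elements of the same name in $\mathbf{S}(n,d)$) subject to the relations: (Q1$'$) $1_\lambda1_\mu=\delta_{\lambda,\mu}1_\lambda$, $\;\sum_{\lambda\in\Lambda(n,d)}1_\lambda=1$; (Q2$'$) $E_i1_\lambda=1_{\lambda+\alpha_i}E_i$ if $\lambda+\alpha_i\in\Lambda(n,d)$ and $E_i1_\lambda=0$ otherwise; $F_i1_\lambda=1_{\lambda-\alpha_i}F_i$ if $\lambda-\alpha_i\in\Lambda(n,d)$ and $F_i1_\lambda=0$ otherwise; $1_\lambda E_i=E_i1_{\lambda-\alpha_i}$ if $\lambda-\alpha_i\in\Lambda(n,d)$ and $1_\lambda E_i=0$ otherwise; $1_\lambda F_i=F_i1_{\lambda+\alpha_i}$ if $\lambda+\alpha_i\in\Lambda(n,d)$ and $1_\lambda F_i=0$ otherwise; (Q3$'$) $E_iF_j-F_jE_i=\delta_{ij}\sum_{\lambda\in\Lambda(n,d)}[\lambda_j-\lambda_{j+1}]1_\lambda$; together with the $q$-Serre relations (Q4) $E_i^2E_j-(v+v^{-1})E_iE_jE_i+E_jE_i^2=0$ if $|i-j|=1$, $E_iE_j-E_jE_i=0$ otherwise; (Q5) $F_i^2F_j-(v+v^{-1})F_iF_jF_i+F_jF_i^2=0$ if $|i-j|=1$, $F_iF_j-F_jF_i=0$ otherwise.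
   Context: $n\ge1$, $d\ge0$ are integers, $\mathbb{N}=\{0,1,2,\dots\}$, $v$ is an indeterminate, $[m]=(v^m-v^{-m})/(v-v^{-1})$ for $m\in\mathbb{Z}$. $\varepsilon_1,\dots,\varepsilon_n$ is the standard orthonormal basis of $\mathbb{R}^n$ and $\alpha_i=\varepsilon_i-\varepsilon_{i+1}$. $\mathbf{U}=\mathbf{U}(\mathfrak{gl}_n)$ is the $\mathbb{Q}(v)$-algebra with generators $E_i,F_i$ ($1\le i\le n-1$), $K_i^{\pm1}$ ($1\le i\le n$) and relations: $K_iK_j=K_jK_i$, $K_iK_i^{-1}=K_i^{-1}K_i=1$; $E_iF_j-F_jE_i=\delta_{ij}(K_iK_{i+1}^{-1}-K_i^{-1}K_{i+1})/(v-v^{-1})$; $K_iE_j=v^{(\varepsilon_i,\alpha_j)}E_jK_i$, $K_iF_j=v^{-(\varepsilon_i,\alpha_j)}F_jK_i$; and the $q$-Serre relations (Q4), (Q5) of the claim. $\mathbf{V}$ is the natural module with basis $w_1,\dots,w_n$: $K_iw_j=v^{\delta_{ij}}w_j$, $E_iw_j=\delta_{j,i+1}w_i$, $F_iw_j=\delta_{ij}w_{i+1}$; $\mathbf{U}$ acts on $\mathbf{V}^{\otimes d}$ through a standard comultiplication, e.g. $\Delta(K_i)=K_i\otimes K_i$, $\Delta(E_i)=E_i\otimes K_iK_{i+1}^{-1}+1\otimes E_i$, $\Delta(F_i)=F_i\otimes1+K_i^{-1}K_{i+1}\otimes F_i$. The $q$-Schur algebra $\mathbf{S}(n,d)$ is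 the image of $\mathbf{U}\to\operatorname{End}(\mathbf{V}^{\otimes d})$ (equivalently the commuting algebra of the Hecke algebra of $\Sigma_d$ on $\mathbf{V}^{\otimes d}$); images of generators are denoted by the same symbols. $\Lambda(n,d)=\{\lambda\in\mathbb{N}^n\mid\sum\lambda_i=d\}$; in $\mathbf{S}(n,d)$, $1_\lambda=\prod_{i=1}^n\begin{bmatrix}K_i\\\lambda_i\end{bmatrix}$ where $\begin{bmatrix}K_i\\t\end{bmatrix}=\prod_{s=1}^t\frac{K_iv^{-s+1}-K_i^{-1}v^{s-1}}{v^s-v^{-s}}$, $\begin{bmatrix}K_i\\0\end{bmatrix}=1$. *)

theory Defs
  imports
    "HOL-Algebra.QuotRing"
    "HOL-Algebra.Module"
    "HOL-Computational_Algebra.Fraction_Field"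
    "HOL-Computational_Algebra.Polynomial"
    "HOL-Library.Function_Algebras"
begin

section \<open>Associative algebras by generators and relations\<close>

text \<open>
  An associative unital algebra over a field \<open>'k\<close> is carried by a \<^const>\<open>carrier\<close>-based record of
  type \<open>('k, 'a) module\<close>: a ring together with a scalar multiplication. (The locale
  \<open>algebra\<close> of HOL-Algebra only covers commutative algebras.)
\<close>

definition alg_iso :: "('k, 'a, 'm) module_scheme \<Rightarrow> ('k, 'b, 'l) module_scheme \<Rightarrow> ('a \<Rightarrow> 'b) set"
  where "alg_iso A B =
    {h \<in> ring_iso A B. \<forall>c. \<forall>x\<in>carrier A. h (c \<odot>\<^bsub>A\<^esub> x) = c \<odot>\<^bsub>B\<^esub> h x}"

definition word_prod :: "('a, 'm) monoid_scheme \<Rightarrow> ('g \<Rightarrow> 'a) \<Rightarrow> 'g list \<Rightarrow> 'a"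
  where "word_prod A f w = foldr (\<lambda>g x. f g \<otimes>\<^bsub>A\<^esub> x) w \<one>\<^bsub>A\<^esub>"

text \<open>
  The free algebra on \<open>S\<close>: finitely supported functions on words in \<open>S\<close>; the product is
  convolution over all ways of cutting a word in two.
\<close>

definition free_alg :: "'g set \<Rightarrow> ('k::field, 'g list \<Rightarrow> 'k) module"
  where "free_alg S =
    \<lparr>carrier = {p. finite {w. p w \<noteq> 0} \<and> (\<forall>w. p w \<noteq> 0 \<longrightarrow> set w \<subseteq> S)},
     monoid.mult = (\<lambda>p q w. \<Sum>k\<le>length w. p (take k w) * q (drop k w)),
     one = (\<lambda>w. of_bool (w = [])),
     zero = (\<lambda>w. 0),
     add = (\<lambda>p q w. p w + q w),
     module.smult = (\<lambda>c p w. c * p w)\<rparr>"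

definition free_gen :: "'g \<Rightarrow> 'g list \<Rightarrow> 'k::field"
  where "free_gen g = (\<lambda>w. of_bool (w = [g]))"

text \<open>Evaluation of a noncommutative polynomial at elements of an algebra.\<close>

definition eval_alg :: "('k::field, 'a, 'm) module_scheme \<Rightarrow> ('g \<Rightarrow> 'a) \<Rightarrow> ('g list \<Rightarrow> 'k) \<Rightarrow> 'a"
  where "eval_alg A f p = (\<Oplus>\<^bsub>A\<^esub>w\<in>{w. p w \<noteq> 0}. p w \<odot>\<^bsub>A\<^esub> word_prod A f w)"

definition quot_alg :: "('k, 'a, 'm) module_scheme \<Rightarrow> 'a set \<Rightarrow> ('k, 'a set) module"
  where "quot_alg A I = ring.extend (A Quot I)
    (module.fields (\<lambda>c C. \<Union>x\<in>C. I +>\<^bsub>A\<^esub> (c \<odot>\<^bsub>A\<^esub> x)))"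

text \<open>A pair \<open>(l, r)\<close> in \<open>R\<close> stands for the relation \<open>l = r\<close>.\<close>

definition rel_ideal :: "'g set \<Rightarrow> (('g list \<Rightarrow> 'k::field) \<times> ('g list \<Rightarrow> 'k)) set \<Rightarrow> ('g list \<Rightarrow> 'k) set"
  where "rel_ideal S R = genideal (free_alg S) {l \<ominus>\<^bsub>free_alg S\<^esub> r |l r. (l, r) \<in> R}"

definition presented_alg ::
    "'g set \<Rightarrow> (('g list \<Rightarrow> 'k::field) \<times> ('g list \<Rightarrow> 'k)) set \<Rightarrow> ('k, ('g list \<Rightarrow> 'k) set) module"
  where "presented_alg S R = quot_alg (free_alg S) (rel_ideal S R)"

definition presented_gen ::
    "'g set \<Rightarrow> (('g list \<Rightarrow> 'k::field) \<times> ('g list \<Rightarrow> 'k)) set \<Rightarrow> 'g \<Rightarrow> ('g list \<Rightarrow> 'k) set"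
  where "presented_gen S R g = rel_ideal S R +>\<^bsub>free_alg S\<^esub> free_gen g"


section \<open>Scalars and weights\<close>

type_synonym Qv = "rat poly fract"

definition v :: Qv
  where "v = Fraction_Field.Fract [:0, 1:] 1"

definition qint :: "int \<Rightarrow> Qv"
  where "qint m = (v powi m - v powi (- m)) / (v - inverse v)"

text \<open>
  Weights are integer-valued functions on the indices \<open>1, \<dots>, n\<close>, extended by zero, so that
  \<open>\<lambda> \<plusminus> \<alpha>\<^sub>i\<close> always makes sense.
\<close>

definition weights :: "nat \<Rightarrow> nat \<Rightarrow> (nat \<Rightarrow> int) set"
  where "weights n d =
    {\<mu>. (\<forall>i. 0 \<le> \<mu> i) \<and> (\<forall>i. i \<notin> {1..n} \<longrightarrow> \<mu> i = 0) \<and> (\<Sum>i=1..n. \<mu> i) = int d}"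

text \<open>\<open>\<alpha>\<^sub>j = \<epsilon>\<^sub>j - \<epsilon>\<^sub>j\<^sub>+\<^sub>1\<close>; its coordinate \<open>root j i\<close> is the inner product of \<open>\<epsilon>\<^sub>i\<close> and \<open>\<alpha>\<^sub>j\<close>.\<close>

definition root :: "nat \<Rightarrow> nat \<Rightarrow> int"
  where "root j = (\<lambda>i. of_bool (i = j) - of_bool (i = j + 1))"


section \<open>The relations\<close>

context
  fixes A :: "(Qv, 'a, 'm) module_scheme" (structure)
begin

definition serre_rels :: "nat \<Rightarrow> (nat \<Rightarrow> 'a) \<Rightarrow> ('a \<times> 'a) set"
  where "serre_rels n x =
    {(x i [^] (2::nat) \<otimes> x j \<ominus> (v + inverse v) \<odot> (x i \<otimes> x j \<otimes> x i) \<oplus> x j \<otimes> x i [^] (2::nat), \<zero>)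
      |i j. i \<in> {1..<n} \<and> j \<in> {1..<n} \<and> \<bar>int i - int j\<bar> = 1} \<union>
    {(x i \<otimes> x j \<ominus> x j \<otimes> x i, \<zero>)
      |i j. i \<in> {1..<n} \<and> j \<in> {1..<n} \<and> \<bar>int i - int j\<bar> \<noteq> 1}"

text \<open>Here \<open>L i\<close> stands for the inverse of \<open>K i\<close>.\<close>

definition gl_rels ::
    "nat \<Rightarrow> (nat \<Rightarrow> 'a) \<Rightarrow> (nat \<Rightarrow> 'a) \<Rightarrow> (nat \<Rightarrow> 'a) \<Rightarrow> (nat \<Rightarrow> 'a) \<Rightarrow> ('a \<times> 'a) set"
  where "gl_rels n E F K L =
    {(K i \<otimes> K j, K j \<otimes> K i) |i j. i \<in> {1..n} \<and> j \<in> {1..n}} \<union>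
    {(K i \<otimes> L i, \<one>) |i. i \<in> {1..n}} \<union>
    {(L i \<otimes> K i, \<one>) |i. i \<in> {1..n}} \<union>
    {(E i \<otimes> F j \<ominus> F j \<otimes> E i,
      if i = j then inverse (v - inverse v) \<odot> (K i \<otimes> L (i + 1) \<ominus> L i \<otimes> K (i + 1)) else \<zero>)
      |i j. i \<in> {1..<n} \<and> j \<in> {1..<n}} \<union>
    {(K i \<otimes> E j, v powi (root j i) \<odot> (E j \<otimes> K i)) |i j. i \<in> {1..n} \<and> j \<in> {1..<n}} \<union>
    {(K i \<otimes> F j, v powi (- root j i) \<odot> (F j \<otimes> K i)) |i j. i \<in> {1..n} \<and> j \<in> {1..<n}} \<union>
    serre_rels n E \<union> serre_rels n F"

text \<open>Here \<open>e \<mu>\<close> stands for the idempotent \<open>1\<^sub>\<mu>\<close>.\<close>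

definition schur_rels ::
    "nat \<Rightarrow> nat \<Rightarrow> ((nat \<Rightarrow> int) \<Rightarrow> 'a) \<Rightarrow> (nat \<Rightarrow> 'a) \<Rightarrow> (nat \<Rightarrow> 'a) \<Rightarrow> ('a \<times> 'a) set"
  where "schur_rels n d e E F =
    {(e \<mu> \<otimes> e \<nu>, if \<mu> = \<nu> then e \<mu> else \<zero>) |\<mu> \<nu>. \<mu> \<in> weights n d \<and> \<nu> \<in> weights n d} \<union>
    {(\<Oplus>\<mu>\<in>weights n d. e \<mu>, \<one>)} \<union>
    {(E i \<otimes> e \<mu>, if \<mu> + root i \<in> weights n d then e (\<mu> + root i) \<otimes> E i else \<zero>)
      |i \<mu>. i \<in> {1..<n} \<and> \<mu> \<in> weights n d} \<union>
    {(F i \<otimes> e \<mu>, if \<mu> - root i \<in> weights n d then e (\<mu> - root i) \<otimes> F i else \<zero>)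
      |i \<mu>. i \<in> {1..<n} \<and> \<mu> \<in> weights n d} \<union>
    {(e \<mu> \<otimes> E i, if \<mu> - root i \<in> weights n d then E i \<otimes> e (\<mu> - root i) else \<zero>)
      |i \<mu>. i \<in> {1..<n} \<and> \<mu> \<in> weights n d} \<union>
    {(e \<mu> \<otimes> F i, if \<mu> + root i \<in> weights n d then F i \<otimes> e (\<mu> + root i) else \<zero>)
      |i \<mu>. i \<in> {1..<n} \<and> \<mu> \<in> weights n d} \<union>
    {(E i \<otimes> F j \<ominus> F j \<otimes> E i,
      if i = j then \<Oplus>\<mu>\<in>weights n d. qint (\<mu> j - \<mu> (j + 1)) \<odot> e \<mu> else \<zero>)
      |i j. i \<in> {1..<n} \<and> j \<in> {1..<n}} \<union>
    serre_rels n E \<union> serre_rels n F"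

end


section \<open>The quantized enveloping algebra of gl(n) and its action on tensor space\<close>

text \<open>\<open>UL i\<close> is the generator \<open>K\<^sub>i\<close> inverse.\<close>

datatype ugen = UE nat | UF nat | UK nat | UL nat

definition U_gens :: "nat \<Rightarrow> ugen set"
  where "U_gens n = UE ` {1..<n} \<union> UF ` {1..<n} \<union> UK ` {1..n} \<union> UL ` {1..n}"

definition U_rels :: "nat \<Rightarrow> ((ugen list \<Rightarrow> Qv) \<times> (ugen list \<Rightarrow> Qv)) set"
  where "U_rels n = gl_rels (free_alg (U_gens n)) n
    (free_gen \<circ> UE) (free_gen \<circ> UF) (free_gen \<circ> UK) (free_gen \<circ> UL)"

definition U_gl :: "nat \<Rightarrow> (Qv, (ugen list \<Rightarrow> Qv) set) module"
  where "U_gl n = presented_alg (U_gens n) (U_rels n)"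

text \<open>
  Endomorphisms of the vector space with finite basis \<open>B\<close>, as matrices indexed by \<open>B\<close>;
  \<open>M a b\<close> is the coefficient of the basis vector \<open>a\<close> in the image of \<open>b\<close>.
\<close>

definition mat_alg :: "'b set \<Rightarrow> ('k::field, 'b \<Rightarrow> 'b \<Rightarrow> 'k) module"
  where "mat_alg B =
    \<lparr>carrier = {M. \<forall>a b. M a b \<noteq> 0 \<longrightarrow> a \<in> B \<and> b \<in> B},
     monoid.mult = (\<lambda>M N a b. \<Sum>c\<in>B. M a c * N c b),
     one = (\<lambda>a b. of_bool (a = b \<and> a \<in> B)),
     zero = (\<lambda>a b. 0),
     add = (\<lambda>M N a b. M a b + N a b),
     module.smult = (\<lambda>c M a b. c * M a b)\<rparr>"

text \<open>The natural module with basis \<open>w\<^sub>1, \<dots>, w\<^sub>n\<close>.\<close>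

fun natural_rep :: "nat \<Rightarrow> ugen \<Rightarrow> nat \<Rightarrow> nat \<Rightarrow> Qv"
  where
    "natural_rep n (UE i) a j = of_bool (j = i + 1 \<and> a = i)"
  | "natural_rep n (UF i) a j = of_bool (j = i \<and> a = i + 1)"
  | "natural_rep n (UK i) a j = (if a = j \<and> j \<in> {1..n} then v powi of_bool (i = j) else 0)"
  | "natural_rep n (UL i) a j = (if a = j \<and> j \<in> {1..n} then v powi - of_bool (i = j) else 0)"

text \<open>
  \<open>comult g\<close> lists the pure tensors \<open>x \<otimes> y\<close> whose sum is \<open>\<Delta>(g)\<close>, with \<open>x\<close> and \<open>y\<close> words in the
  generators; \<open>counit\<close> gives the action on the zeroth tensor power.
\<close>

fun comult :: "ugen \<Rightarrow> (ugen list \<times> ugen list) list"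
  where
    "comult (UE i) = [([UE i], [UK i, UL (i + 1)]), ([], [UE i])]"
  | "comult (UF i) = [([UF i], []), ([UL i, UK (i + 1)], [UF i])]"
  | "comult (UK i) = [([UK i], [UK i])]"
  | "comult (UL i) = [([UL i], [UL i])]"

fun counit :: "ugen \<Rightarrow> Qv"
  where
    "counit (UE i) = 0"
  | "counit (UF i) = 0"
  | "counit (UK i) = 1"
  | "counit (UL i) = 1"

text \<open>
  The basis vector \<open>w\<^bsub>a\<^sub>1\<^esub> \<otimes> \<dots> \<otimes> w\<^bsub>a\<^sub>d\<^esub>\<close> of tensor space is represented by the list \<open>[a\<^sub>1, \<dots>, a\<^sub>d]\<close>.
\<close>

definition tensor_basis :: "nat \<Rightarrow> nat \<Rightarrow> nat list set"
  where "tensor_basis n d = {as. length as = d \<and> set as \<subseteq> {1..n}}"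

fun tensor_mat ::
    "('b \<Rightarrow> 'b \<Rightarrow> 'k::field) \<Rightarrow> ('b list \<Rightarrow> 'b list \<Rightarrow> 'k) \<Rightarrow> 'b list \<Rightarrow> 'b list \<Rightarrow> 'k"
  where
    "tensor_mat M N (a # as) (b # bs) = M a b * N as bs"
  | "tensor_mat M N _ _ = 0"

text \<open>
  Generators act on tensor powers through the iterated comultiplication, the power \<open>d + 1\<close> being
  split as the natural module tensored with the power \<open>d\<close>.
\<close>

primrec tensor_gen :: "nat \<Rightarrow> nat \<Rightarrow> ugen \<Rightarrow> nat list \<Rightarrow> nat list \<Rightarrow> Qv"
  where
    "tensor_gen n 0 = (\<lambda>g. counit g \<odot>\<^bsub>mat_alg (tensor_basis n 0)\<^esub> \<one>\<^bsub>mat_alg (tensor_basis n 0)\<^esub>)"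
  | "tensor_gen n (Suc d) = (\<lambda>g as bs. \<Sum>(x, y)\<leftarrow>comult g.
      tensor_mat (word_prod (mat_alg {1..n}) (natural_rep n) x)
        (word_prod (mat_alg (tensor_basis n d)) (tensor_gen n d) y) as bs)"

text \<open>
  The representation of \<open>U_gl n\<close> on the \<open>d\<close>-th tensor power. An element of \<open>U_gl n\<close> is a coset
  of the ideal of relations, on which evaluation at the operators \<open>tensor_gen n d\<close> is constant.
\<close>

definition tensor_rep :: "nat \<Rightarrow> nat \<Rightarrow> (ugen list \<Rightarrow> Qv) set \<Rightarrow> nat list \<Rightarrow> nat list \<Rightarrow> Qv"
  where "tensor_rep n d C =
    the_elem (eval_alg (mat_alg (tensor_basis n d)) (tensor_gen n d) ` C)"


section \<open>The q-Schur algebra\<close>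

definition schur_alg :: "nat \<Rightarrow> nat \<Rightarrow> (Qv, nat list \<Rightarrow> nat list \<Rightarrow> Qv) module"
  where "schur_alg n d =
    mat_alg (tensor_basis n d) \<lparr>carrier := tensor_rep n d ` carrier (U_gl n)\<rparr>"

definition schur_U :: "nat \<Rightarrow> nat \<Rightarrow> ugen \<Rightarrow> nat list \<Rightarrow> nat list \<Rightarrow> Qv"
  where "schur_U n d g = tensor_rep n d (presented_gen (U_gens n) (U_rels n) g)"

text \<open>The element \<open>[K; t]\<close>, with \<open>L\<close> the inverse of \<open>K\<close>.\<close>

definition K_binom :: "(Qv, 'a, 'm) module_scheme \<Rightarrow> 'a \<Rightarrow> 'a \<Rightarrow> nat \<Rightarrow> 'a"
  where "K_binom A K L t = word_prod A
    (\<lambda>s. inverse (v powi int s - v powi - int s) \<odot>\<^bsub>A\<^esub>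
      (v powi (- int s + 1) \<odot>\<^bsub>A\<^esub> K \<ominus>\<^bsub>A\<^esub> v powi (int s - 1) \<odot>\<^bsub>A\<^esub> L)) [1..<t + 1]"

definition schur_idem :: "nat \<Rightarrow> nat \<Rightarrow> (nat \<Rightarrow> int) \<Rightarrow> nat list \<Rightarrow> nat list \<Rightarrow> Qv"
  where "schur_idem n d \<mu> = word_prod (schur_alg n d)
    (\<lambda>i. K_binom (schur_alg n d) (schur_U n d (UK i)) (schur_U n d (UL i)) (nat (\<mu> i))) [1..<n + 1]"


section \<open>Generators of the presentation\<close>

datatype sgen = SI "nat \<Rightarrow> int" | SE nat | SF nat

definition S_gens :: "nat \<Rightarrow> nat \<Rightarrow> sgen set"
  where "S_gens n d = SI ` weights n d \<union> SE ` {1..<n} \<union> SF ` {1..<n}"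

definition S_rels :: "nat \<Rightarrow> nat \<Rightarrow> ((sgen list \<Rightarrow> Qv) \<times> (sgen list \<Rightarrow> Qv)) set"
  where "S_rels n d = schur_rels (free_alg (S_gens n d)) n d
    (free_gen \<circ> SI) (free_gen \<circ> SE) (free_gen \<circ> SF)"

fun schur_elem :: "nat \<Rightarrow> nat \<Rightarrow> sgen \<Rightarrow> nat list \<Rightarrow> nat list \<Rightarrow> Qv"
  where
    "schur_elem n d (SI \<mu>) = schur_idem n d \<mu>"
  | "schur_elem n d (SE i) = schur_U n d (UE i)"
  | "schur_elem n d (SF i) = schur_U n d (UF i)"

end

(* The relations hold on tensor space, by induction on d through the comultiplication, and the
   resulting homomorphism onto S(n,d) is surjective because K_i = sum of v^(mu_i) 1_mu. For
   injectivity, attach to every matrix A of natural numbers with column sums lambda a monomial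
   word in the E_i, F_i whose k-th stage uses the column of A above and the row of A left of the
   k-th diagonal entry. Only the Serre relations, the commutator of E_i and F_j, and the vanishing
   of weights with a negative coordinate are needed to see that these words times 1_lambda span
   the presented algebra. They are independent already as operators on tensor space: since v > 1
   in the ordered field Q(v), all matrix entries of E_i and F_i are nonnegative, no cancellation
   occurs, and an entry is nonzero iff there is a path between basis vectors; counting the
   tensor factors that have moved shows that the words are triangular with respect to the
   partial sums of A. *)
theory Submission
  imports Defs
begin

section \<open>Linear rewriting of words and the quantum Serre relations\<close>

text \<open>No PBW basis and no dimension formula enters; one family of words is shown to span and
  to be independent. Its shape comes from paths. In stage \<open>k\<close> the F-part first lifts
  every tensor factor destined for index \<open>k\<close> from below up to \<open>k\<close>; at the
  end the E-part takes every factor that started at \<open>k\<close> down to its destination. Hence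
  exponents are partial sums of rows and columns. Conversely, rewriting yields nondecreasing
  exponents, whose differences are the matrix entries. The obstacle is the bound on the column sums.
  It concerns the weight standing to the right of a word, so rewriting is tracked relative to a
  fixed right context, as membership in a span modulo \<open>J\<close> without recording
  coefficients. Besides positivity on tensor space, the order of the scalar field serves to invert
  the quantum integers arising from the Serre relations.\<close>

locale word_span = vector_space scale
  for scale :: "'k::field \<Rightarrow> 'v::ab_group_add \<Rightarrow> 'v" +
  fixes J :: "'v set" and ev :: "'g list \<Rightarrow> 'v"
  assumes subspace_J: "subspace J"
begin

text \<open>
  Left contexts are arbitrary, but the right context \<open>b\<close> is fixed: whether a word vanishes depends on
  the weight to its right.
\<close>

definition reduces :: "'g list \<Rightarrow> 'g list \<Rightarrow> 'g list set \<Rightarrow> bool"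
  where "reduces b w W \<longleftrightarrow> (\<forall>a. ev (a @ w @ b) \<in> span (J \<union> (\<lambda>u. ev (a @ u @ b)) ` W))"

lemma reduces_mem: "w \<in> W \<Longrightarrow> reduces b w W"
  unfolding reduces_def by (auto intro: span_base)

text \<open>The left factor \<open>a\<close> is absorbed by the arbitrary left contexts in
  \<open>reduces\<close>, whereas \<open>c\<close> stands to the right of \<open>w\<close> and has
  to join the fixed right context of the first hypothesis. The three substitution rules that follow
  are special cases.\<close>

lemma reduces_ctx:
  assumes "reduces (c @ b) w W" and "\<And>u. u \<in> W \<Longrightarrow> reduces b (a @ u @ c) W'"
  shows "reduces b (a @ w @ c) W'"
  unfolding reduces_def
proof
  fix a'
  let ?G = "J \<union> (\<lambda>u. ev (a' @ u @ b)) ` W'"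
  have "ev ((a' @ a) @ w @ c @ b) \<in> span (J \<union> (\<lambda>u. ev ((a' @ a) @ u @ c @ b)) ` W)"
    using assms(1) unfolding reduces_def by blast
  moreover have "J \<union> (\<lambda>u. ev ((a' @ a) @ u @ c @ b)) ` W \<subseteq> span ?G"
    using assms(2) unfolding reduces_def by (auto intro: span_base)
  then have "span (J \<union> (\<lambda>u. ev ((a' @ a) @ u @ c @ b)) ` W) \<subseteq> span ?G"
    by (rule span_minimal[OF _ subspace_span])
  ultimately have "ev ((a' @ a) @ w @ c @ b) \<in> span ?G" by blast
  then show "ev (a' @ (a @ w @ c) @ b) \<in> span ?G" by simp
qed

lemma reduces_trans:
  assumes "reduces b w W" and "\<And>u. u \<in> W \<Longrightarrow> reduces b u W'"
  shows "reduces b w W'"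
  using reduces_ctx[of "[]" b w W "[]" W'] assms by simp

lemma reduces_prefix:
  assumes "reduces b w W" and "\<And>u. u \<in> W \<Longrightarrow> reduces b (a @ u) W'"
  shows "reduces b (a @ w) W'"
  using reduces_ctx[of "[]" b w W a W'] assms by simp

lemma reduces_suffix:
  assumes "reduces (c @ b) w W" and "\<And>u. u \<in> W \<Longrightarrow> reduces b (u @ c) W'"
  shows "reduces b (w @ c) W'"
  using reduces_ctx[of c b w W "[]" W'] assms by simp

text \<open>Used for words killed by their weight; \<open>W\<close> may then even be empty.\<close>

lemma reduces_empty: "(\<And>a. ev (a @ w @ b) \<in> J) \<Longrightarrow> reduces b w W"
  unfolding reduces_def by (auto intro: span_base)

end

text \<open>The Chebyshev recursion satisfied by the quantum integers, with \<open>t = v + v\<inverse>\<close>.\<close>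

fun cheb :: "'k::comm_ring_1 \<Rightarrow> nat \<Rightarrow> 'k"
  where
    "cheb t 0 = 0"
  | "cheb t (Suc 0) = 1"
  | "cheb t (Suc (Suc m)) = t * cheb t (Suc m) - cheb t m"

text \<open>Nonnegativity alone does not survive the induction because of the subtracted term. The
  stronger invariant, growth by at least one in each step, is propagated by
  \<open>t >= 2\<close>.\<close>

lemma cheb_mono_nonneg:
  fixes t :: "'k::linordered_field"
  assumes "t \<ge> 2"
  shows "cheb t m \<ge> 0 \<and> cheb t (Suc m) \<ge> cheb t m + 1"
proof (induction m)
  case (Suc m)
  then have "2 * cheb t (Suc m) \<le> t * cheb t (Suc m)"
    using assms by (intro mult_right_mono) auto
  with Suc show ?case by (simp, linarith)
qed simp

lemma cheb_Suc_pos: "t \<ge> 2 \<Longrightarrow> cheb (t :: 'k::linordered_field) (Suc m) > 0"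
  using cheb_mono_nonneg[of t m] by linarith

text \<open>\<open>t\<close> stands for \<open>v + v^-1\<close>. The bound \<open>t_ge_2\<close>
  replaces the usual condition that \<open>v\<close> is not a root of unity: it makes
  \<open>cheb t N\<close> invertible for \<open>N >= 1\<close>. Letters \<open>x\<close> and
  evaluation \<open>ev\<close> are abstract, so that one argument serves the \<open>E\<close>, the
  \<open>F\<close> and words read backwards.\<close>

locale serre_words = word_span scale J ev
  for scale :: "'k::linordered_field \<Rightarrow> 'v::ab_group_add \<Rightarrow> 'v"
    and J :: "'v set" and ev :: "'g list \<Rightarrow> 'v" +
  fixes x :: "nat \<Rightarrow> 'g" and n :: nat and t :: 'k
  assumes t_ge_2: "t \<ge> 2"
    and serre: "\<lbrakk>i \<in> {1..<n}; j \<in> {1..<n}; \<bar>int i - int j\<bar> = 1\<rbrakk> \<Longrightarrow>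
      ev (a @ [x i, x i, x j] @ b) - scale t (ev (a @ [x i, x j, x i] @ b)) +
      ev (a @ [x j, x i, x i] @ b) \<in> J"
    and commute: "\<lbrakk>i \<in> {1..<n}; j \<in> {1..<n}; \<bar>int i - int j\<bar> \<noteq> 1\<rbrakk> \<Longrightarrow>
      ev (a @ [x i, x j] @ b) - ev (a @ [x j, x i] @ b) \<in> J"
begin

text \<open>Modulo \<open>J\<close> the recurrence is solved by
  \<open>u N = [N] u 1 - [N-1] u 0\<close>, with quantum integers given by \<open>cheb\<close>. As
  \<open>[N]\<close> is nonzero, this can also be solved for \<open>u 1\<close>.\<close>

lemma span_recurrence:
  fixes u :: "nat \<Rightarrow> 'v"
  assumes rec: "\<And>i. Suc (Suc i) \<le> N \<Longrightarrow> u (Suc (Suc i)) - scale t (u (Suc i)) + u i \<in> J"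
    and N: "N \<ge> 1"
  shows "u N \<in> span (J \<union> {u 0, u 1})" and "u 1 \<in> span (J \<union> {u 0, u N})"
proof -
  have *: "u (Suc i) - scale (cheb t (Suc i)) (u 1) + scale (cheb t i) (u 0) \<in> J"
    if "Suc i \<le> N" for i
    using that
  proof (induction i rule: induct_nat_012)
    case 0
    then show ?case using subspace_0[OF subspace_J] by simp
  next
    case 1
    then show ?case using rec[of 0] by simp
  next
    case (ge2 i)
    let ?r = "\<lambda>i. u (Suc i) - scale (cheb t (Suc i)) (u 1) + scale (cheb t i) (u 0)"
    \<comment> \<open>The defect of the closed formula satisfies the same three-term recurrence, up
      to one instance of \<open>rec\<close>.\<close>
    have "?r (Suc (Suc i)) = (u (Suc (Suc (Suc i))) - scale t (u (Suc (Suc i))) + u (Suc i))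
      + scale t (?r (Suc i)) - ?r i"
      by (simp add: algebra_simps)
    also have "\<dots> \<in> J"
      using rec[OF ge2.prems] ge2.IH ge2.prems
      by (metis (no_types, lifting) Suc_leD subspace_J subspace_add subspace_diff subspace_scale)
    finally show ?case .
  qed
  obtain m where m: "N = Suc m" using N by (cases N) auto
  let ?j = "u N - scale (cheb t N) (u 1) + scale (cheb t m) (u 0)"
  have j: "?j \<in> J" using *[of m] m by simp
  have span: "y \<in> span (J \<union> {a, b})" if "y = a \<or> y = b \<or> y \<in> J" for y a b
    using that by (intro span_base) auto
  have "u N = ?j + scale (cheb t N) (u 1) - scale (cheb t m) (u 0)" by (simp add: algebra_simps)
  also have "\<dots> \<in> span (J \<union> {u 0, u 1})"
    using j by (intro span_add span_diff span_scale span) auto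
  finally show "u N \<in> span (J \<union> {u 0, u 1})" .
  have c: "cheb t N \<noteq> 0" using cheb_Suc_pos[OF t_ge_2, of m] m by simp
  have "u 1 = scale (inverse (cheb t N)) (u N + scale (cheb t m) (u 0) - ?j)"
    using c by (simp add: scale_right_diff_distrib scale_right_distrib)
  also have "\<dots> \<in> span (J \<union> {u 0, u N})"
    using j by (intro span_add span_diff span_scale span) auto
  finally show "u 1 \<in> span (J \<union> {u 0, u N})" .
qed

text \<open>The index \<open>l\<close> is the position of one \<open>x j\<close> inside a power of
  \<open>x i\<close>. A Serre relation with powers of \<open>x i\<close> on both sides is a
  three-term recurrence in \<open>l\<close>, so each end is a combination of the opposite end and
  the neighbour of that opposite end, and each neighbour of an end is a combination of both
  ends.\<close>

lemma serre_power:
  assumes "i \<in> {1..<n}" "j \<in> {1..<n}" "\<bar>int i - int j\<bar> = 1"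
  defines "u \<equiv> \<lambda>N l. replicate l (x i) @ [x j] @ replicate (N - l) (x i)"
  assumes N: "N \<ge> 1"
  shows "reduces b (u N N) {u N 0, u N 1}" "reduces b (u N 1) {u N 0, u N N}"
    and "reduces b (u N 0) {u N N, u N (N - 1)}" "reduces b (u N (N - 1)) {u N N, u N 0}"
proof -
  have rec: "ev (a @ u N (Suc (Suc l)) @ b) - scale t (ev (a @ u N (Suc l) @ b))
    + ev (a @ u N l @ b) \<in> J" if l: "Suc (Suc l) \<le> N" for a l
  proof -
    obtain k where k: "N = Suc (Suc (l + k))" using l by (metis add_Suc le_Suc_ex)
    show ?thesis
      using serre[of i j "a @ replicate l (x i)" "replicate k (x i) @ b"] assms(1-3)
      unfolding u_def k by (simp add: replicate_app_Cons_same Suc_diff_le)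
  qed
  \<comment> \<open>The recurrence is symmetric, so it also holds when positions are counted from
    the right.\<close>
  have rec': "ev (a @ u N (N - Suc (Suc l)) @ b) - scale t (ev (a @ u N (N - Suc l) @ b))
    + ev (a @ u N (N - l) @ b) \<in> J" if l: "Suc (Suc l) \<le> N" for a l
  proof -
    define m where "m = N - Suc (Suc l)"
    have "N - Suc l = Suc m" "N - l = Suc (Suc m)" "Suc (Suc m) \<le> N" using l by (auto simp: m_def)
    then show ?thesis using rec[of m a] by (simp add: m_def[symmetric] algebra_simps)
  qed
  show "reduces b (u N N) {u N 0, u N 1}" "reduces b (u N 1) {u N 0, u N N}"
    using span_recurrence[of N "\<lambda>l. ev (a @ u N l @ b)" for a, OF rec N]
    unfolding reduces_def by simp_all
  show "reduces b (u N 0) {u N N, u N (N - 1)}" "reduces b (u N (N - 1)) {u N N, u N 0}"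
    using span_recurrence[of N "\<lambda>l. ev (a @ u N (N - l) @ b)" for a, OF rec' N]
    unfolding reduces_def by simp_all
qed

text \<open>Passing \<open>x j\<close> through the power of \<open>x i\<close> leaves two terms. In
  the second one a single \<open>x i\<close> is enclosed between copies of \<open>x j\<close>; with
  the roles of the letters exchanged, it can be moved to either end of the power of
  \<open>x j\<close>.\<close>

lemma serre_move:
  assumes ij: "i \<in> {1..<n}" "j \<in> {1..<n}" "\<bar>int i - int j\<bar> = 1" and p: "p \<ge> 1"
  shows "reduces b (x j # replicate p (x i) @ replicate q (x j))
    {replicate p (x i) @ replicate (Suc q) (x j),
     replicate (p - 1) (x i) @ replicate (Suc q) (x j) @ [x i]}" (is "reduces _ _ ?W")
proof -
  have ji: "\<bar>int j - int i\<bar> = 1" using ij by linarith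
  have 1: "reduces (replicate q (x j) @ b) (x j # replicate p (x i))
    {replicate p (x i) @ [x j], replicate (p - 1) (x i) @ [x j, x i]}"
    using serre_power(3)[OF ij p, of "replicate q (x j) @ b"] p by simp
  have 2: "reduces b (x j # x i # replicate q (x j))
    {replicate (Suc q) (x j) @ [x i], x i # replicate (Suc q) (x j)}"
    using serre_power(2)[OF ij(2,1) ji, of "Suc q"] by (simp add: insert_commute)
  have 3: "reduces b (replicate (p - 1) (x i) @ x j # x i # replicate q (x j)) ?W"
  proof (rule reduces_prefix[OF 2], elim insertE emptyE)
    fix u assume "u = x i # replicate (Suc q) (x j)"
    moreover have "replicate (p - 1) (x i) @ x i # r = replicate p (x i) @ r" for r
      using p by (cases p) (simp_all add: replicate_app_Cons_same)
    ultimately show "reduces b (replicate (p - 1) (x i) @ u) ?W"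
      by (metis insertI1 reduces_mem)
  qed (simp add: reduces_mem)
  have "reduces b ((x j # replicate p (x i)) @ replicate q (x j)) ?W"
  proof (rule reduces_suffix[OF 1], elim insertE emptyE)
    fix u assume "u = replicate p (x i) @ [x j]"
    then show "reduces b (u @ replicate q (x j)) ?W" by (intro reduces_mem) simp
  next
    fix u assume "u = replicate (p - 1) (x i) @ [x j, x i]"
    then show "reduces b (u @ replicate q (x j)) ?W" using 3 by simp
  qed
  then show ?thesis by simp
qed

text \<open>Lowers an exponent to at most that of its right neighbour, at the cost of copies of
  \<open>x i\<close> emitted to the right. In the induction the additional \<open>x j\<close> enters
  from the right and is absorbed by the power of \<open>x j\<close> in the middle.\<close>

lemma serre_split:
  assumes ij: "i \<in> {1..<n}" "j \<in> {1..<n}" "\<bar>int i - int j\<bar> = 1" and "q \<le> p"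
  shows "reduces b (replicate p (x i) @ replicate q (x j))
    {replicate l (x i) @ replicate q (x j) @ replicate (p - l) (x i) |l. l \<le> q}"
  using \<open>q \<le> p\<close>
proof (induction q arbitrary: b)
  case 0
  then show ?case by (auto intro: reduces_mem)
next
  case (Suc q)
  have ji: "\<bar>int j - int i\<bar> = 1" using ij by linarith
  let ?W = "{replicate l (x i) @ replicate (Suc q) (x j) @ replicate (p - l) (x i) |l. l \<le> Suc q}"
  have "reduces b ((replicate p (x i) @ replicate q (x j)) @ [x j]) ?W"
  proof (rule reduces_suffix[OF Suc.IH], goal_cases)
    case 1
    then show ?case using Suc.prems by simp
  next
    case (2 u)
    then obtain l where l: "l \<le> q" "u = replicate l (x i) @ replicate q (x j) @ replicate (p - l) (x i)"
      by auto
    \<comment> \<open>Here \<open>l \<le> q < p\<close>, so at least one \<open>x i\<close>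
      separates the new \<open>x j\<close> from the others.\<close>
    obtain r where r: "p - l = Suc r" using l Suc.prems by (cases "p - l") auto
    have 1: "reduces b (replicate (Suc r) (x i) @ [x j])
      {x j # replicate (Suc r) (x i), x i # x j # replicate r (x i)}"
      using serre_power(1)[OF ij, of "Suc r"] by simp
    have 2: "reduces (replicate r (x i) @ b) (replicate q (x j) @ [x i, x j])
        {replicate (Suc q) (x j) @ [x i], x i # replicate (Suc q) (x j)}"
      using serre_power(4)[OF ij(2,1) ji, of "Suc q"] by simp
    have 3: "reduces b (replicate l (x i) @ (replicate q (x j) @ [x i, x j]) @ replicate r (x i)) ?W"
    proof (rule reduces_ctx[OF 2], elim insertE emptyE)
      fix u assume "u = replicate (Suc q) (x j) @ [x i]"
      then have "replicate l (x i) @ u @ replicate r (x i) =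
        replicate l (x i) @ replicate (Suc q) (x j) @ replicate (p - l) (x i)" using r by simp
      then show "reduces b (replicate l (x i) @ u @ replicate r (x i)) ?W"
        using l by (intro reduces_mem) fastforce
    next
      fix u assume u: "u = x i # replicate (Suc q) (x j)"
      have "r = p - Suc l" using r by simp
      then have "replicate l (x i) @ u @ replicate r (x i) =
        replicate (Suc l) (x i) @ replicate (Suc q) (x j) @ replicate (p - Suc l) (x i)"
        unfolding u by (simp add: replicate_app_Cons_same)
      then show "reduces b (replicate l (x i) @ u @ replicate r (x i)) ?W"
        using l by (intro reduces_mem) fastforce
    qed
    have "reduces b ((replicate l (x i) @ replicate q (x j)) @ replicate (Suc r) (x i) @ [x j]) ?W"
    proof (rule reduces_prefix[OF 1], elim insertE emptyE)
      fix u assume "u = x j # replicate (Suc r) (x i)"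
      then have "(replicate l (x i) @ replicate q (x j)) @ u =
        replicate l (x i) @ replicate (Suc q) (x j) @ replicate (p - l) (x i)"
        using r by (simp add: replicate_app_Cons_same)
      then show "reduces b ((replicate l (x i) @ replicate q (x j)) @ u) ?W"
        using l by (intro reduces_mem) fastforce
    next
      fix u assume "u = x i # x j # replicate r (x i)"
      then show "reduces b ((replicate l (x i) @ replicate q (x j)) @ u) ?W"
        using 3 by simp
    qed
    then show ?case using l r by simp
  qed
  then show ?case by (simp add: replicate_append_same)
qed

lemma commute_past:
  assumes "i \<in> {1..<n}" "\<And>j. j \<in> set is \<Longrightarrow> j \<in> {1..<n} \<and> \<bar>int i - int j\<bar> \<noteq> 1"
  shows "reduces b (x i # map x is) {map x is @ [x i]}"
proof -
  have swap: "reduces b [x i, x j] {[x j, x i]}" if "i \<in> {1..<n}" "j \<in> {1..<n}" "\<bar>int i - int j\<bar> \<noteq> 1"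
    for i j b
    unfolding reduces_def
  proof
    fix a
    have "ev (a @ [x i, x j] @ b) =
      (ev (a @ [x i, x j] @ b) - ev (a @ [x j, x i] @ b)) + ev (a @ [x j, x i] @ b)" by simp
    also have "\<dots> \<in> span (J \<union> (\<lambda>u. ev (a @ u @ b)) ` {[x j, x i]})"
      using commute[OF that] by (intro span_add span_base) auto
    finally show "ev (a @ [x i, x j] @ b) \<in> span (J \<union> (\<lambda>u. ev (a @ u @ b)) ` {[x j, x i]})" .
  qed
  show "reduces b (x i # map x is) {map x is @ [x i]}"
    using assms(2)
  proof (induction "is")
    case Nil
    then show ?case by (simp add: reduces_mem)
  next
    case (Cons j "is")
    have "reduces b ([x i, x j] @ map x is) {map x (j # is) @ [x i]}"
    proof (rule reduces_suffix[OF swap])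
      fix u assume "u \<in> {[x j, x i]}"
      moreover have "reduces b ([x j] @ (x i # map x is)) {map x (j # is) @ [x i]}"
        by (rule reduces_prefix[OF Cons.IH]) (use Cons.prems in \<open>auto intro: reduces_mem\<close>)
      ultimately show "reduces b (u @ map x is) {map x (j # is) @ [x i]}" by simp
    qed (use assms Cons.prems in auto)
    then show ?case by simp
  qed
qed

lemma commute_past_power:
  assumes "i \<in> {1..<n}" "\<And>j. j \<in> set is \<Longrightarrow> j \<in> {1..<n} \<and> \<bar>int i - int j\<bar> \<noteq> 1"
  shows "reduces b (replicate p (x i) @ map x is) {map x is @ replicate p (x i)}"
proof (induction p)
  case (Suc p)
  have "reduces b ([x i] @ (replicate p (x i) @ map x is)) {map x is @ replicate (Suc p) (x i)}"
  proof (rule reduces_prefix[OF Suc])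
    fix u assume "u \<in> {map x is @ replicate p (x i)}"
    moreover have "reduces b ((x i # map x is) @ replicate p (x i)) {map x is @ replicate (Suc p) (x i)}"
      by (rule reduces_suffix[OF commute_past]) (use assms in \<open>auto intro: reduces_mem\<close>)
    ultimately show "reduces b ([x i] @ u) {map x is @ replicate (Suc p) (x i)}" by simp
  qed
  then show ?case by simp
qed (simp add: reduces_mem)

end

section \<open>Power products with increasing letters\<close>

definition seg :: "nat \<Rightarrow> nat \<Rightarrow> (nat \<Rightarrow> nat) \<Rightarrow> nat list"
  where "seg l k f = concat (map (\<lambda>i. replicate (f i) i) [l..<k])"

lemma seg_cong: "(\<And>i. l \<le> i \<Longrightarrow> i < k \<Longrightarrow> f i = g i) \<Longrightarrow> seg l k f = seg l k g"
  unfolding seg_def by (intro arg_cong[where f = concat] map_cong) auto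

lemma seg_split:
  assumes "l \<le> i" "i \<le> k"
  shows "seg l k f = seg l i f @ seg i k f"
proof -
  have "[l..<k] = [l..<i] @ [i..<k]"
    using upt_add_eq_append[of l i "k - i"] assms by simp
  then show ?thesis unfolding seg_def by simp
qed

lemma seg_Cons: "l < k \<Longrightarrow> seg l k f = replicate (f l) l @ seg (Suc l) k f"
  unfolding seg_def by (simp add: upt_conv_Cons)

lemma seg_empty [simp]: "k \<le> l \<Longrightarrow> seg l k f = []"
  by (simp add: seg_def)

lemma set_seg: "set (seg l k f) \<subseteq> {l..<k}"
  unfolding seg_def by auto

context serre_words
begin

text \<open>The letter \<open>x i\<close> travels to its own block and meets only one obstacle, the
  block of \<open>x (i - 1)\<close>. Passing it by \<open>serre_move\<close> may release one
  \<open>x (i - 1)\<close>, which commutes with everything on its remaining way to the right end.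
  Released letters never have index \<open>k - 1\<close>, so the exponent of
  \<open>x (k - 1)\<close> is known exactly.\<close>

lemma left_mult_seg:
  assumes i: "1 \<le> i" "i < k" and k: "k \<le> n"
  shows "reduces b (x i # map x (seg 1 k f)) {map x (seg 1 k g) @ map x q |g q.
    set q \<subseteq> {1..<k - 1} \<and> g (k - 1) = f (k - 1) + of_bool (i = k - 1)}" (is "reduces b _ ?W")
proof (cases "i = 1 \<or> f (i - 1) = 0")
  case True
  let ?g = "f(i := Suc (f i))"
  have *: "reduces b ((x i # map x (seg 1 (i - 1) f)) @ map x (seg i k f)) ?W"
  proof (rule reduces_suffix[OF commute_past], goal_cases)
    case 1
    then show ?case using i k by simp
  next
    case (2 j)
    then show ?case using set_seg[of 1 "i - 1" f] i k by fastforce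
  next
    case (3 u)
    have "seg 1 k ?g = seg 1 (i - 1) ?g @ seg i k ?g"
      using True i seg_split[of 1 i k ?g] seg_split[of 1 "i - 1" i ?g] seg_Cons[of "i - 1" i ?g]
      by (cases "i = 1") auto
    also have "seg 1 (i - 1) ?g = seg 1 (i - 1) f" by (rule seg_cong) auto
    also have "seg i k ?g = i # seg i k f"
      using i seg_Cons[of i k ?g] seg_Cons[of i k f] seg_cong[of "Suc i" k ?g f] by simp
    finally have "seg 1 k ?g = seg 1 (i - 1) f @ i # seg i k f" .
    then have "u @ map x (seg i k f) = map x (seg 1 k ?g) @ map x []"
      using 3 by (simp del: One_nat_def)
    moreover have "?g (k - 1) = f (k - 1) + of_bool (i = k - 1)" by simp
    ultimately show ?case by (intro reduces_mem) fastforce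
  qed
  moreover have "seg 1 k f = seg 1 (i - 1) f @ seg i k f"
    using True i seg_split[of 1 i k f] seg_split[of 1 "i - 1" i f] seg_Cons[of "i - 1" i f]
    by (cases "i = 1") auto
  ultimately show ?thesis by simp
next
  case False
  define h where "h = i - 1"
  have h: "i = Suc h" "1 \<le> h" "h < k" using False i by (auto simp: h_def)
  have fh: "f h \<ge> 1" using False h by simp
  have seg3: "seg 1 k g = seg 1 h g @ replicate (g h) h @ replicate (g i) i @ seg (Suc i) k g" for g
    using h i seg_split[of 1 h k g] seg_Cons[of h k g] seg_Cons[of i k g] by simp
  let ?A = "map x (seg 1 h f)" and ?B = "map x (seg (Suc i) k f)"
  let ?M = "replicate (f h) (x h) @ replicate (f i) (x i)"
  have mid: "reduces b (?A @ (x i # ?M) @ ?B) ?W"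
  proof (rule reduces_ctx[OF serre_move], goal_cases)
    case (5 u)
    let ?g = "f(i := Suc (f i))"
    let ?g' = "f(i := Suc (f i), h := f h - 1)"
    have g: "seg 1 h ?g = seg 1 h f" "seg (Suc i) k ?g = seg (Suc i) k f"
      "seg 1 h ?g' = seg 1 h f" "seg (Suc i) k ?g' = seg (Suc i) k f"
      using h by (auto intro!: seg_cong)
    from 5 consider "u = replicate (f h) (x h) @ replicate (Suc (f i)) (x i)"
      | "u = replicate (f h - 1) (x h) @ replicate (Suc (f i)) (x i) @ [x h]" by auto
    then show ?case
    proof cases
      case 1
      have "?A @ u @ ?B = map x (seg 1 k ?g) @ map x []"
        unfolding 1 seg3[of ?g] g using h by simp
      moreover have "?g (k - 1) = f (k - 1) + of_bool (i = k - 1)" by simp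
      ultimately show ?thesis by (intro reduces_mem) fastforce
    next
      case 2
      \<comment> \<open>The released \<open>x h\<close> has only letters of index at least
        \<open>h + 2\<close> to its right.\<close>
      have *: "reduces b ((?A @ replicate (f h - 1) (x h) @ replicate (Suc (f i)) (x i)) @ (x h # ?B)) ?W"
      proof (rule reduces_prefix[OF commute_past], goal_cases)
        case 1
        then show ?case using h i k by simp
      next
        case (2 j)
        then show ?case using set_seg[of "Suc i" k f] h k by fastforce
      next
        case (3 w)
        have "(?A @ replicate (f h - 1) (x h) @ replicate (Suc (f i)) (x i)) @ w =
          map x (seg 1 k ?g') @ map x [h]"
          unfolding seg3[of ?g'] g using h 3 by simp
        moreover have "?g' (k - 1) = f (k - 1) + of_bool (i = k - 1)" using h i by auto
        moreover have "set [h] \<subseteq> {1..<k - 1}" using h i by simp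
        ultimately show ?case by (intro reduces_mem) blast
      qed
      then show ?thesis unfolding 2 by simp
    qed
  qed (use h i k fh in auto)
  have "reduces b ((x i # ?A) @ ?M @ ?B) ?W"
  proof (rule reduces_suffix[OF commute_past], goal_cases)
    case (2 j)
    then show ?case using set_seg[of 1 h f] h i k by fastforce
  next
    case (3 u)
    then show ?case using mid by simp
  qed (use i k in simp)
  then show ?thesis unfolding seg3[of f] by simp
qed

text \<open>Exponents are adjusted from the top downwards. Repairing a descent at \<open>j\<close>
  by \<open>serre_split\<close> lowers only the exponent of \<open>x j\<close> and emits copies of
  \<open>x j\<close>, which commute past the later blocks. Hence the inequalities already achieved
  above \<open>j\<close> persist.\<close>

lemma seg_monotone:
  assumes k: "2 \<le> k" "k \<le> n" and j: "1 \<le> j" "j \<le> k - 1"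
  shows "reduces b (map x (seg 1 k f)) {map x (seg 1 k g) @ map x q |g q.
    set q \<subseteq> {1..<k - 1} \<and> g (k - 1) = f (k - 1) \<and> (\<forall>i. j \<le> i \<and> i < k - 1 \<longrightarrow> g i \<le> g (Suc i))}"
  (is "reduces b _ (?W j)")
  using j(2,1)
proof (induction j rule: inc_induct)
  case base
  have "map x (seg 1 k f) = map x (seg 1 k f) @ map x []" by simp
  then show ?case by (intro reduces_mem CollectI exI[of _ f] exI[of _ "[]"] conjI) auto
next
  case (step j)
  show ?case
  proof (rule reduces_trans[OF step.IH])
    fix u assume "u \<in> ?W (Suc j)"
    then obtain g q where u: "u = map x (seg 1 k g) @ map x q" and q: "set q \<subseteq> {1..<k - 1}"
      and g: "g (k - 1) = f (k - 1)" "\<And>i. Suc j \<le> i \<Longrightarrow> i < k - 1 \<Longrightarrow> g i \<le> g (Suc i)" by blast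
    show "reduces b u (?W j)"
    proof (cases "g j \<le> g (Suc j)")
      case True
      then have "\<forall>i. j \<le> i \<and> i < k - 1 \<longrightarrow> g i \<le> g (Suc i)"
        using g(2) by (metis le_antisym not_less_eq_eq)
      then show ?thesis unfolding u using q g(1) by (intro reduces_mem) blast
    next
      case False
      have seg3: "seg 1 k g = seg 1 j g @ replicate (g j) j @ replicate (g (Suc j)) (Suc j)
        @ seg (Suc (Suc j)) k g" for g
        using step seg_split[of 1 j k g] seg_Cons[of j k g] seg_Cons[of "Suc j" k g] by simp
      let ?A = "map x (seg 1 j g)" and ?B = "map x (seg (Suc (Suc j)) k g)"
      have "reduces b (?A @ (replicate (g j) (x j) @ replicate (g (Suc j)) (x (Suc j))) @ ?B @ map x q) (?W j)"
      proof (rule reduces_ctx[OF serre_split], goal_cases)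
        case (5 w)
        then obtain l where l: "l \<le> g (Suc j)"
          "w = replicate l (x j) @ replicate (g (Suc j)) (x (Suc j)) @ replicate (g j - l) (x j)" by blast
        have "reduces b ((?A @ replicate l (x j) @ replicate (g (Suc j)) (x (Suc j))) @
          (replicate (g j - l) (x j) @ ?B) @ map x q) (?W j)"
        proof (rule reduces_ctx[OF commute_past_power], goal_cases)
          case (2 i)
          then show ?case using set_seg[of "Suc (Suc j)" k g] step k by fastforce
        next
          case (3 w')
          let ?g = "g(j := l)"
          let ?q = "replicate (g j - l) j @ q"
          have gg: "seg 1 j ?g = seg 1 j g" "seg (Suc (Suc j)) k ?g = seg (Suc (Suc j)) k g"
            by (auto intro!: seg_cong)
          have "(?A @ replicate l (x j) @ replicate (g (Suc j)) (x (Suc j))) @ w' @ map x q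
            = map x (seg 1 k ?g) @ map x ?q"
            unfolding seg3[of ?g] gg using 3 by simp
          moreover have "set ?q \<subseteq> {1..<k - 1}" using q step by auto
          moreover have "?g (k - 1) = f (k - 1)" using g step by simp
          moreover have "\<forall>i. j \<le> i \<and> i < k - 1 \<longrightarrow> ?g i \<le> ?g (Suc i)"
            using g(2) l(1) by auto
          ultimately show ?case by (intro reduces_mem) blast
        qed (use step k in auto)
        then show ?case unfolding l by simp
      qed (use step k False in auto)
      then show ?thesis unfolding u seg3[of g] by simp
    qed
  qed (use step in auto)
qed

text \<open>One stage of the normal form. Nondecreasing exponents are wanted because they will be
  read as partial sums of matrix entries; the exact exponent of \<open>x (k - 1)\<close> will be
  compared with a coordinate of the weight.\<close>

lemma word_reduces_seg:
  assumes k: "2 \<le> k" "k \<le> n" and w: "set w \<subseteq> {1..<k}"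
  shows "reduces b (map x w) {map x (seg 1 k g) @ map x q |g q.
    set q \<subseteq> {1..<k - 1} \<and> g (k - 1) = count_list w (k - 1) \<and>
    (\<forall>i. 1 \<le> i \<and> i < k - 1 \<longrightarrow> g i \<le> g (Suc i))}" (is "reduces b _ ?W")
proof -
  have "reduces b (map x w) {map x (seg 1 k g) @ map x q |g q.
    set q \<subseteq> {1..<k - 1} \<and> g (k - 1) = count_list w (k - 1)}" (is "reduces b _ (?V w)")
    using w
  proof (induction w)
    case Nil
    have "seg 1 k (\<lambda>_. 0) = []" by (simp add: seg_def)
    then have "map x [] = map x (seg 1 k (\<lambda>_. 0)) @ map x []" by simp
    then show ?case by (intro reduces_mem) fastforce
  next
    case (Cons i w)
    have "reduces b ([x i] @ map x w) (?V (i # w))"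
    proof (rule reduces_prefix[OF Cons.IH])
      fix u assume "u \<in> ?V w"
      then obtain g q where u: "u = map x (seg 1 k g) @ map x q" "set q \<subseteq> {1..<k - 1}"
        "g (k - 1) = count_list w (k - 1)" by blast
      have "reduces b ((x i # map x (seg 1 k g)) @ map x q) (?V (i # w))"
      proof (rule reduces_suffix[OF left_mult_seg], goal_cases)
        case (4 u')
        then obtain g' q' where u': "u' = map x (seg 1 k g') @ map x q'" "set q' \<subseteq> {1..<k - 1}"
          "g' (k - 1) = g (k - 1) + of_bool (i = k - 1)" by blast
        then have "u' @ map x q = map x (seg 1 k g') @ map x (q' @ q)"
          "set (q' @ q) \<subseteq> {1..<k - 1}" "g' (k - 1) = count_list (i # w) (k - 1)"
          using u by auto
        then show ?case by (intro reduces_mem) blast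
      qed (use Cons.prems k in auto)
      then show "reduces b ([x i] @ u) (?V (i # w))" using u by simp
    qed (use Cons.prems in auto)
    then show ?case by simp
  qed
  then show ?thesis
  proof (rule reduces_trans)
    fix u assume "u \<in> ?V w"
    then obtain g q where u: "u = map x (seg 1 k g) @ map x q" "set q \<subseteq> {1..<k - 1}"
        "g (k - 1) = count_list w (k - 1)" by blast
    have "reduces b (map x (seg 1 k g) @ map x q) ?W"
    proof (rule reduces_suffix[OF seg_monotone[of k 1]], goal_cases)
      case (5 u')
      then obtain g' q' where u': "u' = map x (seg 1 k g') @ map x q'" "set q' \<subseteq> {1..<k - 1}"
          "g' (k - 1) = g (k - 1)" "\<forall>i. 1 \<le> i \<and> i < k - 1 \<longrightarrow> g' i \<le> g' (Suc i)" by blast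
      then have "u' @ map x q = map x (seg 1 k g') @ map x (q' @ q)"
          "set (q' @ q) \<subseteq> {1..<k - 1}" "g' (k - 1) = count_list w (k - 1)"
          using u by auto
      with u'(4) show ?case by (intro reduces_mem) blast
    qed (use k in auto)
    then show "reduces b u ?W" using u by simp
  qed
qed

end

section \<open>A spanning set of monomials\<close>

text \<open>Reversal exchanges the two contexts: the arbitrary left context of the conclusion
  becomes the right context of the hypothesis, which is therefore required for every
  \<open>b\<close>.\<close>

lemma (in word_span) reduces_rev:
  assumes "\<And>b. word_span.reduces scale J (ev \<circ> rev) b w W"
  shows "reduces b (rev w) (rev ` W)"
proof -
  interpret R: word_span scale J "ev \<circ> rev"
    by unfold_locales (rule subspace_J)
  show ?thesis
    unfolding reduces_def
  proof
    fix a
    show "ev (a @ rev w @ b) \<in> span (J \<union> (\<lambda>u. ev (a @ u @ b)) ` rev ` W)"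
      using assms[of "rev a", unfolded R.reduces_def, rule_format, of "rev b"]
      by (simp add: image_image)
  qed
qed

text \<open>Reversal swaps the outer terms of the Serre expression and exchanges \<open>i\<close>
  with \<open>j\<close> in the commutation relation.\<close>

lemma (in serre_words) serre_words_rev: "serre_words scale J (ev \<circ> rev) x n t"
proof
  fix i j a b
  assume ij: "i \<in> {1..<n}" "j \<in> {1..<n}"
  show "(ev \<circ> rev) (a @ [x i, x i, x j] @ b) - scale t ((ev \<circ> rev) (a @ [x i, x j, x i] @ b)) +
      (ev \<circ> rev) (a @ [x j, x i, x i] @ b) \<in> J" if "\<bar>int i - int j\<bar> = 1"
    using serre[OF ij that, of "rev b" "rev a"] by (simp add: algebra_simps)
  show "(ev \<circ> rev) (a @ [x i, x j] @ b) - (ev \<circ> rev) (a @ [x j, x i] @ b) \<in> J"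
    if "\<bar>int i - int j\<bar> \<noteq> 1"
    using commute[of j i "rev b" "rev a"] ij that by (simp add: abs_minus_commute)
qed (simp_all add: subspace_J t_ge_2)

text \<open>Each swap produces, besides the exchanged pair, a word with one letter of each class
  deleted. These corrections are recorded only through strict inclusion of multisets, which is
  enough for an induction on length.\<close>

lemma (in word_span) sort_reduces:
  assumes swap: "\<And>b x y. x \<in> X \<Longrightarrow> y \<in> Y \<Longrightarrow> reduces b [x, y] {[y, x], []}"
    and XY: "X \<inter> Y = {}" and w: "set w \<subseteq> X \<union> Y"
  shows "reduces b w ({filter (\<lambda>z. z \<in> Y) w @ filter (\<lambda>z. z \<in> X) w} \<union> {u. mset u \<subset># mset w})"
proof -
  have push: "reduces b (x # ys) ({ys @ [x]} \<union> {u. mset u \<subset># mset (x # ys)})"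
    if "x \<in> X" "set ys \<subseteq> Y" for b x ys
    using that(2)
  proof (induction ys)
    case (Cons y ys)
    let ?W = "{(y # ys) @ [x]} \<union> {u. mset u \<subset># mset (x # y # ys)}"
    have "reduces b ([x, y] @ ys) ?W"
    proof (rule reduces_suffix[OF swap], goal_cases)
      case (3 u)
      then consider "u = [y, x]" | "u = []" by auto
      then show ?case
      proof cases
        case 1
        have "reduces b ([y] @ (x # ys)) ?W"
        proof (rule reduces_prefix[OF Cons.IH], goal_cases)
          case (2 u')
          then have "u' = ys @ [x] \<or> mset ([y] @ u') \<subset># mset (x # y # ys)"
            by (auto simp: add_mset_commute[of x y])
          then show ?case by (intro reduces_mem) auto
        qed (use Cons.prems in simp)
        then show ?thesis using 1 by simp
      next
        case 2
        have "mset ys \<subset># mset (x # y # ys)"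
          by (simp add: subset_mset.less_le_not_le subset_eq_diff_conv)
        then show ?thesis using 2 by (intro reduces_mem) simp
      qed
    qed (use that Cons.prems in auto)
    then show ?case by simp
  qed (simp add: reduces_mem)
  show ?thesis
    using w
  proof (induction w)
    case (Cons z w)
    let ?fs = "filter (\<lambda>z. z \<in> Y) w" and ?es = "filter (\<lambda>z. z \<in> X) w"
    let ?W = "{filter (\<lambda>z. z \<in> Y) (z # w) @ filter (\<lambda>z. z \<in> X) (z # w)} \<union>
      {u. mset u \<subset># mset (z # w)}"
    have ms: "mset w = mset ?fs + mset ?es"
      using Cons.prems XY by (induction w) auto
    have "reduces b ([z] @ w) ?W"
    proof (rule reduces_prefix[OF Cons.IH], goal_cases)
      case (2 u)
      then consider "u = ?fs @ ?es" | "mset u \<subset># mset w" by auto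
      then show ?case
      proof cases
        case 1
        show ?thesis
        proof (cases "z \<in> X")
          case True
          have "reduces b ((z # ?fs) @ ?es) ?W"
          proof (rule reduces_suffix[OF push[OF True]], goal_cases)
            case (2 u)
            then have "u = ?fs @ [z] \<or> mset u \<subset># mset (z # ?fs)" by blast
            moreover have "mset (u @ ?es) \<subset># mset (z # w)" if "mset u \<subset># mset (z # ?fs)"
            proof -
              have "mset u + mset ?es \<subset># mset (z # ?fs) + mset ?es"
                using that by (rule subset_mset.add_strict_right_mono)
              also have "mset (z # ?fs) + mset ?es = mset (z # w)" using ms by simp
              finally show ?thesis by simp
            qed
            ultimately have "u @ ?es = (?fs @ [z]) @ ?es \<or> mset (u @ ?es) \<subset># mset (z # w)"
              by blast
            then show ?case using True XY by (intro reduces_mem) auto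
          qed auto
          then show ?thesis using 1 by simp
        next
          case False
          then show ?thesis using 1 Cons.prems by (intro reduces_mem) auto
        qed
      next
        case 2
        then show ?thesis by (intro reduces_mem) simp
      qed
    qed (use Cons.prems in simp)
    then show ?case by simp
  qed (simp add: reduces_mem)
qed

lemma count_list_seg: "count_list (seg l k f) i = (if l \<le> i \<and> i < k then f i else 0)"
proof (induction k)
  case (Suc k)
  show ?case
  proof (cases "l \<le> k")
    case True
    then have "seg l (Suc k) f = seg l k f @ replicate (f k) k"
      using seg_split[of l k "Suc k" f] seg_Cons[of k "Suc k" f] by simp
    moreover have "count_list (replicate m k) i = (if i = k then m else 0)" for m
      by (induction m) auto
    ultimately show ?thesis using Suc True by auto
  qed simp
qed simp

section \<open>Weights of words and monomials attached to matrices\<close>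

fun letter_weight :: "sgen \<Rightarrow> nat \<Rightarrow> int"
  where
    "letter_weight (SE i) = root i"
  | "letter_weight (SF i) = - root i"
  | "letter_weight (SI \<mu>) = 0"

definition weight :: "sgen list \<Rightarrow> nat \<Rightarrow> int"
  where "weight w j = (\<Sum>x\<leftarrow>w. letter_weight x j)"

lemma weight_append: "weight (u @ w) = weight u + weight w"
  unfolding weight_def by (auto simp: fun_eq_iff)

lemma weight_Nil: "weight [] = 0"
  unfolding weight_def by (auto simp: fun_eq_iff)

lemma weight_SE: "j \<ge> 1 \<Longrightarrow> weight (map SE w) j = int (count_list w j) - int (count_list w (j - 1))"
  unfolding weight_def by (induction w) (auto simp: root_def)

lemma weight_SF: "j \<ge> 1 \<Longrightarrow> weight (map SF w) j = int (count_list w (j - 1)) - int (count_list w j)"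
  unfolding weight_def by (induction w) (auto simp: root_def)

definition letters :: "nat \<Rightarrow> sgen set"
  where "letters k = SE ` {1..<k} \<union> SF ` {1..<k}"

text \<open>
  The monomial attached to a matrix \<open>A\<close>, whose diagonal is irrelevant. The exponents in stage \<open>k\<close>
  are partial sums along the \<open>k\<close>-th column above the diagonal and the \<open>k\<close>-th row left of it.
\<close>

fun xword :: "nat \<Rightarrow> (nat \<Rightarrow> nat \<Rightarrow> nat) \<Rightarrow> sgen list"
  where
    "xword 0 A = []"
  | "xword (Suc k) A = map SE (seg 1 (Suc k) (\<lambda>i. \<Sum>i'=1..i. A i' (Suc k))) @ xword k A @
      map SF (rev (seg 1 (Suc k) (\<lambda>j. \<Sum>j'=1..j. A (Suc k) j')))"

lemma xword_cong:
  "(\<And>i j. i \<in> {1..k} \<Longrightarrow> j \<in> {1..k} \<Longrightarrow> A i j = B i j) \<Longrightarrow> xword k A = xword k B"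
proof (induction k)
  case (Suc k)
  have "seg 1 (Suc k) (\<lambda>i. \<Sum>i'=1..i. A i' (Suc k)) = seg 1 (Suc k) (\<lambda>i. \<Sum>i'=1..i. B i' (Suc k))"
    "seg 1 (Suc k) (\<lambda>i. \<Sum>i'=1..i. A (Suc k) i') = seg 1 (Suc k) (\<lambda>i. \<Sum>i'=1..i. B (Suc k) i')"
    using Suc.prems by (auto intro!: seg_cong sum.cong)
  moreover have "xword k A = xword k B" using Suc by simp
  ultimately show ?case by simp
qed simp

lemma set_xword: "set (xword k A) \<subseteq> letters k"
proof (induction k)
  case (Suc k)
  then show ?case
    using set_seg[of 1 "Suc k"] unfolding letters_def xword.simps set_append set_map set_rev
    by (fastforce simp: image_iff subset_iff)
qed simp

text \<open>The diagonal entries, which would complete the column sums to \<open>\<mu>\<close>, are left out.\<close>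

definition col_mats :: "nat \<Rightarrow> (nat \<Rightarrow> int) \<Rightarrow> (nat \<Rightarrow> nat \<Rightarrow> nat) set"
  where "col_mats k \<mu> = {A. (\<forall>i j. A i j \<noteq> 0 \<longrightarrow> i \<in> {1..k} \<and> j \<in> {1..k} \<and> i \<noteq> j) \<and>
    (\<forall>j\<in>{1..k}. int (\<Sum>i=1..k. A i j) \<le> \<mu> j)}"

text \<open>\<open>lam\<close> is the weight on which the words act, so
  \<open>lam + weight b\<close> is the weight reached after \<open>b\<close>. The scalar in
  \<open>swap_EF\<close> may depend on the contexts, since the commutator acts on each weight space
  by its own scalar; \<open>vanish\<close> says that weights with a negative coordinate do not
  occur.\<close>

locale schur_words = word_span scale J ev
  for scale :: "'k::linordered_field \<Rightarrow> 'v::ab_group_add \<Rightarrow> 'v"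
    and J :: "'v set" and ev :: "sgen list \<Rightarrow> 'v" +
  fixes n :: nat and t :: 'k and lam :: "nat \<Rightarrow> int"
  assumes serre_E: "serre_words scale J ev SE n t"
    and serre_F: "serre_words scale J ev SF n t"
    and swap_EF: "\<lbrakk>i \<in> {1..<n}; j \<in> {1..<n}\<rbrakk> \<Longrightarrow>
      \<exists>c. ev (a @ [SE i, SF j] @ b) - ev (a @ [SF j, SE i] @ b) - scale c (ev (a @ b)) \<in> J"
    and vanish: "j \<in> {1..n} \<Longrightarrow> (lam + weight b) j < 0 \<Longrightarrow> ev (a @ b) \<in> J"
begin

lemma vanish_reduces: "j \<in> {1..n} \<Longrightarrow> (lam + weight (w @ b)) j < 0 \<Longrightarrow> reduces b w W"
  by (rule reduces_empty) (simp add: vanish)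

lemma swap_reduces:
  assumes "i \<in> {1..<n}" "j \<in> {1..<n}"
  shows "reduces b [SE i, SF j] {[SF j, SE i], []}" "reduces b [SF j, SE i] {[SE i, SF j], []}"
proof -
  have *: "x \<in> span (J \<union> {y, z})" "y \<in> span (J \<union> {x, z})" if xyz: "x - y - scale c z \<in> J" for x y z c
  proof -
    have 1: "w \<in> span (J \<union> {a, b})" if "w = a \<or> w = b \<or> w \<in> J" for w a b
      using that by (intro span_base) auto
    have "x = (x - y - scale c z) + y + scale c z" by simp
    also have "\<dots> \<in> span (J \<union> {y, z})" by (intro span_add span_scale 1) (use xyz in auto)
    finally show "x \<in> span (J \<union> {y, z})" .
    have "y = x - (x - y - scale c z) - scale c z" by simp
    also have "\<dots> \<in> span (J \<union> {x, z})" by (intro span_diff span_scale 1) (use xyz in auto)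
    finally show "y \<in> span (J \<union> {x, z})" .
  qed
  show "reduces b [SE i, SF j] {[SF j, SE i], []}" "reduces b [SF j, SE i] {[SE i, SF j], []}"
    unfolding reduces_def using swap_EF[OF assms] * by (simp, blast)+
qed

text \<open>Both orders of sorting are used. With the \<open>E\<close> on the left the word has the
  desired shape, but \<open>E (k - 1)\<close> may occur too often. In that case the \<open>E\<close>
  are moved to the right end instead, where they act first and make the \<open>k\<close>-th
  coordinate negative. The corrections are shorter words.\<close>

lemma triangular_reduces:
  assumes k: "2 \<le> k" "k \<le> n" and w: "set w \<subseteq> letters k"
  shows "reduces b w {map SE es @ map SF fs |es fs. set es \<subseteq> {1..<k} \<and> set fs \<subseteq> {1..<k} \<and>
    int (count_list es (k - 1)) \<le> (lam + weight b) k}" (is "reduces b w ?W")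
  using w
proof (induction "length w" arbitrary: w rule: less_induct)
  case less
  let ?X = "SE ` {1..<k}" and ?Y = "SF ` {1..<k}"
  have smaller: "reduces b u ?W" if "mset u \<subset># mset w" for u
  proof (rule less.hyps)
    show "length u < length w" using mset_subset_size[OF that] by simp
    show "set u \<subseteq> letters k"
      using that less.prems by (metis order_trans set_mset_mono set_mset_mset subset_mset.less_imp_le)
  qed
  have preimage: "\<exists>us. u = map f us \<and> set us \<subseteq> S" if "set u \<subseteq> f ` S" for u and f :: "nat \<Rightarrow> sgen" and S
    using that lists_image[of f S] unfolding lists_eq_set by blast
  obtain es where es: "filter (\<lambda>z. z \<in> ?X) w = map SE es" "set es \<subseteq> {1..<k}"
    using preimage[of "filter (\<lambda>z. z \<in> ?X) w" SE "{1..<k}"] by auto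
  obtain fs where fs: "filter (\<lambda>z. z \<in> ?Y) w = map SF fs" "set fs \<subseteq> {1..<k}"
    using preimage[of "filter (\<lambda>z. z \<in> ?Y) w" SF "{1..<k}"] by auto
  show ?case
  proof (cases "int (count_list es (k - 1)) \<le> (lam + weight b) k")
    case True
    show ?thesis
    proof (rule reduces_trans[OF sort_reduces[of ?Y ?X]], goal_cases)
      case (1 b y x)
      then show ?case using swap_reduces(2) k by auto
    next
      case (4 u)
      then show ?case using smaller True es fs by (auto intro: reduces_mem)
    qed (use less.prems in \<open>auto simp: letters_def\<close>)
  next
    case False
    show ?thesis
    proof (rule reduces_trans[OF sort_reduces[of ?X ?Y]], goal_cases)
      case (1 b y x)
      then show ?case using swap_reduces(1) k by auto
    next
      case (4 u)
      \<comment> \<open>Each \<open>E (k - 1)\<close> lowers the \<open>k\<close>-th coordinate by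
        one, and there is no \<open>E k\<close> to restore it.\<close>
      have "k \<notin> set es" using es(2) by auto
      then have "(lam + weight (map SE es @ b)) k < 0"
        using False k by (simp add: weight_append weight_SE)
      then have "reduces b (map SE es) {}" using k by (intro vanish_reduces[of k]) auto
      then have "reduces b (map SF fs @ map SE es) ?W" by (rule reduces_prefix) simp
      then show ?case using 4 smaller es fs by auto
    qed (use less.prems in \<open>auto simp: letters_def\<close>)
  qed
qed

text \<open>Recovers summands from partial sums. The subtraction of naturals is faithful only where
  \<open>f\<close> is nondecreasing; the case \<open>i = 1\<close> starts from zero whatever
  \<open>f 0\<close> is.\<close>

definition incr :: "(nat \<Rightarrow> nat) \<Rightarrow> nat \<Rightarrow> nat"
  where "incr f i = f i - (if i = 1 then 0 else f (i - 1))"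

lemma sum_incr: "(\<And>i'. 1 \<le> i' \<Longrightarrow> i' < i \<Longrightarrow> f i' \<le> f (Suc i')) \<Longrightarrow> 1 \<le> i \<Longrightarrow> sum (incr f) {1..i} = f i"
proof (induction i)
  case (Suc i)
  show ?case
  proof (cases "i = 0")
    case False
    then have "sum (incr f) {1..i} = f i" using Suc by simp
    then show ?thesis using False Suc.prems(1)[of i] by (simp add: incr_def)
  qed (simp add: incr_def)
qed simp

text \<open>A word is peeled from both sides: the \<open>E\<close> give the outer left factor of
  stage \<open>k + 1\<close>, the \<open>F\<close> its outer right factor, and the letters left
  between them have smaller index. The induction hypothesis is applied to this middle part with the
  outer F-factor added to the right context, so that its column bounds refer to the shifted
  weight.\<close>

theorem word_reduces_xword:
  assumes "k \<le> n" and "set w \<subseteq> letters k"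
  shows "reduces b w {xword k A |A. A \<in> col_mats k (lam + weight b)}"
  using assms
proof (induction k arbitrary: b w)
  case 0
  then have "w = xword 0 (\<lambda>i j. 0)" by (simp add: letters_def)
  moreover have "(\<lambda>i j. 0) \<in> col_mats 0 (lam + weight b)" by (simp add: col_mats_def)
  ultimately show ?case by (intro reduces_mem) blast
next
  case (Suc k)
  let ?K = "Suc k" and ?\<mu> = "lam + weight b"
  let ?W = "{xword ?K A |A. A \<in> col_mats ?K ?\<mu>}"
  show ?case
  proof (cases "k = 0")
    case True
    have w: "w = xword ?K (\<lambda>i j. 0)" using Suc.prems True by (simp add: letters_def)
    show ?thesis
    \<comment> \<open>There are no letters yet. The zero matrix is admissible unless the weight
      itself is negative, and then the word vanishes.\<close>
    proof (cases "?\<mu> 1 < 0")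
      case True
      then show ?thesis using vanish_reduces[of 1 w b] Suc.prems w
        by (simp add: weight_append weight_Nil \<open>k = 0\<close>)
    next
      case False
      then have "(\<lambda>i j. 0) \<in> col_mats ?K ?\<mu>" using True by (simp add: col_mats_def)
      then show ?thesis using w by (intro reduces_mem) blast
    qed
  next
    case False
    then have K: "2 \<le> ?K" "?K \<le> n" using Suc.prems by auto
    interpret E: serre_words scale J ev SE n t by (rule serre_E)
    interpret F: serre_words scale J ev SF n t by (rule serre_F)
    interpret R: serre_words scale J "ev \<circ> rev" SF n t by (rule F.serre_words_rev)
    show ?thesis
    proof (rule reduces_trans[OF triangular_reduces[OF K Suc.prems(2)]])
      fix u assume "u \<in> {map SE es @ map SF fs |es fs. set es \<subseteq> {1..<?K} \<and> set fs \<subseteq> {1..<?K} \<and>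
        int (count_list es (?K - 1)) \<le> ?\<mu> ?K}"
      then obtain es fs where u: "u = map SE es @ map SF fs"
        and es: "set es \<subseteq> {1..<?K}" and fs: "set fs \<subseteq> {1..<?K}"
        and cnt: "int (count_list es k) \<le> ?\<mu> ?K" by auto
      have "reduces b (map SE es @ map SF fs) ?W"
      proof (rule reduces_suffix[OF E.word_reduces_seg[OF K es]])
        fix u assume "u \<in> {map SE (seg 1 ?K g) @ map SE q |g q. set q \<subseteq> {1..<?K - 1} \<and>
          g (?K - 1) = count_list es (?K - 1) \<and> (\<forall>i. 1 \<le> i \<and> i < ?K - 1 \<longrightarrow> g i \<le> g (Suc i))}"
        then obtain g q where u: "u = map SE (seg 1 ?K g) @ map SE q" and q: "set q \<subseteq> {1..<k}"
          and g: "g k = count_list es k" "\<And>i. 1 \<le> i \<Longrightarrow> i < k \<Longrightarrow> g i \<le> g (Suc i)" by auto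
        \<comment> \<open>The F-word is normalized from its right end, by applying the stage lemma
          to the reversed word.\<close>
        have "reduces b (rev (map SF (rev fs))) (rev ` {map SF (seg 1 ?K c) @ map SF q |c q.
          set q \<subseteq> {1..<?K - 1} \<and> c (?K - 1) = count_list (rev fs) (?K - 1) \<and>
          (\<forall>i. 1 \<le> i \<and> i < ?K - 1 \<longrightarrow> c i \<le> c (Suc i))})"
          by (rule reduces_rev, rule R.word_reduces_seg[OF K]) (use fs in simp)
        then have "reduces b (map SF fs) (rev ` {map SF (seg 1 ?K c) @ map SF q |c q.
          set q \<subseteq> {1..<?K - 1} \<and> c (?K - 1) = count_list (rev fs) (?K - 1) \<and>
          (\<forall>i. 1 \<le> i \<and> i < ?K - 1 \<longrightarrow> c i \<le> c (Suc i))})"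
          by (simp add: rev_map)
        then have "reduces b (u @ map SF fs) ?W"
        proof (rule reduces_prefix)
          fix u' assume "u' \<in> rev ` {map SF (seg 1 ?K c) @ map SF q |c q.
            set q \<subseteq> {1..<?K - 1} \<and> c (?K - 1) = count_list (rev fs) (?K - 1) \<and>
            (\<forall>i. 1 \<le> i \<and> i < ?K - 1 \<longrightarrow> c i \<le> c (Suc i))}"
          then obtain c q' where u': "u' = map SF (rev q') @ map SF (rev (seg 1 ?K c))"
            and q': "set q' \<subseteq> {1..<k}" and c: "\<And>i. 1 \<le> i \<Longrightarrow> i < k \<Longrightarrow> c i \<le> c (Suc i)"
            by (auto simp: rev_map)
          let ?F = "map SF (rev (seg 1 ?K c))"
          let ?\<mu>' = "lam + weight (?F @ b)"
          have qq: "set (map SE q @ map SF (rev q')) \<subseteq> letters k"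
            using q q' by (auto simp: letters_def)
          have "reduces b (map SE (seg 1 ?K g) @ (map SE q @ map SF (rev q')) @ ?F) ?W"
          proof (rule reduces_ctx[OF Suc.IH[OF _ qq]], goal_cases)
            case (2 w')
            then obtain A' where A': "w' = xword k A'" "A' \<in> col_mats k ?\<mu>'" by blast
            \<comment> \<open>The E-exponents determine column \<open>k + 1\<close> and the
              F-exponents row \<open>k + 1\<close>; the rest is the matrix of the middle
              word.\<close>
            define A where "A i j = (if i \<in> {1..k} \<and> j = ?K then incr g i else
              if j \<in> {1..k} \<and> i = ?K then incr c j else A' i j)" for i j
            have A'0: "A' i j = 0" if "\<not> (i \<in> {1..k} \<and> j \<in> {1..k} \<and> i \<noteq> j)" for i j
              using A'(2) that unfolding col_mats_def by blast
            have colK: "(\<Sum>i'=1..i. A i' ?K) = g i" if "1 \<le> i" "i \<le> k" for i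
              using sum_incr[of i g] g(2) that by (simp add: A_def)
            have rowK: "(\<Sum>j'=1..j. A ?K j') = c j" if "1 \<le> j" "j \<le> k" for j
              using sum_incr[of j c] c that by (simp add: A_def)
            have "xword ?K A = map SE (seg 1 ?K g) @ xword k A @ ?F"
            proof -
              have "seg 1 ?K (\<lambda>i. \<Sum>i'=1..i. A i' ?K) = seg 1 ?K g"
                "seg 1 ?K (\<lambda>j. \<Sum>j'=1..j. A ?K j') = seg 1 ?K c"
                using colK rowK by (auto intro!: seg_cong simp del: One_nat_def)
              then show ?thesis by (simp only: xword.simps)
            qed
            also have "xword k A = xword k A'" by (rule xword_cong) (auto simp: A_def)
            finally have 1: "map SE (seg 1 ?K g) @ w' @ ?F = xword ?K A" using A' by simp
            have "A \<in> col_mats ?K ?\<mu>"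
              unfolding col_mats_def
            proof (intro CollectI conjI allI impI ballI)
              fix i j assume "A i j \<noteq> 0"
              moreover have "A' i j = 0 \<or> i \<in> {1..k} \<and> j \<in> {1..k} \<and> i \<noteq> j"
                by (cases "A' i j = 0") (use A'0[of i j] in argo)+
              ultimately show "i \<in> {1..?K}" "j \<in> {1..?K}" "i \<noteq> j"
                by (auto simp: A_def split: if_splits)
            next
              fix j assume j: "j \<in> {1..?K}"
              show "int (\<Sum>i=1..?K. A i j) \<le> ?\<mu> j"
              proof (cases "j = ?K")
                case True
                have "A ?K ?K = 0" using A'0[of ?K ?K] by (auto simp: A_def)
                \<comment> \<open>The full column sum is the last exponent \<open>g k\<close>, the
                  number of letters \<open>E k\<close>, which \<open>triangular_reduces\<close> has
                  bounded.\<close>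
                then show ?thesis using colK[of k] cnt g(1) True False by simp
              next
                case jk: False
                then have j: "1 \<le> j" "j \<le> k" using j by auto
                have "(\<Sum>i=1..k. A i j) = (\<Sum>i=1..k. A' i j)"
                  using j by (intro sum.cong) (auto simp: A_def)
                then have 1: "(\<Sum>i=1..?K. A i j) = (\<Sum>i=1..k. A' i j) + incr c j"
                  using j by (simp add: A_def)
                have "int (\<Sum>i=1..k. A' i j) \<le> ?\<mu>' j"
                  using A'(2) j unfolding col_mats_def by simp
                \<comment> \<open>The F-factor lowers coordinate \<open>j\<close> by exactly the new
                  entry of column \<open>j\<close>, which leaves the room needed for it.\<close>
                moreover have "?\<mu>' j = ?\<mu> j - int (incr c j)"
                  using j c[of "j - 1"]
                  by (auto simp: weight_append weight_SF count_list_seg incr_def of_nat_diff)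
                ultimately show ?thesis unfolding 1 by simp
              qed
            qed
            then show ?case unfolding 1 by (intro reduces_mem) blast
          qed (use Suc.prems in simp)
          then show "reduces b (u @ u') ?W" using u u' by simp
        qed
        then show "reduces b (u @ map SF fs) ?W" .
      qed
      then show "reduces b u ?W" using u by simp
    qed
  qed
qed

end

section \<open>Matrix algebras, free algebras and evaluation\<close>

definition mat_mult :: "'b set \<Rightarrow> ('b \<Rightarrow> 'b \<Rightarrow> 'k::field) \<Rightarrow> ('b \<Rightarrow> 'b \<Rightarrow> 'k) \<Rightarrow> 'b \<Rightarrow> 'b \<Rightarrow> 'k"
  where "mat_mult B M N = (\<lambda>a b. \<Sum>c\<in>B. M a c * N c b)"

definition mat_one :: "'b set \<Rightarrow> 'b \<Rightarrow> 'b \<Rightarrow> 'k::field"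
  where "mat_one B = (\<lambda>a b. of_bool (a = b \<and> a \<in> B))"

text \<open>Turns the record operations into plain functions, so that ring identities can be checked
  entrywise.\<close>

lemma mat_alg_simps [simp]:
  "monoid.mult (mat_alg B) = mat_mult B" "monoid.one (mat_alg B) = mat_one B"
  "zero (mat_alg B) = 0" "add (mat_alg B) = (+)"
  "module.smult (mat_alg B) = (\<lambda>c M a b. c * M a b)"
  by (auto simp: mat_alg_def mat_mult_def mat_one_def fun_eq_iff)

lemma carrier_mat_alg: "M \<in> carrier (mat_alg B) \<longleftrightarrow> (\<forall>a b. M a b \<noteq> 0 \<longrightarrow> a \<in> B \<and> b \<in> B)"
  by (simp add: mat_alg_def)

lemma mat_mult_assoc: "mat_mult B (mat_mult B L M) N = mat_mult B L (mat_mult B M N)"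
proof (intro ext)
  fix a b
  have "mat_mult B (mat_mult B L M) N a b = (\<Sum>d\<in>B. \<Sum>c\<in>B. L a c * M c d * N d b)"
    by (simp add: mat_mult_def sum_distrib_right)
  also have "\<dots> = (\<Sum>c\<in>B. \<Sum>d\<in>B. L a c * M c d * N d b)" by (rule sum.swap)
  also have "\<dots> = mat_mult B L (mat_mult B M N) a b"
    by (simp add: mat_mult_def sum_distrib_left mult.assoc)
  finally show "mat_mult B (mat_mult B L M) N a b = mat_mult B L (mat_mult B M N) a b" .
qed

lemma mat_mult_distrib:
  "mat_mult B (L + M) N = mat_mult B L N + mat_mult B M N"
  "mat_mult B L (M + N) = mat_mult B L M + mat_mult B L N"
  by (auto simp: mat_mult_def fun_eq_iff algebra_simps sum.distrib)

lemma mat_mult_one: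
  assumes "finite B" "M \<in> carrier (mat_alg B)"
  shows "mat_mult B (mat_one B) M = M" "mat_mult B M (mat_one B) = M"
proof -
  have "mat_mult B (mat_one B) M a b = M a b" for a b
  proof -
    have "mat_mult B (mat_one B) M a b = (\<Sum>c\<in>B. if c = a then M a b else 0)"
      unfolding mat_mult_def mat_one_def by (intro sum.cong) auto
    also have "\<dots> = M a b" using assms by (auto simp: carrier_mat_alg)
    finally show ?thesis .
  qed
  then show "mat_mult B (mat_one B) M = M" by (intro ext)
  have "mat_mult B M (mat_one B) a b = M a b" for a b
  proof -
    have "mat_mult B M (mat_one B) a b = (\<Sum>c\<in>B. if c = b then M a b else 0)"
      unfolding mat_mult_def mat_one_def by (intro sum.cong) auto
    also have "\<dots> = M a b" using assms by (auto simp: carrier_mat_alg)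
    finally show ?thesis .
  qed
  then show "mat_mult B M (mat_one B) = M" by (intro ext)
qed

lemma mat_mult_closed:
  assumes "M \<in> carrier (mat_alg B)" "N \<in> carrier (mat_alg B)"
  shows "mat_mult B M N \<in> carrier (mat_alg B)"
proof -
  have "a \<in> B \<and> b \<in> B" if nz: "mat_mult B M N a b \<noteq> 0" for a b
  proof -
    obtain c where "M a c * N c b \<noteq> 0"
      using nz unfolding mat_mult_def by (metis (mono_tags, lifting) sum.neutral)
    then show ?thesis using assms unfolding carrier_mat_alg by auto
  qed
  then show ?thesis unfolding carrier_mat_alg by blast
qed

lemma mat_one_closed: "mat_one B \<in> carrier (mat_alg B)"
  by (simp add: carrier_mat_alg mat_one_def)

lemma mat_scale_closed:
  "M \<in> carrier (mat_alg B) \<Longrightarrow> (\<lambda>a b. c * M a b) \<in> carrier (mat_alg B)"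
  unfolding carrier_mat_alg by auto

lemma ring_mat_alg:
  assumes "finite B"
  shows "ring (mat_alg B :: ('k::field, 'b \<Rightarrow> 'b \<Rightarrow> 'k) module)" (is "ring ?M")
proof (rule ringI)
  show "abelian_group ?M"
  proof (rule abelian_groupI)
    fix M :: "'b \<Rightarrow> 'b \<Rightarrow> 'k" assume M: "M \<in> carrier (mat_alg B)"
    have "- M \<in> carrier (mat_alg B)" using M unfolding carrier_mat_alg by simp
    then show "\<exists>y\<in>carrier (mat_alg B). y \<oplus>\<^bsub>mat_alg B\<^esub> M = \<zero>\<^bsub>mat_alg B\<^esub>"
      by (intro bexI[of _ "- M"]) auto
  next
    fix M N :: "'b \<Rightarrow> 'b \<Rightarrow> 'k" assume "M \<in> carrier (mat_alg B)" "N \<in> carrier (mat_alg B)"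
    then show "M \<oplus>\<^bsub>mat_alg B\<^esub> N \<in> carrier (mat_alg B)"
      unfolding carrier_mat_alg by (simp, metis add_0)
  qed (auto simp: carrier_mat_alg algebra_simps)
  show "monoid ?M"
    by (rule monoidI) (use assms in \<open>auto simp: mat_mult_closed mat_one_closed mat_mult_assoc mat_mult_one\<close>)
qed (auto simp: mat_mult_distrib)

text \<open>The difference in a ring record is defined through an abstract additive inverse; this
  identifies it with a concrete candidate.\<close>

lemma (in ring) minus_eqI:
  assumes "x \<in> carrier R" "y \<in> carrier R" "z \<in> carrier R" "z \<oplus> y = x"
  shows "x \<ominus> y = z"
proof -
  have "x \<ominus> y = (z \<oplus> y) \<oplus> \<ominus> y" by (simp only: a_minus_def assms(4))
  also have "\<dots> = z" using assms(1-3) by (simp add: a_assoc r_neg)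
  finally show ?thesis .
qed

section \<open>The free algebra as a convolution algebra\<close>

definition conv :: "('g list \<Rightarrow> 'k::field) \<Rightarrow> ('g list \<Rightarrow> 'k) \<Rightarrow> 'g list \<Rightarrow> 'k"
  where "conv p q = (\<lambda>w. \<Sum>k\<le>length w. p (take k w) * q (drop k w))"

definition basis_word :: "'g list \<Rightarrow> 'g list \<Rightarrow> 'k::field"
  where "basis_word u = (\<lambda>w. of_bool (w = u))"

lemma free_gen_eq_basis_word: "free_gen g = basis_word [g]"
  by (simp add: free_gen_def basis_word_def)

lemma free_alg_simps [simp]:
  "monoid.mult (free_alg S) = conv" "monoid.one (free_alg S) = basis_word []"
  "zero (free_alg S) = 0" "add (free_alg S) = (+)"
  "module.smult (free_alg S) = (\<lambda>c p w. c * p w)"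
  by (auto simp: free_alg_def conv_def basis_word_def fun_eq_iff)

lemma carrier_free_alg:
  "p \<in> carrier (free_alg S) \<longleftrightarrow> finite {w. p w \<noteq> 0} \<and> (\<forall>w. p w \<noteq> 0 \<longrightarrow> set w \<subseteq> S)"
  by (simp add: free_alg_def)

text \<open>Both sides sum over the ways of cutting \<open>w\<close> into three pieces, indexed by
  the lengths of the first two.\<close>

lemma conv_assoc: "conv (conv p q) r = conv p (conv q r)"
proof
  fix w
  define f where "f j i = p (take j w) * q (take i (drop j w)) * r (drop (i + j) w)" for j i
  have "conv (conv p q) r w = (\<Sum>k\<le>length w. \<Sum>j\<le>k. f j (k - j))"
    unfolding conv_def sum_distrib_right
    by (intro sum.cong refl) (auto simp: f_def min_def drop_take)
  also have "\<dots> = (\<Sum>(i, j)\<in>{(i, j). i + j \<le> length w}. f i j)"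
    by (rule sum.triangle_reindex_eq[symmetric])
  also have "{(i, j). i + j \<le> length w} = (SIGMA i:{..length w}. {..length w - i})"
    by auto
  also have "(\<Sum>(i, j)\<in>\<dots>. f i j) = (\<Sum>i\<le>length w. \<Sum>j\<le>length w - i. f i j)"
    by (simp add: sum.Sigma)
  also have "\<dots> = conv p (conv q r) w"
    unfolding conv_def sum_distrib_left
    by (intro sum.cong refl) (auto simp: f_def mult.assoc)
  finally show "conv (conv p q) r w = conv p (conv q r) w" .
qed

lemma conv_distrib: "conv (p + q) r = conv p r + conv q r" "conv p (q + r) = conv p q + conv p r"
  by (auto simp: conv_def fun_eq_iff algebra_simps sum.distrib)

lemma conv_scale: "conv (\<lambda>w. c * p w) q = (\<lambda>w. c * conv p q w)" "conv p (\<lambda>w. c * q w) = (\<lambda>w. c * conv p q w)"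
  by (auto simp: conv_def fun_eq_iff sum_distrib_left algebra_simps)

lemma conv_minus: "conv (p - q) r = conv p r - conv q r" "conv p (q - r) = conv p q - conv p r"
  by (auto simp: conv_def fun_eq_iff algebra_simps sum_subtractf)

lemma conv_zero [simp]: "conv 0 p = 0" "conv p 0 = 0"
  by (auto simp: conv_def fun_eq_iff)

lemma conv_basis_word: "conv (basis_word u) (basis_word w) = basis_word (u @ w)"
proof
  fix x
  have "conv (basis_word u) (basis_word w) x =
    (\<Sum>k\<le>length x. if k = length u then of_bool (x = u @ w) else 0 :: 'b)"
    unfolding conv_def basis_word_def
    by (intro sum.cong refl) (auto simp: append_eq_conv_conj min_def, metis append_take_drop_id)
  also have "\<dots> = basis_word (u @ w) x" by (auto simp: basis_word_def)
  finally show "conv (basis_word u) (basis_word w) x = (basis_word (u @ w) x :: 'b)" .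
qed

lemma conv_one [simp]: "conv (basis_word []) p = p" "conv p (basis_word []) = p"
proof -
  show "conv (basis_word []) p = p"
  proof
    fix x
    have "conv (basis_word []) p x = (\<Sum>k\<le>length x. if k = 0 then p x else 0)"
      unfolding conv_def basis_word_def by (intro sum.cong refl) auto
    then show "conv (basis_word []) p x = p x" by simp
  qed
  show "conv p (basis_word []) = p"
  proof
    fix x
    have "conv p (basis_word []) x = (\<Sum>k\<le>length x. if k = length x then p x else 0)"
      unfolding conv_def basis_word_def by (intro sum.cong refl) auto
    then show "conv p (basis_word []) x = p x" by simp
  qed
qed

lemma conv_nonzero:
  assumes "conv p q w \<noteq> 0"
  obtains x y where "w = x @ y" "p x \<noteq> 0" "q y \<noteq> 0"
proof -
  have "\<exists>k\<le>length w. p (take k w) * q (drop k w) \<noteq> 0"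
    using assms sum.neutral[of "{..length w}" "\<lambda>k. p (take k w) * q (drop k w)"]
    unfolding conv_def by auto
  then show ?thesis using that by (metis append_take_drop_id mult_eq_0_iff)
qed

lemma support_conv:
  "{w. conv p q w \<noteq> 0} \<subseteq> (\<lambda>(x, y). x @ y) ` ({w. p w \<noteq> 0} \<times> {w. q w \<noteq> 0})"
  by (auto elim!: conv_nonzero)

lemma conv_closed:
  assumes "p \<in> carrier (free_alg S)" "q \<in> carrier (free_alg S)"
  shows "conv p q \<in> carrier (free_alg S)"
proof -
  have "set w \<subseteq> S" if "conv p q w \<noteq> 0" for w
    using that assms unfolding carrier_free_alg by (elim conv_nonzero) auto
  then show ?thesis
    using assms support_conv[of p q] unfolding carrier_free_alg
    by (meson finite_SigmaI finite_imageI finite_subset)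
qed

lemma basis_word_closed: "set u \<subseteq> S \<Longrightarrow> basis_word u \<in> carrier (free_alg S)"
  by (auto simp: carrier_free_alg basis_word_def)

lemma free_add_closed:
  assumes "p \<in> carrier (free_alg S)" "q \<in> carrier (free_alg S)"
  shows "p + q \<in> carrier (free_alg S)"
proof -
  have "finite {w. (p + q) w \<noteq> 0}"
    by (rule finite_subset[of _ "{w. p w \<noteq> 0} \<union> {w. q w \<noteq> 0}"])
      (use assms in \<open>auto simp: carrier_free_alg\<close>)
  moreover have "set w \<subseteq> S" if "(p + q) w \<noteq> 0" for w
  proof -
    have "p w \<noteq> 0 \<or> q w \<noteq> 0" using that by auto
    then show ?thesis using assms unfolding carrier_free_alg by blast
  qed
  ultimately show ?thesis unfolding carrier_free_alg by blast
qed

lemma free_scale_closed: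
  assumes "p \<in> carrier (free_alg S)"
  shows "(\<lambda>w. c * p w) \<in> carrier (free_alg S)"
  using assms unfolding carrier_free_alg by (auto elim: rev_finite_subset)

lemma free_minus_closed:
  assumes "p \<in> carrier (free_alg S)" "q \<in> carrier (free_alg S)"
  shows "p - q \<in> carrier (free_alg S)"
proof -
  have "p - q = p + (\<lambda>w. - 1 * q w)" by auto
  then show ?thesis using free_add_closed[OF assms(1) free_scale_closed[OF assms(2)]] by metis
qed

lemma ring_free_alg: "ring (free_alg S :: ('k::field, 'g list \<Rightarrow> 'k) module)"
proof (rule ringI)
  let ?F = "free_alg S :: ('k, 'g list \<Rightarrow> 'k) module"
  have zero: "0 \<in> carrier ?F" by (simp add: carrier_free_alg)
  show "abelian_group ?F"
  proof (rule abelian_groupI)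
    fix p assume "p \<in> carrier ?F"
    then have "0 - p \<in> carrier ?F" using zero free_minus_closed by blast
    then show "\<exists>y\<in>carrier ?F. y \<oplus>\<^bsub>?F\<^esub> p = \<zero>\<^bsub>?F\<^esub>" by (intro bexI[of _ "0 - p"]) auto
  qed (auto simp: zero free_add_closed algebra_simps)
  show "monoid ?F"
    by (rule monoidI) (auto simp: conv_closed basis_word_closed conv_assoc)
qed (auto simp: conv_distrib)

lemma free_a_minus:
  assumes "p \<in> carrier (free_alg S)" "q \<in> carrier (free_alg S)"
  shows "p \<ominus>\<^bsub>free_alg S\<^esub> q = p - q"
  using ring.minus_eqI[OF ring_free_alg, of p S q "p - q"] assms by (simp add: free_minus_closed)

section \<open>Evaluation of noncommutative polynomials at matrices\<close>

definition eval_mat :: "'b set \<Rightarrow> ('g \<Rightarrow> 'b \<Rightarrow> 'b \<Rightarrow> 'k::field) \<Rightarrow> ('g list \<Rightarrow> 'k) \<Rightarrow> 'b \<Rightarrow> 'b \<Rightarrow> 'k"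
  where "eval_mat B f p = (\<lambda>a b. \<Sum>w | p w \<noteq> 0. p w * word_prod (mat_alg B) f w a b)"

lemma word_prod_simps [simp]:
  "word_prod A f [] = \<one>\<^bsub>A\<^esub>" "word_prod A f (g # w) = f g \<otimes>\<^bsub>A\<^esub> word_prod A f w"
  by (simp_all add: word_prod_def)

lemma word_prod_closed:
  "monoid A \<Longrightarrow> f ` set w \<subseteq> carrier A \<Longrightarrow> word_prod A f w \<in> carrier A"
  by (induction w) (auto intro: monoid.m_closed monoid.one_closed)

lemma word_prod_append:
  "monoid A \<Longrightarrow> f ` (set u \<union> set w) \<subseteq> carrier A \<Longrightarrow>
    word_prod A f (u @ w) = word_prod A f u \<otimes>\<^bsub>A\<^esub> word_prod A f w"
  by (induction u) (auto simp: word_prod_closed monoid.m_assoc monoid.l_one image_Un)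

lemma finsum_mat:
  fixes g :: "'w \<Rightarrow> 'b \<Rightarrow> 'b \<Rightarrow> 'k::field"
  assumes "finite B" "finite W" "\<And>w. w \<in> W \<Longrightarrow> g w \<in> carrier (mat_alg B)"
  shows "finsum (mat_alg B) g W = (\<lambda>a b. \<Sum>w\<in>W. g w a b)"
proof -
  interpret ring "mat_alg B :: ('k, 'b \<Rightarrow> 'b \<Rightarrow> 'k) module" by (rule ring_mat_alg[OF assms(1)])
  show ?thesis
    using assms(2,3)
  proof (induction W)
    case (insert w W)
    then have "finsum (mat_alg B) g (insert w W) = g w + finsum (mat_alg B) g W"
      by (subst finsum_insert) auto
    then show ?case using insert by (auto simp: fun_eq_iff)
  qed (auto simp: fun_eq_iff)
qed

lemma eval_alg_mat:
  assumes "finite B" "f ` S \<subseteq> carrier (mat_alg B)" "p \<in> carrier (free_alg S)"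
  shows "eval_alg (mat_alg B) f p = eval_mat B f p"
proof -
  have "p w \<noteq> 0 \<Longrightarrow> word_prod (mat_alg B) f w \<in> carrier (mat_alg B)" for w
    using assms(2,3) unfolding carrier_free_alg
    by (intro word_prod_closed ring.is_monoid ring_mat_alg assms(1)) blast
  then show ?thesis
    using assms(1,3) unfolding eval_alg_def eval_mat_def carrier_free_alg
    by (subst finsum_mat) (auto simp: mat_scale_closed)
qed

text \<open>Cancellation can make the support of a sum or product smaller than expected; a larger
  common range of summation avoids tracking it.\<close>

lemma eval_mat_superset:
  assumes "finite Z" "{w. p w \<noteq> 0} \<subseteq> Z"
  shows "eval_mat B f p a b = (\<Sum>w\<in>Z. p w * word_prod (mat_alg B) f w a b)"
  unfolding eval_mat_def using assms by (intro sum.mono_neutral_left) auto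

lemma eval_mat_add:
  assumes "finite {w. p w \<noteq> 0}" "finite {w. q w \<noteq> 0}"
  shows "eval_mat B f (p + q) = eval_mat B f p + eval_mat B f q"
proof (intro ext)
  fix a b
  let ?Z = "{w. p w \<noteq> 0} \<union> {w. q w \<noteq> 0}"
  have "finite ?Z" "{w. (p + q) w \<noteq> 0} \<subseteq> ?Z" using assms by auto
  then show "eval_mat B f (p + q) a b = (eval_mat B f p + eval_mat B f q) a b"
    using eval_mat_superset[of ?Z "p + q" B f a b] eval_mat_superset[of ?Z p B f a b]
      eval_mat_superset[of ?Z q B f a b]
    by (simp add: sum.distrib algebra_simps)
qed

lemma eval_mat_scale: "eval_mat B f (\<lambda>w. c * p w) = (\<lambda>a b. c * eval_mat B f p a b)"
  by (cases "c = 0") (auto simp: eval_mat_def sum_distrib_left mult.assoc)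

lemma eval_mat_zero [simp]: "eval_mat B f 0 = 0"
  by (auto simp: eval_mat_def fun_eq_iff)

lemma eval_mat_minus:
  assumes "finite {w. p w \<noteq> 0}" "finite {w. q w \<noteq> 0}"
  shows "eval_mat B f (p - q) = eval_mat B f p - eval_mat B f q"
proof -
  have *: "p - q = p + (\<lambda>w. - 1 * q w)" by auto
  show ?thesis
    unfolding * using assms eval_mat_add[of p "\<lambda>w. - 1 * q w" B f] eval_mat_scale[of B f "- 1" q]
    by (auto simp: fun_eq_iff)
qed

lemma eval_mat_basis_word: "eval_mat B f (basis_word u) = word_prod (mat_alg B) f u"
proof -
  have "{w. (basis_word u :: 'c list \<Rightarrow> 'b) w \<noteq> 0} = {u}" by (auto simp: basis_word_def)
  then show ?thesis unfolding eval_mat_def by (simp add: basis_word_def)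
qed

text \<open>A word with a cut position is the same as a pair of words, so the double sum for the
  product regroups into a sum over pairs from the two supports.\<close>

lemma eval_mat_conv:
  assumes B: "finite B" and f: "f ` S \<subseteq> carrier (mat_alg B)"
    and p: "p \<in> carrier (free_alg S)" and q: "q \<in> carrier (free_alg S)"
  shows "eval_mat B f (conv p q) = mat_mult B (eval_mat B f p) (eval_mat B f q)"
proof (intro ext)
  fix a b
  let ?P = "{w. p w \<noteq> 0}" and ?Q = "{w. q w \<noteq> 0}"
  let ?X = "word_prod (mat_alg B) f"
  let ?g = "\<lambda>(x, y). p x * q y * ?X (x @ y) a b"
  define Z where "Z = (\<lambda>(x, y). x @ y) ` (?P \<times> ?Q)"
  have fin: "finite ?P" "finite ?Q" using p q by (auto simp: carrier_free_alg)
  then have finZ: "finite Z" by (simp add: Z_def)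
  have ZI: "x @ y \<in> Z" if "p x \<noteq> 0" "q y \<noteq> 0" for x y
    using that unfolding Z_def by force
  have finS: "finite {(w, k). w \<in> Z \<and> k \<le> length w \<and> (take k w, drop k w) \<notin> ?P \<times> ?Q}"
    by (rule finite_subset[of _ "SIGMA w:Z. {..length w}"]) (use finZ in auto)
  have sub: "{w. conv p q w \<noteq> 0} \<subseteq> Z" unfolding Z_def by (rule support_conv)
  have "eval_mat B f (conv p q) a b = (\<Sum>w\<in>Z. \<Sum>k\<le>length w. ?g (take k w, drop k w))"
    unfolding eval_mat_superset[OF finZ sub]
    by (simp add: conv_def sum_distrib_right)
  also have "\<dots> = (\<Sum>(w, k)\<in>(SIGMA w:Z. {..length w}). ?g (take k w, drop k w))"
    using finZ by (simp add: sum.Sigma)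
  \<comment> \<open>Cuts with a piece outside the supports contribute zero and are discarded; the
    others correspond to pairs by concatenation.\<close>
  also have "\<dots> = sum ?g (?P \<times> ?Q)"
    by (rule sum.reindex_bij_witness_not_neutral[where
          S' = "{(w, k). w \<in> Z \<and> k \<le> length w \<and> (take k w, drop k w) \<notin> ?P \<times> ?Q}" and T' = "{}"
          and j = "\<lambda>(w, k). (take k w, drop k w)" and i = "\<lambda>(x, y). (x @ y, length x)"])
      (use finS ZI in auto)
  also have "\<dots> = (\<Sum>x\<in>?P. \<Sum>y\<in>?Q. p x * q y * mat_mult B (?X x) (?X y) a b)"
  proof (subst sum.cartesian_product[symmetric], intro sum.cong refl)
    fix x y assume "x \<in> ?P" "y \<in> ?Q"
    then have "f ` (set x \<union> set y) \<subseteq> carrier (mat_alg B)" using p q f unfolding carrier_free_alg by blast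
    then show "p x * q y * ?X (x @ y) a b = p x * q y * mat_mult B (?X x) (?X y) a b"
      by (subst word_prod_append) (auto intro: ring.is_monoid ring_mat_alg B)
  qed
  also have "\<dots> = (\<Sum>x\<in>?P. \<Sum>y\<in>?Q. \<Sum>c\<in>B. p x * q y * (?X x a c * ?X y c b))"
    by (simp add: mat_mult_def sum_distrib_left)
  also have "\<dots> = (\<Sum>x\<in>?P. \<Sum>c\<in>B. \<Sum>y\<in>?Q. p x * q y * (?X x a c * ?X y c b))"
    by (intro sum.cong refl sum.swap)
  also have "\<dots> = (\<Sum>c\<in>B. \<Sum>x\<in>?P. \<Sum>y\<in>?Q. p x * q y * (?X x a c * ?X y c b))"
    by (rule sum.swap)
  also have "\<dots> = mat_mult B (eval_mat B f p) (eval_mat B f q) a b"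
    unfolding mat_mult_def eval_mat_def sum_product by (intro sum.cong refl) (simp add: algebra_simps)
  finally show "eval_mat B f (conv p q) a b = mat_mult B (eval_mat B f p) (eval_mat B f q) a b" .
qed

lemma eval_mat_closed:
  assumes B: "finite B" and f: "f ` S \<subseteq> carrier (mat_alg B)" and p: "p \<in> carrier (free_alg S)"
  shows "eval_mat B f p \<in> carrier (mat_alg B)"
proof -
  have "word_prod (mat_alg B) f w \<in> carrier (mat_alg B)" if "p w \<noteq> 0" for w
    using p f that unfolding carrier_free_alg
    by (intro word_prod_closed ring.is_monoid ring_mat_alg B) blast
  then have "finsum (mat_alg B) (\<lambda>w a b. p w * word_prod (mat_alg B) f w a b) {w. p w \<noteq> 0}
    \<in> carrier (mat_alg B)"
    by (intro abelian_monoid.finsum_closed)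
      (use ring_mat_alg[OF B] in \<open>auto simp: mat_scale_closed ring_def abelian_group_def\<close>)
  then show ?thesis
    using p B \<open>\<And>w. p w \<noteq> 0 \<Longrightarrow> word_prod (mat_alg B) f w \<in> carrier (mat_alg B)\<close>
    unfolding eval_mat_def carrier_free_alg by (subst (asm) finsum_mat) (auto simp: mat_scale_closed)
qed

lemma eval_mat_ring_hom:
  fixes f :: "'g \<Rightarrow> 'b \<Rightarrow> 'b \<Rightarrow> 'k::field"
  assumes "finite B" "f ` S \<subseteq> carrier (mat_alg B)"
  shows "ring_hom_ring (free_alg S) (mat_alg B) (eval_mat B f)"
proof (rule ring_hom_ringI)
  show "ring (free_alg S :: ('k, 'g list \<Rightarrow> 'k) module)" by (rule ring_free_alg)
  show "ring (mat_alg B :: ('k, 'b \<Rightarrow> 'b \<Rightarrow> 'k) module)" by (rule ring_mat_alg[OF assms(1)])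
qed (use assms in \<open>auto simp: eval_mat_closed eval_mat_conv eval_mat_basis_word carrier_free_alg eval_mat_add\<close>)

text \<open>Instantiated twice: for \<open>U_gl\<close>, where it makes the representation on cosets
  well defined, and for the Schur presentation, where it provides the homomorphism onto the
  generated matrix algebra.\<close>

locale matrix_presentation =
  fixes B :: "'b set" and f :: "'g \<Rightarrow> 'b \<Rightarrow> 'b \<Rightarrow> 'k::field"
    and S :: "'g set" and R :: "(('g list \<Rightarrow> 'k) \<times> ('g list \<Rightarrow> 'k)) set"
  assumes finite_B: "finite B"
    and gens: "f ` S \<subseteq> carrier (mat_alg B)"
    and rels_closed: "R \<subseteq> carrier (free_alg S) \<times> carrier (free_alg S)"
    and rels: "(l, r) \<in> R \<Longrightarrow> eval_mat B f l = eval_mat B f r"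
begin

abbreviation (input) F :: "('k, 'g list \<Rightarrow> 'k) module" where "F \<equiv> free_alg S"

lemma hom: "ring_hom_ring F (mat_alg B) (eval_mat B f)"
  by (rule eval_mat_ring_hom[OF finite_B gens])

lemma fin_support: "p \<in> carrier F \<Longrightarrow> finite {w. p w \<noteq> 0}"
  by (simp add: carrier_free_alg)

lemma ideal_rel_ideal: "ideal (rel_ideal S R) F"
proof -
  have "{l \<ominus>\<^bsub>F\<^esub> r |l r. (l, r) \<in> R} \<subseteq> carrier F"
    using rels_closed by (auto simp: free_a_minus free_minus_closed)
  then show ?thesis unfolding rel_ideal_def by (rule ring.genideal_ideal[OF ring_free_alg])
qed

lemma rel_in_ideal: "(l, r) \<in> R \<Longrightarrow> l - r \<in> rel_ideal S R"
proof -
  assume lr: "(l, r) \<in> R"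
  have "{l \<ominus>\<^bsub>F\<^esub> r |l r. (l, r) \<in> R} \<subseteq> carrier F"
    using rels_closed by (auto simp: free_a_minus free_minus_closed)
  then have "l \<ominus>\<^bsub>F\<^esub> r \<in> rel_ideal S R"
    unfolding rel_ideal_def using ring.genideal_self[OF ring_free_alg] lr by blast
  then show "l - r \<in> rel_ideal S R" using lr rels_closed by (auto simp: free_a_minus)
qed

lemma rel_ideal_closed: "rel_ideal S R \<subseteq> carrier F"
  using ideal.Icarr[OF ideal_rel_ideal] by blast

lemma rel_ideal_le_kernel: "p \<in> rel_ideal S R \<Longrightarrow> eval_mat B f p = 0"
proof -
  assume p: "p \<in> rel_ideal S R"
  have "rel_ideal S R \<subseteq> a_kernel F (mat_alg B) (eval_mat B f)"
    unfolding rel_ideal_def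
  proof (rule ring.genideal_minimal[OF ring_free_alg])
    show "ideal (a_kernel F (mat_alg B) (eval_mat B f)) F"
      by (rule ring_hom_ring.kernel_is_ideal[OF hom])
    show "{l \<ominus>\<^bsub>F\<^esub> r |l r. (l, r) \<in> R} \<subseteq> a_kernel F (mat_alg B) (eval_mat B f)"
      using rels_closed rels
      by (auto simp: a_kernel_def' free_a_minus free_minus_closed eval_mat_minus fin_support)
  qed
  then show "eval_mat B f p = 0" using p by (auto simp: a_kernel_def')
qed

lemma coset_closed: "p \<in> carrier F \<Longrightarrow> q \<in> rel_ideal S R +>\<^bsub>F\<^esub> p \<Longrightarrow> q \<in> carrier F"
  using rel_ideal_closed by (auto simp: a_r_coset_def' intro: free_add_closed)

lemma eval_mat_on_coset:
  assumes "p \<in> carrier F" "q \<in> rel_ideal S R +>\<^bsub>F\<^esub> p"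
  shows "eval_mat B f q = eval_mat B f p"
proof -
  obtain h where h: "h \<in> rel_ideal S R" "q = h + p" using assms(2) by (auto simp: a_r_coset_def')
  then show ?thesis
    using assms(1) rel_ideal_closed by (auto simp: eval_mat_add fin_support rel_ideal_le_kernel)
qed

lemma self_in_coset: "p \<in> carrier F \<Longrightarrow> p \<in> rel_ideal S R +>\<^bsub>F\<^esub> p"
proof -
  have "0 \<in> rel_ideal S R"
    using additive_subgroup.zero_closed[OF ideal.axioms(1)[OF ideal_rel_ideal]] by simp
  then show ?thesis by (force simp: a_r_coset_def')
qed

text \<open>Evaluation maps a coset to a singleton. The version with \<open>eval_alg\<close> fits
  \<open>tensor_rep\<close>, the one with \<open>eval_mat\<close> fits the isomorphism from a
  quotient ring.\<close>

lemma eval_coset: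
  assumes "p \<in> carrier F"
  shows "the_elem (eval_mat B f ` (rel_ideal S R +>\<^bsub>F\<^esub> p)) = eval_mat B f p"
    and "the_elem (eval_alg (mat_alg B) f ` (rel_ideal S R +>\<^bsub>F\<^esub> p)) = eval_mat B f p"
proof -
  have *: "eval_mat B f ` (rel_ideal S R +>\<^bsub>F\<^esub> p) = {eval_mat B f p}"
    using eval_mat_on_coset[OF assms] self_in_coset[OF assms] by blast
  then show "the_elem (eval_mat B f ` (rel_ideal S R +>\<^bsub>F\<^esub> p)) = eval_mat B f p" by simp
  have "eval_alg (mat_alg B) f ` (rel_ideal S R +>\<^bsub>F\<^esub> p) = eval_mat B f ` (rel_ideal S R +>\<^bsub>F\<^esub> p)"
    using coset_closed[OF assms] eval_alg_mat[OF finite_B gens] by (intro image_cong) auto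
  then show "the_elem (eval_alg (mat_alg B) f ` (rel_ideal S R +>\<^bsub>F\<^esub> p)) = eval_mat B f p"
    using * by simp
qed

lemma carrier_presented: "carrier (presented_alg S R) = (\<lambda>p. rel_ideal S R +>\<^bsub>F\<^esub> p) ` carrier F"
  by (auto simp: presented_alg_def quot_alg_def ring.extend_def ring.defs module.defs
      FactRing_def A_RCOSETS_def')

lemma eval_presented_gen:
  assumes "g \<in> S"
  shows "the_elem (eval_alg (mat_alg B) f ` presented_gen S R g) = f g"
proof -
  have "f g \<in> carrier (mat_alg B)" using assms gens by blast
  then show ?thesis
    unfolding presented_gen_def free_gen_eq_basis_word using assms
    by (subst eval_coset) (auto simp: basis_word_closed eval_mat_basis_word mat_mult_one finite_B)
qed

text \<open>The homomorphism theorem for rings, with compatibility with scalars added by hand, since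
  a quotient ring carries no scalar action. It reduces the presentation to one inclusion: the kernel
  of evaluation lies in the ideal of relations.\<close>

theorem presented_alg_iso:
  assumes H: "H = eval_mat B f ` carrier F"
    and inj: "\<And>p. p \<in> carrier F \<Longrightarrow> eval_mat B f p = 0 \<Longrightarrow> p \<in> rel_ideal S R"
  shows "\<exists>\<phi> \<in> alg_iso (presented_alg S R) ((mat_alg B) \<lparr>carrier := H\<rparr>).
    \<forall>g \<in> S. \<phi> (presented_gen S R g) = f g"
proof
  let ?A = "(mat_alg B) \<lparr>carrier := H\<rparr> :: ('k, 'b \<Rightarrow> 'b \<Rightarrow> 'k) module"
  let ?ev = "eval_mat B f"
  let ?\<phi> = "\<lambda>C. the_elem (?ev ` C)"
  have ring_H: "ring ?A" unfolding H by (rule ring_hom_ring.img_is_ring[OF hom])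
  have hA: "ring_hom_ring F ?A ?ev"
  proof (rule ring_hom_ringI[OF ring_free_alg ring_H])
    fix p q assume pq: "p \<in> carrier F" "q \<in> carrier F"
    then show "?ev (p \<otimes>\<^bsub>F\<^esub> q) = ?ev p \<otimes>\<^bsub>?A\<^esub> ?ev q"
      using eval_mat_conv[OF finite_B gens] by simp
    show "?ev (p \<oplus>\<^bsub>F\<^esub> q) = ?ev p \<oplus>\<^bsub>?A\<^esub> ?ev q"
      using eval_mat_add[OF fin_support fin_support] pq by simp
  qed (simp_all add: H eval_mat_basis_word)
  have ker: "a_kernel F ?A ?ev = rel_ideal S R"
    using inj rel_ideal_closed rel_ideal_le_kernel by (auto simp: a_kernel_def')
  have iso: "?\<phi> \<in> ring_iso (F Quot rel_ideal S R) ?A"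
    using ring_hom_ring.FactRing_iso_set[OF hA] H unfolding ker by simp
  have "?\<phi> \<in> ring_iso (presented_alg S R) ?A"
    using iso
    by (simp add: ring_iso_def ring_hom_def presented_alg_def quot_alg_def ring.extend_def ring.defs module.defs)
  moreover have "?\<phi> (c \<odot>\<^bsub>presented_alg S R\<^esub> C) = c \<odot>\<^bsub>?A\<^esub> ?\<phi> C"
    if C: "C \<in> carrier (presented_alg S R)" for c C
  proof -
    obtain p where p: "p \<in> carrier F" "C = rel_ideal S R +>\<^bsub>F\<^esub> p"
      using C unfolding carrier_presented by blast
    let ?s = "\<lambda>q w. c * q w"
    have "c \<odot>\<^bsub>presented_alg S R\<^esub> C = (\<Union>q\<in>C. rel_ideal S R +>\<^bsub>F\<^esub> ?s q)"
      by (simp add: presented_alg_def quot_alg_def ring.extend_def ring.defs module.defs)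
    \<comment> \<open>Scalar multiplication on cosets is a union over all representatives;
      evaluation sends all of them to the same matrix.\<close>
    moreover have "?ev ` (\<Union>q\<in>C. rel_ideal S R +>\<^bsub>F\<^esub> ?s q) = {\<lambda>a b. c * ?ev p a b}"
    proof -
      have "?ev r = (\<lambda>a b. c * ?ev p a b)" if "q \<in> C" "r \<in> rel_ideal S R +>\<^bsub>F\<^esub> ?s q" for q r
      proof -
        have "q \<in> carrier F" using that(1) p coset_closed by blast
        then have "?ev r = ?ev (?s q)" using that(2) by (intro eval_mat_on_coset free_scale_closed)
        also have "\<dots> = (\<lambda>a b. c * ?ev p a b)"
          using eval_mat_on_coset[OF p(1)] that(1) p(2) by (simp add: eval_mat_scale)
        finally show ?thesis .
      qed
      then have all: "?ev r = (\<lambda>a b. c * ?ev p a b)" if "r \<in> (\<Union>q\<in>C. rel_ideal S R +>\<^bsub>F\<^esub> ?s q)" for r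
        using that by (elim UN_E)
      have "p \<in> C" unfolding p(2) by (rule self_in_coset[OF p(1)])
      then have "?s p \<in> (\<Union>q\<in>C. rel_ideal S R +>\<^bsub>F\<^esub> ?s q)"
        by (rule UN_I) (rule self_in_coset[OF free_scale_closed[OF p(1)]])
      then show ?thesis
        using all by (intro equalityI image_subsetI subsetI) (auto intro: rev_image_eqI)
    qed
    ultimately show ?thesis using eval_coset(1)[OF p(1)] p by simp
  qed
  ultimately show "?\<phi> \<in> alg_iso (presented_alg S R) ?A" by (simp add: alg_iso_def)
  show "\<forall>g\<in>S. ?\<phi> (presented_gen S R g) = f g"
  proof
    fix g assume g: "g \<in> S"
    then have "basis_word [g] \<in> carrier F" by (simp add: basis_word_closed)
    then show "?\<phi> (presented_gen S R g) = f g"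
      using eval_presented_gen[OF g] eval_coset[of "basis_word [g]"]
      unfolding presented_gen_def free_gen_eq_basis_word by simp
  qed
qed

end

section \<open>The action on tensor space\<close>

text \<open>In the order on rational functions a polynomial is positive when its leading coefficient
  is, so the indeterminate exceeds every constant.\<close>

lemma v_gt_1: "v > 1"
proof -
  have "(1 :: rat poly) < [:0, 1:]" by (simp add: less_poly_def pos_poly_pCons one_pCons)
  then show ?thesis unfolding v_def by (simp add: Fraction_Field.one_less_Fract_iff)
qed

lemma v_pos: "v > 0"
  using v_gt_1 by (rule less_trans[OF zero_less_one])

section \<open>Diagonal matrices, scalings and Serre expressions\<close>

definition diag :: "'b set \<Rightarrow> ('b \<Rightarrow> 'k::field) \<Rightarrow> 'b \<Rightarrow> 'b \<Rightarrow> 'k"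
  where "diag B \<phi> = (\<lambda>a b. if a = b \<and> b \<in> B then \<phi> b else 0)"

definition scl :: "'k::field \<Rightarrow> ('b \<Rightarrow> 'b \<Rightarrow> 'k) \<Rightarrow> 'b \<Rightarrow> 'b \<Rightarrow> 'k"
  where "scl c M = (\<lambda>a b. c * M a b)"

lemma mat_one_diag: "mat_one B = diag B (\<lambda>_. 1)"
  by (auto simp: mat_one_def diag_def fun_eq_iff)

lemma diag_cong: "(\<And>b. b \<in> B \<Longrightarrow> \<phi> b = \<psi> b) \<Longrightarrow> diag B \<phi> = diag B \<psi>"
  by (auto simp: diag_def fun_eq_iff)

lemma diag_closed: "diag B \<phi> \<in> carrier (mat_alg B)"
  by (simp add: diag_def carrier_mat_alg)

lemma mat_add_closed:
  assumes "M \<in> carrier (mat_alg B)" "N \<in> carrier (mat_alg B)"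
  shows "M + N \<in> carrier (mat_alg B)"
  using assms unfolding carrier_mat_alg by (metis add_0 plus_fun_apply)

lemma diag_mult_left:
  assumes "finite B" "M \<in> carrier (mat_alg B)"
  shows "mat_mult B (diag B \<phi>) M = (\<lambda>a b. \<phi> a * M a b)"
proof (intro ext)
  fix a b
  have "mat_mult B (diag B \<phi>) M a b = (\<Sum>c\<in>B. if c = a then \<phi> a * M a b else 0)"
    unfolding mat_mult_def diag_def by (intro sum.cong) auto
  then show "mat_mult B (diag B \<phi>) M a b = \<phi> a * M a b"
    using assms by (auto simp: carrier_mat_alg)
qed

lemma diag_mult_right:
  assumes "finite B" "M \<in> carrier (mat_alg B)"
  shows "mat_mult B M (diag B \<phi>) = (\<lambda>a b. M a b * \<phi> b)"
proof (intro ext)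
  fix a b
  have "mat_mult B M (diag B \<phi>) a b = (\<Sum>c\<in>B. if c = b then M a b * \<phi> b else 0)"
    unfolding mat_mult_def diag_def by (intro sum.cong) auto
  then show "mat_mult B M (diag B \<phi>) a b = M a b * \<phi> b"
    using assms by (auto simp: carrier_mat_alg)
qed

lemma diag_mult: "finite B \<Longrightarrow> mat_mult B (diag B \<phi>) (diag B \<psi>) = diag B (\<lambda>b. \<phi> b * \<psi> b)"
  by (simp add: diag_mult_left[OF _ diag_closed]) (auto simp: diag_def fun_eq_iff)

lemma mat_mult_scl: "mat_mult B (scl c M) N = scl c (mat_mult B M N)"
  "mat_mult B M (scl c N) = scl c (mat_mult B M N)"
  by (auto simp: mat_mult_def scl_def fun_eq_iff sum_distrib_left algebra_simps)

lemma mat_mult_zero [simp]: "mat_mult B 0 M = 0" "mat_mult B M 0 = 0"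
  by (auto simp: mat_mult_def fun_eq_iff)

text \<open>The parameter \<open>q\<close> is kept apart from \<open>v\<close>: in the
  comultiplication the raising generators obey the exchange rules with \<open>q = v\<close>, the
  lowering ones with \<open>q = v^-1\<close>. The expression itself is invariant under inversion of
  \<open>q\<close>.\<close>

definition serre_mat :: "'b set \<Rightarrow> 'k::field \<Rightarrow> ('b \<Rightarrow> 'b \<Rightarrow> 'k) \<Rightarrow> ('b \<Rightarrow> 'b \<Rightarrow> 'k) \<Rightarrow> 'b \<Rightarrow> 'b \<Rightarrow> 'k"
  where "serre_mat B q x y = mat_mult B x (mat_mult B x y) -
    scl (q + inverse q) (mat_mult B x (mat_mult B y x)) + mat_mult B y (mat_mult B x x)"

text \<open>The mixed terms cancel because the two summands \<open>q\<close>-commute.\<close>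

lemma serre_mat_add:
  fixes q :: "'k::field"
  assumes q: "q \<noteq> 0"
    and c11: "mat_mult B y1 x1 = scl (inverse q * inverse q) (mat_mult B x1 y1)"
    and c12: "mat_mult B y1 x2 = scl q (mat_mult B x2 y1)"
    and c21: "mat_mult B y2 x1 = scl q (mat_mult B x1 y2)"
  shows "serre_mat B q (x1 + y1) (x2 + y2) = serre_mat B q x1 x2 + serre_mat B q y1 y2"
proof -
  have ctx: "mat_mult B y1 (mat_mult B x1 z) = scl (inverse q * inverse q) (mat_mult B x1 (mat_mult B y1 z))"
    "mat_mult B y1 (mat_mult B x2 z) = scl q (mat_mult B x2 (mat_mult B y1 z))"
    "mat_mult B y2 (mat_mult B x1 z) = scl q (mat_mult B x1 (mat_mult B y2 z))" for z
    unfolding mat_mult_assoc[symmetric] c11 c12 c21 mat_mult_scl by simp_all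
  show ?thesis
    unfolding serre_mat_def mat_mult_distrib ctx c11 c12 c21 mat_mult_scl
    using q by (auto simp: fun_eq_iff scl_def field_simps)
qed

section \<open>Kronecker products on tensor space\<close>

lemma finite_tensor_basis: "finite (tensor_basis n d)"
proof -
  have "tensor_basis n d = {xs. set xs \<subseteq> {1..n} \<and> length xs = d}" by (auto simp: tensor_basis_def)
  then show ?thesis using finite_lists_length_eq[of "{1..n}" d] by simp
qed

lemma tensor_basis_0: "tensor_basis n 0 = {[]}"
  by (auto simp: tensor_basis_def)

lemma tensor_basis_Suc: "tensor_basis n (Suc d) = (\<lambda>(a, as). a # as) ` ({1..n} \<times> tensor_basis n d)"
  by (auto simp: tensor_basis_def length_Suc_conv image_iff)

lemma Cons_in_tensor_basis: "a # as \<in> tensor_basis n (Suc d) \<longleftrightarrow> a \<in> {1..n} \<and> as \<in> tensor_basis n d"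
  by (auto simp: tensor_basis_def)

lemma tensor_mat_nonzero:
  assumes "tensor_mat M N as bs \<noteq> 0"
  obtains a as' b bs' where "as = a # as'" "bs = b # bs'" "M a b \<noteq> 0" "N as' bs' \<noteq> 0"
  using assms by (cases "(M, N, as, bs)" rule: tensor_mat.cases) auto

lemma tensor_mat_closed:
  assumes "M \<in> carrier (mat_alg {1..n})" "N \<in> carrier (mat_alg (tensor_basis n d))"
  shows "tensor_mat M N \<in> carrier (mat_alg (tensor_basis n (Suc d)))"
  unfolding carrier_mat_alg
proof (intro allI impI)
  fix as bs assume "tensor_mat M N as bs \<noteq> 0"
  then show "as \<in> tensor_basis n (Suc d) \<and> bs \<in> tensor_basis n (Suc d)"
    using assms by (elim tensor_mat_nonzero) (simp add: Cons_in_tensor_basis carrier_mat_alg)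
qed

text \<open>The mixed-product rule: an index of length \<open>d + 1\<close> is a pair of head and
  tail, so the sum over intermediate indices factors.\<close>

lemma tensor_mat_mult:
  "mat_mult (tensor_basis n (Suc d)) (tensor_mat M N) (tensor_mat M' N') =
    tensor_mat (mat_mult {1..n} M M') (mat_mult (tensor_basis n d) N N')"
proof (intro ext)
  fix as bs
  show "mat_mult (tensor_basis n (Suc d)) (tensor_mat M N) (tensor_mat M' N') as bs =
    tensor_mat (mat_mult {1..n} M M') (mat_mult (tensor_basis n d) N N') as bs"
  proof (cases "as = [] \<or> bs = []")
    case True
    then show ?thesis by (auto simp: mat_mult_def)
  next
    case False
    then obtain a as' b bs' where ab: "as = a # as'" "bs = b # bs'" by (meson neq_Nil_conv)
    have inj: "inj_on (\<lambda>(a, as). a # as) ({1..n} \<times> tensor_basis n d)" by (auto simp: inj_on_def)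
    have "mat_mult (tensor_basis n (Suc d)) (tensor_mat M N) (tensor_mat M' N') as bs =
      (\<Sum>(c, cs)\<in>{1..n} \<times> tensor_basis n d. M a c * N as' cs * (M' c b * N' cs bs'))"
      unfolding mat_mult_def tensor_basis_Suc sum.reindex[OF inj] ab
      by (intro sum.cong) auto
    also have "\<dots> = (\<Sum>c\<in>{1..n}. \<Sum>cs\<in>tensor_basis n d. (M a c * M' c b) * (N as' cs * N' cs bs'))"
      unfolding sum.cartesian_product[symmetric] by (intro sum.cong) (auto simp: algebra_simps)
    also have "\<dots> = tensor_mat (mat_mult {1..n} M M') (mat_mult (tensor_basis n d) N N') as bs"
      unfolding ab by (simp add: mat_mult_def sum_product)
    finally show ?thesis .
  qed
qed

lemma tensor_mat_add: "tensor_mat (M + M') N = tensor_mat M N + tensor_mat M' N"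
  "tensor_mat M (N + N') = tensor_mat M N + tensor_mat M N'"
proof -
  show "tensor_mat (M + M') N = tensor_mat M N + tensor_mat M' N"
  proof (intro ext)
    fix as bs
    show "tensor_mat (M + M') N as bs = (tensor_mat M N + tensor_mat M' N) as bs"
      by (cases as; cases bs) (auto simp: algebra_simps)
  qed
  show "tensor_mat M (N + N') = tensor_mat M N + tensor_mat M N'"
  proof (intro ext)
    fix as bs
    show "tensor_mat M (N + N') as bs = (tensor_mat M N + tensor_mat M N') as bs"
      by (cases as; cases bs) (auto simp: algebra_simps)
  qed
qed

lemma tensor_mat_minus: "tensor_mat (M - M') N = tensor_mat M N - tensor_mat M' N"
  "tensor_mat M (N - N') = tensor_mat M N - tensor_mat M N'"
  using tensor_mat_add(1)[of "M - M'" M' N] tensor_mat_add(2)[of M "N - N'" N']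
  by (simp_all add: algebra_simps)

lemma tensor_mat_zero [simp]: "tensor_mat 0 N = 0" "tensor_mat M 0 = 0"
  using tensor_mat_minus(1)[of 0 0 N] tensor_mat_minus(2)[of M 0 0] by simp_all

lemma tensor_mat_scl: "tensor_mat (scl c M) N = scl c (tensor_mat M N)"
  "tensor_mat M (scl c N) = scl c (tensor_mat M N)"
proof -
  show "tensor_mat (scl c M) N = scl c (tensor_mat M N)"
  proof (intro ext)
    fix as bs
    show "tensor_mat (scl c M) N as bs = scl c (tensor_mat M N) as bs"
      by (cases as; cases bs) (auto simp: scl_def algebra_simps)
  qed
  show "tensor_mat M (scl c N) = scl c (tensor_mat M N)"
  proof (intro ext)
    fix as bs
    show "tensor_mat M (scl c N) as bs = scl c (tensor_mat M N) as bs"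
      by (cases as; cases bs) (auto simp: scl_def algebra_simps)
  qed
qed

lemma tensor_mat_diag:
  "tensor_mat (diag {1..n} \<phi>) (diag (tensor_basis n d) \<psi>) =
    diag (tensor_basis n (Suc d)) (\<lambda>bs. \<phi> (hd bs) * \<psi> (tl bs))"
proof (intro ext)
  fix as bs
  show "tensor_mat (diag {1..n} \<phi>) (diag (tensor_basis n d) \<psi>) as bs =
    diag (tensor_basis n (Suc d)) (\<lambda>bs. \<phi> (hd bs) * \<psi> (tl bs)) as bs"
    by (cases as; cases bs) (auto simp: diag_def Cons_in_tensor_basis, auto simp: tensor_basis_def)
qed

text \<open>The weight of a basis tensor, integer-valued so that it can be shifted by roots and
  compared with elements of \<open>weights\<close>.\<close>

definition cnt :: "nat list \<Rightarrow> nat \<Rightarrow> int"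
  where "cnt bs i = int (count_list bs i)"

lemma cnt_simps [simp]: "cnt [] i = 0" "cnt (b # bs) i = of_bool (b = i) + cnt bs i"
  by (auto simp: cnt_def)

section \<open>The generators on tensor powers\<close>

context
  fixes n :: nat
begin

private abbreviation (input) "T d \<equiv> tensor_basis n d"
private abbreviation (input) "N \<equiv> {1..n}"

definition mat_unit_E :: "nat \<Rightarrow> nat \<Rightarrow> nat \<Rightarrow> Qv" where "mat_unit_E i = (\<lambda>a b. of_bool (b = i + 1 \<and> a = i))"
definition mat_unit_F :: "nat \<Rightarrow> nat \<Rightarrow> nat \<Rightarrow> Qv" where "mat_unit_F i = (\<lambda>a b. of_bool (b = i \<and> a = i + 1))"

lemma natural_rep_eq:
  "natural_rep n (UE i) = mat_unit_E i" "natural_rep n (UF i) = mat_unit_F i"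
  "natural_rep n (UK i) = diag N (\<lambda>b. v powi of_bool (b = i))"
  "natural_rep n (UL i) = diag N (\<lambda>b. v powi - of_bool (b = i))"
  by (auto simp: mat_unit_E_def mat_unit_F_def diag_def fun_eq_iff)

lemma mat_unit_EF_closed: "i \<in> {1..<n} \<Longrightarrow> mat_unit_E i \<in> carrier (mat_alg N)" "i \<in> {1..<n} \<Longrightarrow> mat_unit_F i \<in> carrier (mat_alg N)"
  by (auto simp: mat_unit_E_def mat_unit_F_def carrier_mat_alg)

lemma tensor_gen_KL:
  "tensor_gen n d (UK i) = diag (T d) (\<lambda>bs. v powi cnt bs i)"
  "tensor_gen n d (UL i) = diag (T d) (\<lambda>bs. v powi - cnt bs i)"
proof (induction d)
  case 0
  {
    case 1
    then show ?case by (auto simp: fun_eq_iff mat_one_def diag_def tensor_basis_0)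
  next
    case 2
    then show ?case by (auto simp: fun_eq_iff mat_one_def diag_def tensor_basis_0)
  }
next
  case (Suc d)
  have K: "tensor_gen n (Suc d) (UK i) = tensor_mat (diag N (\<lambda>b. v powi of_bool (b = i))) (diag (T d) (\<lambda>bs. v powi cnt bs i))"
    by (intro ext) (simp add: Suc natural_rep_eq mat_mult_one diag_closed finite_tensor_basis del: natural_rep.simps)
  have L: "tensor_gen n (Suc d) (UL i) = tensor_mat (diag N (\<lambda>b. v powi - of_bool (b = i))) (diag (T d) (\<lambda>bs. v powi - cnt bs i))"
    by (intro ext) (simp add: Suc natural_rep_eq mat_mult_one diag_closed finite_tensor_basis del: natural_rep.simps)
  have nz: "v \<noteq> 0" using v_pos by simp
  {
    case 1
    show ?case unfolding K tensor_mat_diag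
      by (rule diag_cong) (auto simp: tensor_basis_Suc power_int_add nz)
  next
    case 2
    show ?case unfolding L tensor_mat_diag
      by (rule diag_cong) (auto simp: tensor_basis_Suc nz simp flip: power_int_add)
  }
qed

text \<open>Eigenvalues of \<open>K_i K_{i+1}^-1\<close> on basis tensors and of
  \<open>K_i^-1 K_{i+1}\<close> on natural basis vectors: the diagonal factors in the
  comultiplication of \<open>E_i\<close> and \<open>F_i\<close>.\<close>

definition K_ratio :: "nat \<Rightarrow> nat list \<Rightarrow> Qv" where "K_ratio i bs = v powi (cnt bs i - cnt bs (i + 1))"
definition K_ratio_inv :: "nat \<Rightarrow> nat \<Rightarrow> Qv" where "K_ratio_inv i b = v powi - root i b"

lemma tensor_gen_0: "tensor_gen n 0 (UE i) = 0" "tensor_gen n 0 (UF i) = 0"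
  by (auto simp: fun_eq_iff)

text \<open>The recursion and closedness depend on each other: the unit laws behind the recursion
  need closedness in degree \<open>d\<close>, and closedness in degree \<open>d + 1\<close> follows
  from the recursion.\<close>

lemma tensor_gen_EF_closed:
  assumes "i \<in> {1..<n}"
  shows "tensor_gen n d (UE i) \<in> carrier (mat_alg (T d))" "tensor_gen n d (UF i) \<in> carrier (mat_alg (T d))"
    "tensor_gen n (Suc d) (UE i) = tensor_mat (mat_unit_E i) (diag (T d) (K_ratio i)) + tensor_mat (mat_one N) (tensor_gen n d (UE i))"
    "tensor_gen n (Suc d) (UF i) = tensor_mat (mat_unit_F i) (mat_one (T d)) + tensor_mat (diag N (K_ratio_inv i)) (tensor_gen n d (UF i))"
proof -
  have nz: "v \<noteq> 0" using v_pos by simp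
  have step: "tensor_gen n (Suc d) (UE i) = tensor_mat (mat_unit_E i) (diag (T d) (K_ratio i)) + tensor_mat (mat_one N) (tensor_gen n d (UE i))
    \<and> tensor_gen n (Suc d) (UF i) = tensor_mat (mat_unit_F i) (mat_one (T d)) + tensor_mat (diag N (K_ratio_inv i)) (tensor_gen n d (UF i))"
    if "tensor_gen n d (UE i) \<in> carrier (mat_alg (T d))" "tensor_gen n d (UF i) \<in> carrier (mat_alg (T d))" for d
  proof -
    have 1: "mat_mult (T d) (diag (T d) (\<lambda>bs. v powi cnt bs i)) (diag (T d) (\<lambda>bs. v powi - cnt bs (i + 1))) = diag (T d) (K_ratio i)"
      by (subst diag_mult) (auto simp: finite_tensor_basis K_ratio_def nz simp flip: power_int_add intro!: diag_cong)
    have 2: "mat_mult N (diag N (\<lambda>b. v powi - of_bool (b = i))) (diag N (\<lambda>b. v powi of_bool (b = i + 1))) = diag N (K_ratio_inv i)"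
      by (subst diag_mult) (auto simp: K_ratio_inv_def root_def nz intro!: diag_cong)
    show ?thesis
      using that assms
      by (auto simp: fun_eq_iff natural_rep_eq mat_mult_one mat_unit_EF_closed diag_closed finite_tensor_basis
        tensor_gen_KL 1 2 simp del: natural_rep.simps One_nat_def)
  qed
  have cl: "tensor_gen n d (UE i) \<in> carrier (mat_alg (T d)) \<and> tensor_gen n d (UF i) \<in> carrier (mat_alg (T d))" for d
  proof (induction d)
    case 0
    then show ?case by (simp add: tensor_gen_0 carrier_mat_alg del: tensor_gen.simps)
  next
    case (Suc d)
    show ?case
      unfolding conjunct1[OF step[OF conjunct1[OF Suc] conjunct2[OF Suc]]]
        conjunct2[OF step[OF conjunct1[OF Suc] conjunct2[OF Suc]]]
      using Suc assms
      by (intro conjI mat_add_closed tensor_mat_closed mat_unit_EF_closed diag_closed mat_one_closed) auto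
  qed
  show "tensor_gen n d (UE i) \<in> carrier (mat_alg (T d))" "tensor_gen n d (UF i) \<in> carrier (mat_alg (T d))"
    "tensor_gen n (Suc d) (UE i) = tensor_mat (mat_unit_E i) (diag (T d) (K_ratio i)) + tensor_mat (mat_one N) (tensor_gen n d (UE i))"
    "tensor_gen n (Suc d) (UF i) = tensor_mat (mat_unit_F i) (mat_one (T d)) + tensor_mat (diag N (K_ratio_inv i)) (tensor_gen n d (UF i))"
    using cl step by auto
qed

lemma tensor_gen_weight:
  assumes i: "i \<in> {1..<n}"
  shows "tensor_gen n d (UE i) as bs \<noteq> 0 \<Longrightarrow> cnt as j = cnt bs j + root i j"
    "tensor_gen n d (UF i) as bs \<noteq> 0 \<Longrightarrow> cnt as j = cnt bs j - root i j"
proof (induction d arbitrary: as bs)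
  case 0
  {
    case 1
    then show ?case using tensor_gen_0 by (simp del: tensor_gen.simps)
  next
    case 2
    then show ?case using tensor_gen_0 by (simp del: tensor_gen.simps)
  }
next
  case (Suc d)
  {
    case 1
    then have "tensor_mat (mat_unit_E i) (diag (T d) (K_ratio i)) as bs \<noteq> 0 \<or>
      tensor_mat (mat_one N) (tensor_gen n d (UE i)) as bs \<noteq> 0"
      unfolding tensor_gen_EF_closed(3)[OF i] by auto
    then show ?case
      using Suc.IH(1)
      by (elim disjE tensor_mat_nonzero)
        (auto simp: mat_unit_E_def diag_def mat_one_def root_def split: if_splits)
  next
    case 2
    then have "tensor_mat (mat_unit_F i) (mat_one (T d)) as bs \<noteq> 0 \<or>
      tensor_mat (diag N (K_ratio_inv i)) (tensor_gen n d (UF i)) as bs \<noteq> 0"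
      unfolding tensor_gen_EF_closed(4)[OF i] by auto
    then show ?case
      using Suc.IH(2)
      by (elim disjE tensor_mat_nonzero)
        (auto simp: mat_unit_F_def diag_def mat_one_def root_def split: if_splits)
  }
qed


lemma mat_unit_E_mult:
  assumes "i \<in> {1..<n}"
  shows "mat_mult N (mat_unit_E i) (mat_unit_E j) = (if j = i + 1 then (\<lambda>a b. of_bool (a = i \<and> b = j + 1)) else 0)"
proof (intro ext)
  fix a b
  have "mat_mult N (mat_unit_E i) (mat_unit_E j) a b = (\<Sum>c\<in>N. if c = i + 1 then of_bool (a = i \<and> b = j + 1 \<and> j = i + 1) else 0)"
    unfolding mat_mult_def mat_unit_E_def by (intro sum.cong) auto
  also have "\<dots> = of_bool (a = i \<and> b = j + 1 \<and> j = i + 1)" using assms by simp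
  finally show "mat_mult N (mat_unit_E i) (mat_unit_E j) a b = (if j = i + 1 then (\<lambda>a b. of_bool (a = i \<and> b = j + 1)) else 0) a b"
    by simp
qed

lemma mat_unit_F_mult:
  assumes "i \<in> {1..<n}"
  shows "mat_mult N (mat_unit_F i) (mat_unit_F j) = (if i = j + 1 then (\<lambda>a b. of_bool (a = i + 1 \<and> b = j)) else 0)"
proof (intro ext)
  fix a b
  have "mat_mult N (mat_unit_F i) (mat_unit_F j) a b = (\<Sum>c\<in>N. if c = i then of_bool (a = i + 1 \<and> b = j \<and> i = j + 1) else 0)"
    unfolding mat_mult_def mat_unit_F_def by (intro sum.cong) auto
  also have "\<dots> = of_bool (a = i + 1 \<and> b = j \<and> i = j + 1)" using assms by simp
  finally show "mat_mult N (mat_unit_F i) (mat_unit_F j) a b = (if i = j + 1 then (\<lambda>a b. of_bool (a = i + 1 \<and> b = j)) else 0) a b"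
    by simp
qed

lemma mat_unit_EF_commutator:
  assumes "i \<in> {1..<n}" "j \<in> {1..<n}"
  shows "mat_mult N (mat_unit_E i) (mat_unit_F j) - mat_mult N (mat_unit_F j) (mat_unit_E i) =
    (if i = j then diag N (\<lambda>b. of_bool (b = i) - of_bool (b = i + 1)) else 0)"
proof (intro ext)
  fix a b
  have "mat_mult N (mat_unit_E i) (mat_unit_F j) a b = (\<Sum>c\<in>N. if c = i + 1 then of_bool (a = i \<and> b = j \<and> i = j) else 0)"
    unfolding mat_mult_def mat_unit_E_def mat_unit_F_def by (intro sum.cong) auto
  also have "\<dots> = of_bool (a = i \<and> b = j \<and> i = j)" using assms by simp
  finally have 1: "mat_mult N (mat_unit_E i) (mat_unit_F j) a b = of_bool (a = i \<and> b = j \<and> i = j)" .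
  have "mat_mult N (mat_unit_F j) (mat_unit_E i) a b = (\<Sum>c\<in>N. if c = i then of_bool (a = j + 1 \<and> b = i + 1 \<and> i = j) else 0)"
    unfolding mat_mult_def mat_unit_E_def mat_unit_F_def by (intro sum.cong) auto
  also have "\<dots> = of_bool (a = j + 1 \<and> b = i + 1 \<and> i = j)" using assms by simp
  finally have 2: "mat_mult N (mat_unit_F j) (mat_unit_E i) a b = of_bool (a = j + 1 \<and> b = i + 1 \<and> i = j)" .
  show "(mat_mult N (mat_unit_E i) (mat_unit_F j) - mat_mult N (mat_unit_F j) (mat_unit_E i)) a b =
    (if i = j then diag N (\<lambda>b. of_bool (b = i) - of_bool (b = i + 1)) else 0) a b"
    using assms by (auto simp: 1 2 diag_def simp del: One_nat_def)
qed

text \<open>The change of the commutator eigenvalue when a factor \<open>w_i\<close>, respectively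
  \<open>w_{i+1}\<close>, is put in front of a tensor.\<close>

lemma qint_Suc: "v powi m + inverse v * qint m = qint (m + 1)" "v * qint m - v powi m = qint (m - 1)"
proof -
  have nz: "v \<noteq> 0" using v_pos by simp
  have "inverse v < v" using v_gt_1 by (meson less_trans one_less_inverse_iff inverse_less_1_iff not_less_iff_gr_or_eq)
  then have d: "v - inverse v \<noteq> 0" by simp
  have x: "v powi m \<noteq> 0" using nz by simp
  have "(v powi m + inverse v * qint m) * (v - inverse v) = qint (m + 1) * (v - inverse v)"
    unfolding qint_def using d nz x
    by (simp add: power_int_add power_int_diff power_int_minus field_simps)
  then show "v powi m + inverse v * qint m = qint (m + 1)" using mult_right_cancel[OF d] by blast
  have "(v * qint m - v powi m) * (v - inverse v) = qint (m - 1) * (v - inverse v)"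
    unfolding qint_def using d nz x
    by (simp add: power_int_add power_int_diff power_int_minus field_simps)
  then show "v * qint m - v powi m = qint (m - 1)" using mult_right_cancel[OF d] by blast
qed

lemma tensor_gen_EF:
  assumes i: "i \<in> {1..<n}" and j: "j \<in> {1..<n}"
  shows "mat_mult (T d) (tensor_gen n d (UE i)) (tensor_gen n d (UF j)) -
    mat_mult (T d) (tensor_gen n d (UF j)) (tensor_gen n d (UE i)) =
    (if i = j then diag (T d) (\<lambda>bs. qint (cnt bs i - cnt bs (i + 1))) else 0)"
proof (induction d)
  case 0
  have "diag (T 0) (\<lambda>bs. qint (cnt bs i - cnt bs (i + 1))) = 0"
    by (auto simp: diag_def tensor_basis_0 qint_def fun_eq_iff)
  then show ?case unfolding tensor_gen_0 mat_mult_zero diff_self by (cases "i = j") simp_all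
next
  case (Suc d)
  note fin = finite_tensor_basis finite_atLeastAtMost[of 1 n]
  note cl = tensor_gen_EF_closed(1)[OF i] tensor_gen_EF_closed(2)[OF j]
  let ?E = "tensor_gen n d (UE i)" and ?F = "tensor_gen n d (UF j)"
  let ?k = "diag (T d) (K_ratio i)" and ?l = "diag N (K_ratio_inv j)"
  have nz: "v \<noteq> 0" using v_pos by simp
  \<comment> \<open>The mixed terms of the diagonal-bearing summands agree: exchanging them produces
    a power of \<open>v\<close> in each tensor factor, with opposite exponents.\<close>
  have "tensor_mat (mat_mult N (mat_unit_E i) ?l) (mat_mult (T d) ?k ?F) =
    tensor_mat (mat_mult N ?l (mat_unit_E i)) (mat_mult (T d) ?F ?k)"
  proof (intro ext)
    fix as bs
    have "mat_unit_E i a b * K_ratio_inv j b * (K_ratio i as * ?F as bs) = K_ratio_inv j a * mat_unit_E i a b * (?F as bs * K_ratio i bs)" for a b as bs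
    proof (cases "mat_unit_E i a b = 0 \<or> ?F as bs = 0")
      case False
      then have ab: "a = i" "b = i + 1" by (auto simp: mat_unit_E_def)
      have c: "cnt as i = cnt bs i - root j i" "cnt as (i + 1) = cnt bs (i + 1) - root j (i + 1)"
        using False tensor_gen_weight(2)[OF j] by auto
      have m: "K_ratio_inv j x * K_ratio i xs = v powi (- root j x + (cnt xs i - cnt xs (i + 1)))" for x xs
        unfolding K_ratio_inv_def K_ratio_def using nz power_int_add[of v "- root j x" "cnt xs i - cnt xs (i + 1)"]
        by simp
      have "K_ratio_inv j b * K_ratio i as = K_ratio_inv j a * K_ratio i bs"
        unfolding m ab c by (rule arg_cong[where f = "\<lambda>k. v powi k"]) simp
      then show ?thesis by (simp add: algebra_simps)
    qed auto
    then show "tensor_mat (mat_mult N (mat_unit_E i) ?l) (mat_mult (T d) ?k ?F) as bs =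
      tensor_mat (mat_mult N ?l (mat_unit_E i)) (mat_mult (T d) ?F ?k) as bs"
      by (cases as; cases bs)
        (simp_all add: diag_mult_left diag_mult_right mat_unit_EF_closed[OF i] cl fin del: One_nat_def)
  qed
  \<comment> \<open>What remains is the commutator on the natural module tensored with
    \<open>?k\<close>, plus \<open>?l\<close> tensored with the commutator of degree
    \<open>d\<close>.\<close>
  then have "mat_mult (T (Suc d)) (tensor_gen n (Suc d) (UE i)) (tensor_gen n (Suc d) (UF j)) -
    mat_mult (T (Suc d)) (tensor_gen n (Suc d) (UF j)) (tensor_gen n (Suc d) (UE i)) =
    tensor_mat (mat_mult N (mat_unit_E i) (mat_unit_F j) - mat_mult N (mat_unit_F j) (mat_unit_E i)) ?k +
    tensor_mat ?l (mat_mult (T d) ?E ?F - mat_mult (T d) ?F ?E)"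
    unfolding tensor_gen_EF_closed(3)[OF i] tensor_gen_EF_closed(4)[OF j] mat_mult_distrib tensor_mat_mult
    by (simp add: mat_mult_one fin cl mat_unit_EF_closed(1)[OF i] mat_unit_EF_closed(2)[OF j] diag_closed tensor_mat_minus del: One_nat_def tensor_gen.simps)
  also have "\<dots> = (if i = j then diag (T (Suc d)) (\<lambda>bs. qint (cnt bs i - cnt bs (i + 1))) else 0)"
  proof (cases "i = j")
    case True
    have "tensor_mat (diag N (\<lambda>b. of_bool (b = i) - of_bool (b = i + 1))) (diag (T d) (K_ratio i)) +
      tensor_mat (diag N (K_ratio_inv i)) (diag (T d) (\<lambda>bs. qint (cnt bs i - cnt bs (i + 1)))) =
      diag (T (Suc d)) (\<lambda>bs. qint (cnt bs i - cnt bs (i + 1)))"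
      unfolding tensor_mat_diag
    proof (intro ext)
      fix as bs :: "nat list"
      have "(of_bool (b = i) - of_bool (b = i + 1)) * K_ratio i bs + K_ratio_inv i b * qint (cnt bs i - cnt bs (i + 1)) =
        qint (cnt (b # bs) i - cnt (b # bs) (i + 1))" for b bs
        using qint_Suc[of "cnt bs i - cnt bs (i + 1)"]
        by (cases "b = i"; cases "b = i + 1") (auto simp: K_ratio_def K_ratio_inv_def root_def power_int_minus algebra_simps)
      then show "(diag (T (Suc d)) (\<lambda>bs. (of_bool (hd bs = i) - of_bool (hd bs = i + 1)) * K_ratio i (tl bs)) +
        diag (T (Suc d)) (\<lambda>bs. K_ratio_inv i (hd bs) * qint (cnt (tl bs) i - cnt (tl bs) (i + 1)))) as bs =
        diag (T (Suc d)) (\<lambda>bs. qint (cnt bs i - cnt bs (i + 1))) as bs"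
        by (cases bs) (auto simp: diag_def tensor_basis_Suc)
    qed
    then show ?thesis unfolding Suc mat_unit_EF_commutator[OF i j] using True by simp
  next
    case False
    then show ?thesis
      unfolding Suc mat_unit_EF_commutator[OF i j] by (simp only: if_False tensor_mat_zero add_0_left)
  qed
  finally show ?case .
qed

section \<open>The Serre relations on tensor powers\<close>

lemma serre_mat_tensor_diag:
  fixes q :: "'k::field"
  shows "serre_mat (T (Suc d)) q (tensor_mat (diag N \<phi>) P) (tensor_mat (diag N \<psi>) Q) =
    tensor_mat (diag N (\<lambda>b. \<phi> b * \<phi> b * \<psi> b)) (serre_mat (T d) q P Q)"
proof -
  have [simp]: "mat_mult N (diag N \<phi>') (diag N \<psi>') = diag N (\<lambda>b. \<phi>' b * \<psi>' b)" for \<phi>' \<psi>' :: "nat \<Rightarrow> 'k"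
    by (rule diag_mult) simp
  show ?thesis
    unfolding serre_mat_def tensor_mat_mult
    by (simp add: tensor_mat_add tensor_mat_minus tensor_mat_scl algebra_simps del: One_nat_def)
qed

lemma serre_mat_tensor_nilpotent:
  assumes "mat_mult N M (mat_mult N M M') = 0" "mat_mult N M (mat_mult N M' M) = 0"
    "mat_mult N M' (mat_mult N M M) = 0"
  shows "serre_mat (T (Suc d)) q (tensor_mat M P) (tensor_mat M' Q) = 0"
  unfolding serre_mat_def tensor_mat_mult assms by (auto simp: scl_def fun_eq_iff)

text \<open>On the natural module each term of the Serre expression vanishes separately, because
  every cubic product listed contains a neighbouring pair with product zero.\<close>

lemma mat_unit_EF_nilpotent:
  assumes "i \<in> {1..<n}" "j \<in> {1..<n}"
  shows "mat_mult N (mat_unit_E i) (mat_mult N (mat_unit_E i) (mat_unit_E j)) = 0" "mat_mult N (mat_unit_E i) (mat_mult N (mat_unit_E j) (mat_unit_E i)) = 0"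
    "mat_mult N (mat_unit_E j) (mat_mult N (mat_unit_E i) (mat_unit_E i)) = 0"
    "mat_mult N (mat_unit_F i) (mat_mult N (mat_unit_F i) (mat_unit_F j)) = 0" "mat_mult N (mat_unit_F i) (mat_mult N (mat_unit_F j) (mat_unit_F i)) = 0"
    "mat_mult N (mat_unit_F j) (mat_mult N (mat_unit_F i) (mat_unit_F i)) = 0"
proof -
  have E: "mat_mult N (mat_unit_E i) (mat_unit_E i) = 0" "j \<noteq> i + 1 \<Longrightarrow> mat_mult N (mat_unit_E i) (mat_unit_E j) = 0"
    "i \<noteq> j + 1 \<Longrightarrow> mat_mult N (mat_unit_E j) (mat_unit_E i) = 0"
    using mat_unit_E_mult[OF assms(1)] mat_unit_E_mult[OF assms(2)] by auto
  have F: "mat_mult N (mat_unit_F i) (mat_unit_F i) = 0" "i \<noteq> j + 1 \<Longrightarrow> mat_mult N (mat_unit_F i) (mat_unit_F j) = 0"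
    "j \<noteq> i + 1 \<Longrightarrow> mat_mult N (mat_unit_F j) (mat_unit_F i) = 0"
    using mat_unit_F_mult[OF assms(1)] mat_unit_F_mult[OF assms(2)] by auto
  show "mat_mult N (mat_unit_E i) (mat_mult N (mat_unit_E i) (mat_unit_E j)) = 0" "mat_mult N (mat_unit_E j) (mat_mult N (mat_unit_E i) (mat_unit_E i)) = 0"
    "mat_mult N (mat_unit_F i) (mat_mult N (mat_unit_F i) (mat_unit_F j)) = 0" "mat_mult N (mat_unit_F j) (mat_mult N (mat_unit_F i) (mat_unit_F i)) = 0"
    using E(1) F(1) by (simp_all flip: mat_mult_assoc del: One_nat_def)
  show "mat_mult N (mat_unit_E i) (mat_mult N (mat_unit_E j) (mat_unit_E i)) = 0"
  proof (cases "j = i + 1")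
    case True
    then show ?thesis using E(3) by simp
  next
    case False
    then show ?thesis using E(2) by (simp flip: mat_mult_assoc del: One_nat_def)
  qed
  show "mat_mult N (mat_unit_F i) (mat_mult N (mat_unit_F j) (mat_unit_F i)) = 0"
  proof (cases "i = j + 1")
    case True
    then show ?thesis using F(3) by simp
  next
    case False
    then show ?thesis using F(2) by (simp flip: mat_mult_assoc del: One_nat_def)
  qed
qed

text \<open>The exponent is \<open>-(\<alpha>_i, \<alpha>_j)\<close> in coordinates. It arises in
  the second tensor factor, where \<open>E_i\<close> changes the weight at which
  \<open>K_ratio j\<close> is evaluated.\<close>

lemma E_exchange:
  assumes i: "i \<in> {1..<n}" and j: "j \<in> {1..<n}"
  shows "mat_mult (T (Suc d)) (tensor_mat (mat_one N) (tensor_gen n d (UE i))) (tensor_mat (mat_unit_E j) (diag (T d) (K_ratio j))) =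
    scl (v powi (root i (j + 1) - root i j))
      (mat_mult (T (Suc d)) (tensor_mat (mat_unit_E j) (diag (T d) (K_ratio j))) (tensor_mat (mat_one N) (tensor_gen n d (UE i))))"
proof -
  have nz: "v \<noteq> 0" using v_pos by simp
  note cl = tensor_gen_EF_closed(1)[OF i]
  have "mat_mult (T d) (tensor_gen n d (UE i)) (diag (T d) (K_ratio j)) =
    scl (v powi (root i (j + 1) - root i j)) (mat_mult (T d) (diag (T d) (K_ratio j)) (tensor_gen n d (UE i)))"
  proof (intro ext)
    fix as bs
    have "tensor_gen n d (UE i) as bs * K_ratio j bs =
      v powi (root i (j + 1) - root i j) * (K_ratio j as * tensor_gen n d (UE i) as bs)"
    proof (cases "tensor_gen n d (UE i) as bs = 0")
      case False
      have "K_ratio j bs = v powi (root i (j + 1) - root i j) * K_ratio j as"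
        unfolding K_ratio_def tensor_gen_weight(1)[OF i False] using nz by (simp flip: power_int_add)
      then show ?thesis by simp
    qed simp
    then show "mat_mult (T d) (tensor_gen n d (UE i)) (diag (T d) (K_ratio j)) as bs =
      scl (v powi (root i (j + 1) - root i j)) (mat_mult (T d) (diag (T d) (K_ratio j)) (tensor_gen n d (UE i))) as bs"
      by (simp add: diag_mult_left diag_mult_right cl finite_tensor_basis scl_def del: tensor_gen.simps)
  qed
  then show ?thesis
    unfolding tensor_mat_mult
    by (simp add: mat_mult_one mat_unit_EF_closed(1)[OF j] tensor_mat_scl del: One_nat_def tensor_gen.simps)
qed

text \<open>Here the power of \<open>v\<close> arises in the first tensor factor, and its exponent
  has the opposite sign. This is why the lowering generators are treated with
  \<open>inverse v\<close>.\<close>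

lemma F_exchange:
  assumes i: "i \<in> {1..<n}" and j: "j \<in> {1..<n}"
  shows "mat_mult (T (Suc d)) (tensor_mat (diag N (K_ratio_inv i)) (tensor_gen n d (UF i))) (tensor_mat (mat_unit_F j) (mat_one (T d))) =
    scl (v powi (root i j - root i (j + 1)))
      (mat_mult (T (Suc d)) (tensor_mat (mat_unit_F j) (mat_one (T d))) (tensor_mat (diag N (K_ratio_inv i)) (tensor_gen n d (UF i))))"
proof -
  have nz: "v \<noteq> 0" using v_pos by simp
  note cl = tensor_gen_EF_closed(2)[OF i]
  have "mat_mult N (diag N (K_ratio_inv i)) (mat_unit_F j) = scl (v powi (root i j - root i (j + 1))) (mat_mult N (mat_unit_F j) (diag N (K_ratio_inv i)))"
    unfolding diag_mult_left[OF finite_atLeastAtMost mat_unit_EF_closed(2)[OF j]]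
      diag_mult_right[OF finite_atLeastAtMost mat_unit_EF_closed(2)[OF j]]
    using nz by (auto simp: fun_eq_iff scl_def mat_unit_F_def K_ratio_inv_def simp flip: power_int_add)
  then show ?thesis
    unfolding tensor_mat_mult
    by (simp add: mat_mult_one finite_tensor_basis cl tensor_mat_scl del: One_nat_def tensor_gen.simps)
qed

lemma serre_mat_zero: "serre_mat B q 0 0 = 0"
  by (auto simp: serre_mat_def scl_def fun_eq_iff)

text \<open>By the exchange rules the two summands of the comultiplication satisfy the hypotheses of
  \<open>serre_mat_add\<close>. The first summand contributes zero, since this is so on the natural
  module; the second is the relation in degree \<open>d\<close> with a diagonal factor in
  front.\<close>

lemma tensor_gen_serre:
  assumes i: "i \<in> {1..<n}" and j: "j \<in> {1..<n}" and ij: "\<bar>int i - int j\<bar> = 1"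
  shows "serre_mat (T d) v (tensor_gen n d (UE i)) (tensor_gen n d (UE j)) = 0"
    and "serre_mat (T d) (inverse v) (tensor_gen n d (UF i)) (tensor_gen n d (UF j)) = 0"
proof (induction d)
  case 0
  {
    case 1
    show ?case unfolding tensor_gen_0 by (rule serre_mat_zero)
  next
    case 2
    show ?case unfolding tensor_gen_0 by (rule serre_mat_zero)
  }
next
  case (Suc d)
  have nz: "v \<noteq> 0" using v_pos by simp
  have ex: "root i i = 1" "root i (i + 1) = -1" "root i (j + 1) - root i j = 1" "root j (i + 1) - root j i = 1"
    "root i j - root i (j + 1) = -1" "root j i - root j (i + 1) = -1"
    using ij by (auto simp: root_def)
  have two: "v powi (-1 - 1) = inverse v * inverse v" "v powi (1 - - 1) = v * v"
    by (simp_all add: power_int_minus power2_eq_square)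
  {
    case 1
    show ?case
      unfolding tensor_gen_EF_closed(3)[OF i] tensor_gen_EF_closed(3)[OF j]
      apply (subst serre_mat_add)
      using nz E_exchange[OF i i, of d] E_exchange[OF i j, of d] E_exchange[OF j i, of d]
      by (simp_all only: ex two power_int_1_right serre_mat_tensor_nilpotent[OF mat_unit_EF_nilpotent(1-3)[OF i j]]
          mat_one_diag serre_mat_tensor_diag Suc tensor_mat_zero add_0_left) simp_all
  next
    case 2
    show ?case
      unfolding tensor_gen_EF_closed(4)[OF i] tensor_gen_EF_closed(4)[OF j]
      apply (subst serre_mat_add)
      using nz F_exchange[OF i i, of d] F_exchange[OF i j, of d] F_exchange[OF j i, of d]
      by (simp_all only: ex two power_int_minus power_int_1_right inverse_inverse_eq
          serre_mat_tensor_nilpotent[OF mat_unit_EF_nilpotent(4-6)[OF i j]]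
          serre_mat_tensor_diag Suc tensor_mat_zero add_0_left) simp_all
  }
qed

text \<open>For distinct nonadjacent indices the exchange exponents vanish, and so do the products
  of matrix units; only the second summands remain, and they commute by induction.\<close>

lemma tensor_gen_commute:
  assumes i: "i \<in> {1..<n}" and j: "j \<in> {1..<n}" and ij: "\<bar>int i - int j\<bar> \<noteq> 1"
  shows "mat_mult (T d) (tensor_gen n d (UE i)) (tensor_gen n d (UE j)) =
      mat_mult (T d) (tensor_gen n d (UE j)) (tensor_gen n d (UE i))" (is "?P d")
    and "mat_mult (T d) (tensor_gen n d (UF i)) (tensor_gen n d (UF j)) =
      mat_mult (T d) (tensor_gen n d (UF j)) (tensor_gen n d (UF i))" (is "?Q d")
proof -
  have "?P d \<and> ?Q d"
  proof (cases "i = j")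
    case False
    have ex: "root i (j + 1) = 0" "root i j = 0" "root j (i + 1) = 0" "root j i = 0"
      using ij False by (auto simp: root_def)
    have ne: "j \<noteq> i + 1" "i \<noteq> j + 1" using ij by auto
    have one: "scl 1 M = M" for M :: "nat list \<Rightarrow> nat list \<Rightarrow> Qv" by (simp add: scl_def)
    have E0: "mat_mult N (mat_unit_E i) (mat_unit_E j) = 0" "mat_mult N (mat_unit_E j) (mat_unit_E i) = 0"
      "mat_mult N (mat_unit_F i) (mat_unit_F j) = 0" "mat_mult N (mat_unit_F j) (mat_unit_F i) = 0"
      using ne by (simp_all add: mat_unit_E_mult[OF i] mat_unit_E_mult[OF j] mat_unit_F_mult[OF i] mat_unit_F_mult[OF j] del: One_nat_def)
    have l: "mat_mult N (diag N (K_ratio_inv i)) (diag N (K_ratio_inv j)) = mat_mult N (diag N (K_ratio_inv j)) (diag N (K_ratio_inv i))"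
      by (simp add: diag_mult mult.commute)
    show ?thesis
    proof (induction d)
      case 0
      show ?case unfolding tensor_gen_0 by simp
    next
      case (Suc d)
      have "?P (Suc d)"
        unfolding tensor_gen_EF_closed(3)[OF i] tensor_gen_EF_closed(3)[OF j] mat_mult_distrib
          E_exchange[OF i j] E_exchange[OF j i]
        unfolding ex tensor_mat_mult E0 conjunct1[OF Suc] by (simp add: one algebra_simps)
      moreover have "?Q (Suc d)"
        unfolding tensor_gen_EF_closed(4)[OF i] tensor_gen_EF_closed(4)[OF j] mat_mult_distrib
          F_exchange[OF i j] F_exchange[OF j i]
        unfolding ex tensor_mat_mult E0 conjunct2[OF Suc] l by (simp add: one algebra_simps)
      ultimately show ?case ..
    qed
  qed simp
  then show "?P d" "?Q d" by auto
qed

end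

section \<open>Generated matrix algebras\<close>

definition gen_alg :: "'b set \<Rightarrow> ('g \<Rightarrow> 'b \<Rightarrow> 'b \<Rightarrow> 'k::field) \<Rightarrow> 'g set \<Rightarrow> ('b \<Rightarrow> 'b \<Rightarrow> 'k) set"
  where "gen_alg B f S = eval_mat B f ` carrier (free_alg S)"

lemma free_fin_support: "p \<in> carrier (free_alg S) \<Longrightarrow> finite {w. p w \<noteq> 0}"
  by (simp add: carrier_free_alg)

context
  fixes B :: "'b set" and f :: "'g \<Rightarrow> 'b \<Rightarrow> 'b \<Rightarrow> 'k::field" and S :: "'g set"
  assumes B: "finite B" and f: "f ` S \<subseteq> carrier (mat_alg B)"
begin

lemma gen_alg_gen: "g \<in> S \<Longrightarrow> f g \<in> gen_alg B f S"
proof -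
  assume g: "g \<in> S"
  then have "f g = eval_mat B f (basis_word [g])"
    using f by (simp add: eval_mat_basis_word mat_mult_one B image_subset_iff)
  then show "f g \<in> gen_alg B f S" unfolding gen_alg_def using g by (simp add: basis_word_closed)
qed

lemma gen_alg_one: "mat_one B \<in> gen_alg B f S"
proof -
  have "mat_one B = eval_mat B f (basis_word [])" by (simp add: eval_mat_basis_word)
  then show ?thesis unfolding gen_alg_def by (simp add: basis_word_closed)
qed

lemma gen_alg_mult: "M \<in> gen_alg B f S \<Longrightarrow> N \<in> gen_alg B f S \<Longrightarrow> mat_mult B M N \<in> gen_alg B f S"
  unfolding gen_alg_def using eval_mat_conv[OF B f] conv_closed by (force simp: image_iff)

lemma gen_alg_add: "M \<in> gen_alg B f S \<Longrightarrow> N \<in> gen_alg B f S \<Longrightarrow> M + N \<in> gen_alg B f S"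
proof -
  assume "M \<in> gen_alg B f S" "N \<in> gen_alg B f S"
  then obtain p q where pq: "M = eval_mat B f p" "N = eval_mat B f q"
    "p \<in> carrier (free_alg S)" "q \<in> carrier (free_alg S)" unfolding gen_alg_def by blast
  have eq: "M + N = eval_mat B f (p + q)"
    unfolding pq(1,2) by (rule eval_mat_add[symmetric]) (rule free_fin_support pq(3,4))+
  show ?thesis unfolding eq gen_alg_def by (rule imageI) (rule free_add_closed[OF pq(3,4)])
qed

lemma gen_alg_minus: "M \<in> gen_alg B f S \<Longrightarrow> N \<in> gen_alg B f S \<Longrightarrow> M - N \<in> gen_alg B f S"
proof -
  assume "M \<in> gen_alg B f S" "N \<in> gen_alg B f S"
  then obtain p q where pq: "M = eval_mat B f p" "N = eval_mat B f q"
    "p \<in> carrier (free_alg S)" "q \<in> carrier (free_alg S)" unfolding gen_alg_def by blast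
  have eq: "M - N = eval_mat B f (p - q)"
    unfolding pq(1,2) by (rule eval_mat_minus[symmetric]) (rule free_fin_support pq(3,4))+
  show ?thesis unfolding eq gen_alg_def by (rule imageI) (rule free_minus_closed[OF pq(3,4)])
qed

lemma gen_alg_scl: "M \<in> gen_alg B f S \<Longrightarrow> scl c M \<in> gen_alg B f S"
proof -
  assume "M \<in> gen_alg B f S"
  then obtain p where p: "M = eval_mat B f p" "p \<in> carrier (free_alg S)" unfolding gen_alg_def by blast
  have eq: "scl c M = eval_mat B f (\<lambda>w. c * p w)" unfolding p(1) scl_def by (rule eval_mat_scale[symmetric])
  show ?thesis unfolding eq gen_alg_def by (rule imageI) (rule free_scale_closed[OF p(2)])
qed

lemma gen_alg_zero: "0 \<in> gen_alg B f S"
  using gen_alg_minus[OF gen_alg_one gen_alg_one] by simp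

lemma gen_alg_sum:
  assumes "finite W" "\<And>w. w \<in> W \<Longrightarrow> M w \<in> gen_alg B f S"
  shows "(\<lambda>a b. \<Sum>w\<in>W. M w a b) \<in> gen_alg B f S"
  using assms
proof (induction W)
  case empty
  then show ?case using gen_alg_zero by (simp add: zero_fun_def)
next
  case (insert w W)
  have "(\<lambda>a b. \<Sum>w\<in>insert w W. M w a b) = M w + (\<lambda>a b. \<Sum>w\<in>W. M w a b)"
    using insert by (auto simp: fun_eq_iff)
  then show ?case using insert gen_alg_add by simp
qed

lemma gen_alg_word: "(\<And>x. x \<in> set w \<Longrightarrow> g x \<in> gen_alg B f S) \<Longrightarrow> word_prod (mat_alg B) g w \<in> gen_alg B f S"
  by (induction w) (auto simp: gen_alg_one gen_alg_mult)

lemma gen_alg_least: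
  assumes "g ` S' \<subseteq> gen_alg B f S"
  shows "gen_alg B g S' \<subseteq> gen_alg B f S"
proof
  fix M assume "M \<in> gen_alg B g S'"
  then obtain p where p: "p \<in> carrier (free_alg S')" "M = eval_mat B g p" by (auto simp: gen_alg_def)
  have "scl (p w) (word_prod (mat_alg B) g w) \<in> gen_alg B f S" if "w \<in> {w. p w \<noteq> 0}" for w
    using p that assms unfolding carrier_free_alg by (intro gen_alg_scl gen_alg_word) blast
  then show "M \<in> gen_alg B f S"
    using gen_alg_sum[OF free_fin_support[OF p(1)]] unfolding p(2) eval_mat_def scl_def by simp
qed

lemma ring_gen_alg: "ring ((mat_alg B)\<lparr>carrier := gen_alg B f S\<rparr>)"
  unfolding gen_alg_def by (rule ring_hom_ring.img_is_ring[OF eval_mat_ring_hom[OF B f]])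

lemma gen_alg_a_minus:
  assumes "M \<in> gen_alg B f S" "N \<in> gen_alg B f S"
  shows "M \<ominus>\<^bsub>(mat_alg B)\<lparr>carrier := gen_alg B f S\<rparr>\<^esub> N = M - N"
  using ring.minus_eqI[OF ring_gen_alg, of M N "M - N"] assms by (simp add: gen_alg_minus)

end

section \<open>Relations as combinations of words, and their evaluation\<close>

lemma word_prod_carrier_update: "word_prod (A\<lparr>carrier := H\<rparr>) f w = word_prod A f w"
  by (induction w) simp_all

lemma finite_basis_word [simp]: "finite {w. (basis_word u :: 'g list \<Rightarrow> 'k::field) w \<noteq> 0}"
  by (simp add: basis_word_def)

lemma eval_scale_word: "eval_mat B f (\<lambda>w. c * basis_word u w) = scl c (word_prod (mat_alg B) f u)"
  unfolding eval_mat_scale eval_mat_basis_word scl_def ..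

lemma eval_minus_word:
  "eval_mat B f (basis_word u - basis_word w) = word_prod (mat_alg B) f u - word_prod (mat_alg B) f w"
  by (simp add: eval_mat_minus eval_mat_basis_word)

lemma eval_serre_word:
  "eval_mat B f (basis_word u - (\<lambda>w. c * basis_word u' w) + basis_word u'') =
    word_prod (mat_alg B) f u - scl c (word_prod (mat_alg B) f u') + word_prod (mat_alg B) f u''"
proof -
  have cl: "basis_word u - (\<lambda>w. c * basis_word u' w) \<in> carrier (free_alg UNIV)"
    "(\<lambda>w. c * basis_word u' w) \<in> carrier (free_alg UNIV)"
    by (intro free_minus_closed free_scale_closed basis_word_closed; simp)+
  show ?thesis
    unfolding eval_mat_add[OF free_fin_support[OF cl(1)] finite_basis_word]
      eval_mat_minus[OF finite_basis_word free_fin_support[OF cl(2)]]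
    by (simp only: eval_scale_word eval_mat_basis_word)
qed

lemma free_gen_conv: "conv (free_gen g) (free_gen g') = basis_word [g, g']"
  by (simp add: free_gen_eq_basis_word conv_basis_word)

lemma free_gen_word:
  "free_gen g \<otimes>\<^bsub>free_alg S\<^esub> free_gen g' = basis_word [g, g']"
  "free_gen g \<otimes>\<^bsub>free_alg S\<^esub> free_gen g' \<otimes>\<^bsub>free_alg S\<^esub> free_gen g'' = basis_word [g, g', g'']"
  "free_gen g [^]\<^bsub>free_alg S\<^esub> (2::nat) \<otimes>\<^bsub>free_alg S\<^esub> free_gen g' = basis_word [g, g, g']"
  "free_gen g' \<otimes>\<^bsub>free_alg S\<^esub> free_gen g [^]\<^bsub>free_alg S\<^esub> (2::nat) = basis_word [g', g, g]"
proof -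
  have pow: "free_gen g [^]\<^bsub>free_alg S\<^esub> (2::nat) = basis_word [g, g]"
    by (simp add: numeral_2_eq_2 nat_pow_def free_gen_eq_basis_word conv_basis_word)
  show "free_gen g [^]\<^bsub>free_alg S\<^esub> (2::nat) \<otimes>\<^bsub>free_alg S\<^esub> free_gen g' = basis_word [g, g, g']"
    "free_gen g' \<otimes>\<^bsub>free_alg S\<^esub> free_gen g [^]\<^bsub>free_alg S\<^esub> (2::nat) = basis_word [g', g, g]"
    unfolding pow by (simp_all add: free_gen_eq_basis_word conv_basis_word)
qed (simp_all add: free_gen_eq_basis_word conv_basis_word)

text \<open>Replaces record operations by words and pointwise operations. The letters must lie in
  \<open>S\<close>, since the abstract difference is identified with the pointwise one on the
  carrier.\<close>

lemma serre_rels_free: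
  fixes c :: "nat \<Rightarrow> 'g"
  assumes c: "c ` {1..<n} \<subseteq> S"
  shows "serre_rels (free_alg S) n (free_gen \<circ> c) =
    {(basis_word [c i, c i, c j] - (\<lambda>w. (v + inverse v) * basis_word [c i, c j, c i] w) + basis_word [c j, c i, c i], 0)
      |i j. i \<in> {1..<n} \<and> j \<in> {1..<n} \<and> \<bar>int i - int j\<bar> = 1} \<union>
    {(basis_word [c i, c j] - basis_word [c j, c i], 0)
      |i j. i \<in> {1..<n} \<and> j \<in> {1..<n} \<and> \<bar>int i - int j\<bar> \<noteq> 1}"
proof -
  have cong: "{f i j |i j. P i j} = {g i j |i j. P i j}" if "\<And>i j. P i j \<Longrightarrow> f i j = g i j"
    for P and f g :: "nat \<Rightarrow> nat \<Rightarrow> ('g list \<Rightarrow> Qv) \<times> ('g list \<Rightarrow> Qv)"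
    by (intro Collect_cong ex_cong1) (use that in auto)
  have "basis_word [c i, c i, c j] \<ominus>\<^bsub>free_alg S\<^esub> (\<lambda>w. (v + inverse v) * basis_word [c i, c j, c i] w) =
    basis_word [c i, c i, c j] - (\<lambda>w. (v + inverse v) * basis_word [c i, c j, c i] w)"
    "(basis_word [c i, c j] :: _ \<Rightarrow> Qv) \<ominus>\<^bsub>free_alg S\<^esub> basis_word [c j, c i] = basis_word [c i, c j] - basis_word [c j, c i]"
    if "i \<in> {1..<n}" "j \<in> {1..<n}" for i j
    using that c by (intro free_a_minus free_scale_closed basis_word_closed; auto)+
  note eqs = this
  show ?thesis
    unfolding serre_rels_def comp_def free_gen_word(2-4)
    unfolding free_gen_word(1) free_alg_simps(3-5)
    by (intro arg_cong2[where f = "(\<union>)"] cong) (simp_all only: eqs)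
qed

text \<open>Stated for an arbitrary map \<open>c\<close> from indices to letters, because it serves
  the raising and the lowering generators, both of \<open>U_gl\<close> and of the Schur
  presentation.\<close>

lemma serre_rels_hold:
  assumes c: "c ` {1..<n} \<subseteq> S" and B: "finite B" and f: "f ` S \<subseteq> carrier (mat_alg B)"
    and serre: "\<And>i j. \<lbrakk>i \<in> {1..<n}; j \<in> {1..<n}; \<bar>int i - int j\<bar> = 1\<rbrakk> \<Longrightarrow> serre_mat B v (f (c i)) (f (c j)) = 0"
    and comm: "\<And>i j. \<lbrakk>i \<in> {1..<n}; j \<in> {1..<n}; \<bar>int i - int j\<bar> \<noteq> 1\<rbrakk> \<Longrightarrow>
      mat_mult B (f (c i)) (f (c j)) = mat_mult B (f (c j)) (f (c i))"
    and lr: "(l, r) \<in> serre_rels (free_alg S) n (free_gen \<circ> c)"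
  shows "eval_mat B f l = eval_mat B f r \<and> l \<in> carrier (free_alg S) \<and> r \<in> carrier (free_alg S)"
proof -
  have [simp]: "mat_mult B (f (c i)) (mat_one B) = f (c i)" if "i \<in> {1..<n}" for i
    using that c f B by (intro mat_mult_one) blast+
  have z: "0 \<in> carrier (free_alg S)" by (simp add: carrier_free_alg)
  from lr consider
    (a) i j where "l = basis_word [c i, c i, c j] - (\<lambda>w. (v + inverse v) * basis_word [c i, c j, c i] w) + basis_word [c j, c i, c i]"
      "r = 0" "i \<in> {1..<n}" "j \<in> {1..<n}" "\<bar>int i - int j\<bar> = 1"
    | (b) i j where "l = basis_word [c i, c j] - basis_word [c j, c i]" "r = 0"
      "i \<in> {1..<n}" "j \<in> {1..<n}" "\<bar>int i - int j\<bar> \<noteq> 1"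
    unfolding serre_rels_free[OF c] by blast
  then show ?thesis
  proof cases
    case a
    have "eval_mat B f l = 0"
      unfolding a(1) eval_serre_word using serre[OF a(3-5)] a(3,4)
      by (simp add: serre_mat_def del: atLeastLessThan_iff)
    moreover have "l \<in> carrier (free_alg S)"
      unfolding a(1) using a(3,4) c
      by (intro free_add_closed free_minus_closed free_scale_closed basis_word_closed) auto
    ultimately show ?thesis using a(2) z by simp
  next
    case b
    have "eval_mat B f l = 0"
      unfolding b(1) eval_minus_word using comm[OF b(3-5)] b(3,4)
      by (simp del: atLeastLessThan_iff)
    moreover have "l \<in> carrier (free_alg S)"
      unfolding b(1) using b(3,4) c
      by (intro free_minus_closed basis_word_closed) auto
    ultimately show ?thesis using b(2) z by simp
  qed
qed

lemma serre_mat_inverse: "serre_mat B (inverse q) = serre_mat B q"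
  unfolding serre_mat_def by (simp add: add.commute)

context
  fixes n d :: nat
begin

lemma tensor_gen_closed: "tensor_gen n d ` U_gens n \<subseteq> carrier (mat_alg (tensor_basis n d))"
  using tensor_gen_EF_closed(1,2)
  by (auto simp: U_gens_def tensor_gen_KL diag_closed simp del: tensor_gen.simps)

text \<open>Shows that tensor space is a module for \<open>U_gl\<close>; this is what gives
  \<open>tensor_rep\<close> a definite value on each coset.\<close>

lemma U_presentation: "matrix_presentation (tensor_basis n d) (tensor_gen n d) (U_gens n) (U_rels n)"
proof -
  let ?B = "tensor_basis n d" and ?f = "tensor_gen n d" and ?S = "U_gens n"
  let ?F = "free_alg ?S :: (Qv, ugen list \<Rightarrow> Qv) module"
  have nz: "v \<noteq> 0" using v_pos by simp
  have mem: "UE ` {1..<n} \<subseteq> ?S" "UF ` {1..<n} \<subseteq> ?S" "UK ` {1..n} \<subseteq> ?S" "UL ` {1..n} \<subseteq> ?S"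
    by (auto simp: U_gens_def)
  have one: "mat_mult ?B (?f g) (mat_one ?B) = ?f g" if "g \<in> ?S" for g
    using tensor_gen_closed that by (intro mat_mult_one finite_tensor_basis) auto
  have two: "word_prod (mat_alg ?B) ?f [g, g'] = mat_mult ?B (?f g) (?f g')" if "g' \<in> ?S" for g g'
    by (simp add: one that)
  have cl: "basis_word [g, g'] \<in> carrier ?F" if "g \<in> ?S" "g' \<in> ?S" for g g'
    using that by (intro basis_word_closed) auto
  have z: "0 \<in> carrier ?F" by (simp add: carrier_free_alg)
  have cl1: "basis_word [] \<in> carrier ?F" by (simp add: basis_word_closed)
  have *: "eval_mat ?B ?f l = eval_mat ?B ?f r \<and> l \<in> carrier ?F \<and> r \<in> carrier ?F"
    if lr: "(l, r) \<in> U_rels n" for l r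
  proof -
    from lr[unfolded U_rels_def gl_rels_def comp_def free_alg_simps free_gen_conv] consider
      (1) i j where "l = basis_word [UK i, UK j]" "r = basis_word [UK j, UK i]" "i \<in> {1..n}" "j \<in> {1..n}"
      | (2) i where "l = basis_word [UK i, UL i]" "r = basis_word []" "i \<in> {1..n}"
      | (3) i where "l = basis_word [UL i, UK i]" "r = basis_word []" "i \<in> {1..n}"
      | (4) i j where "l = basis_word [UE i, UF j] \<ominus>\<^bsub>?F\<^esub> basis_word [UF j, UE i]"
          "r = (if i = j then (\<lambda>w. inverse (v - inverse v) *
            (basis_word [UK i, UL (i + 1)] \<ominus>\<^bsub>?F\<^esub> basis_word [UL i, UK (i + 1)]) w) else 0)"
          "i \<in> {1..<n}" "j \<in> {1..<n}"
      | (5) i j where "l = basis_word [UK i, UE j]" "r = (\<lambda>w. v powi root j i * basis_word [UE j, UK i] w)"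
          "i \<in> {1..n}" "j \<in> {1..<n}"
      | (6) i j where "l = basis_word [UK i, UF j]" "r = (\<lambda>w. v powi - root j i * basis_word [UF j, UK i] w)"
          "i \<in> {1..n}" "j \<in> {1..<n}"
      | (7) "(l, r) \<in> serre_rels ?F n (free_gen \<circ> UE)"
      | (8) "(l, r) \<in> serre_rels ?F n (free_gen \<circ> UF)"
      unfolding comp_def by blast
    then show ?thesis
    proof cases
      case 1
      have g: "UK i \<in> ?S" "UK j \<in> ?S" using 1(3-) by (auto simp: U_gens_def)
      show ?thesis
        unfolding 1(1,2) eval_mat_basis_word two[OF g(1)] two[OF g(2)]
        by (simp add: tensor_gen_KL diag_mult finite_tensor_basis mult.commute cl g del: tensor_gen.simps)
    next
      case 2
      have g: "UK i \<in> ?S" "UL i \<in> ?S" using 2(3-) by (auto simp: U_gens_def)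
      show ?thesis
        unfolding 2(1,2) eval_mat_basis_word two[OF g(2)]
        by (simp add: tensor_gen_KL diag_mult finite_tensor_basis mat_one_diag cl cl1 g power_int_minus nz
            del: tensor_gen.simps)
    next
      case 3
      have g: "UK i \<in> ?S" "UL i \<in> ?S" using 3(3-) by (auto simp: U_gens_def)
      show ?thesis
        unfolding 3(1,2) eval_mat_basis_word two[OF g(1)]
        by (simp add: tensor_gen_KL diag_mult finite_tensor_basis mat_one_diag cl cl1 g power_int_minus nz
            del: tensor_gen.simps)
    next
      case 4
      have g: "UE i \<in> ?S" "UF j \<in> ?S" "UK i \<in> ?S" "UL i \<in> ?S" "UK (i + 1) \<in> ?S" "UL (i + 1) \<in> ?S" using 4(3-) by (auto simp: U_gens_def)
      have l: "l = basis_word [UE i, UF j] - basis_word [UF j, UE i]"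
        unfolding 4(1) using cl g by (intro free_a_minus) auto
      have r: "r = (if i = j then (\<lambda>w. inverse (v - inverse v) *
            (basis_word [UK i, UL (i + 1)] - basis_word [UL i, UK (i + 1)]) w) else 0)"
        unfolding 4(2) free_a_minus[OF cl[OF g(3,6)] cl[OF g(4,5)]] ..
      \<comment> \<open>The two products of \<open>K\<close> and \<open>L\<close> act on a basis
        tensor by opposite powers of \<open>v\<close>, whose normalized difference is a quantum
        integer.\<close>
      have q: "inverse (v - inverse v) * (v powi cnt bs i * v powi - cnt bs (i + 1) - v powi - cnt bs i * v powi cnt bs (i + 1)) =
        qint (cnt bs i - cnt bs (i + 1))" for bs
        using nz by (simp add: qint_def divide_inverse mult.commute power_int_diff power_int_minus)
      have "eval_mat ?B ?f l = (if i = j then diag ?B (\<lambda>bs. qint (cnt bs i - cnt bs (i + 1))) else 0)"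
        unfolding l eval_minus_word two[OF g(1)] two[OF g(2)] by (rule tensor_gen_EF[OF 4(3,4)])
      also have "\<dots> = eval_mat ?B ?f r"
      proof (cases "i = j")
        case True
        have "eval_mat ?B ?f r = scl (inverse (v - inverse v))
          (mat_mult ?B (?f (UK i)) (?f (UL (i + 1))) - mat_mult ?B (?f (UL i)) (?f (UK (i + 1))))"
          unfolding r if_P[OF True] eval_mat_scale eval_minus_word two[OF g(6)] two[OF g(5)] scl_def ..
        also have "\<dots> = diag ?B (\<lambda>bs. qint (cnt bs i - cnt bs (i + 1)))"
          unfolding tensor_gen_KL diag_mult[OF finite_tensor_basis] q[symmetric]
          by (auto simp: diag_def scl_def fun_eq_iff)
        finally show ?thesis using True by simp
      qed (simp add: r)
      finally have "eval_mat ?B ?f l = eval_mat ?B ?f r" .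
      moreover have "l \<in> carrier ?F" unfolding l by (intro free_minus_closed cl g)
      moreover have "r \<in> carrier ?F"
      proof (cases "i = j")
        case True
        show ?thesis
          unfolding r if_P[OF True] by (intro free_scale_closed free_minus_closed cl g)
      next
        case False
        show ?thesis unfolding r if_not_P[OF False] by (rule z)
      qed
      ultimately show ?thesis by blast
    next
      case 5
      have g: "UK i \<in> ?S" "UE j \<in> ?S" using 5(3-) by (auto simp: U_gens_def)
      have "v powi cnt as i * ?f (UE j) as bs = v powi root j i * (?f (UE j) as bs * v powi cnt bs i)" for as bs
      proof (cases "?f (UE j) as bs = 0")
        case False
        show ?thesis unfolding tensor_gen_weight(1)[OF 5(4) False] using nz by (simp add: power_int_add)
      qed (simp del: tensor_gen.simps)
      then have "mat_mult ?B (?f (UK i)) (?f (UE j)) = scl (v powi (root j i)) (mat_mult ?B (?f (UE j)) (?f (UK i)))"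
        unfolding tensor_gen_KL scl_def
          diag_mult_left[OF finite_tensor_basis tensor_gen_EF_closed(1)[OF 5(4)]]
          diag_mult_right[OF finite_tensor_basis tensor_gen_EF_closed(1)[OF 5(4)]]
        by (intro ext)
      then show ?thesis
        unfolding 5(1,2) eval_scale_word eval_mat_basis_word two[OF g(1)] two[OF g(2)]
        by (simp add: cl g free_scale_closed del: tensor_gen.simps)
    next
      case 6
      have g: "UK i \<in> ?S" "UF j \<in> ?S" using 6(3-) by (auto simp: U_gens_def)
      have "v powi cnt as i * ?f (UF j) as bs = v powi - root j i * (?f (UF j) as bs * v powi cnt bs i)" for as bs
      proof (cases "?f (UF j) as bs = 0")
        case False
        show ?thesis unfolding tensor_gen_weight(2)[OF 6(4) False]
          using nz by (simp add: power_int_diff power_int_minus field_simps)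
      qed (simp del: tensor_gen.simps)
      then have "mat_mult ?B (?f (UK i)) (?f (UF j)) = scl (v powi (- root j i)) (mat_mult ?B (?f (UF j)) (?f (UK i)))"
        unfolding tensor_gen_KL scl_def
          diag_mult_left[OF finite_tensor_basis tensor_gen_EF_closed(2)[OF 6(4)]]
          diag_mult_right[OF finite_tensor_basis tensor_gen_EF_closed(2)[OF 6(4)]]
        by (intro ext)
      then show ?thesis
        unfolding 6(1,2) eval_scale_word eval_mat_basis_word two[OF g(1)] two[OF g(2)]
        by (simp add: cl g free_scale_closed del: tensor_gen.simps)
    next
      case 7
      show ?thesis
        by (rule serre_rels_hold[OF mem(1) finite_tensor_basis tensor_gen_closed _ _ 7])
          (use tensor_gen_serre(1) tensor_gen_commute(1) in auto)
    next
      case 8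
      show ?thesis
        by (rule serre_rels_hold[OF mem(2) finite_tensor_basis tensor_gen_closed _ _ 8])
          (use tensor_gen_serre(2) tensor_gen_commute(2) in \<open>auto simp: serre_mat_inverse\<close>)
    qed
  qed
  show ?thesis
    by unfold_locales (use finite_tensor_basis tensor_gen_closed * in auto)
qed

text \<open>Eliminates cosets: from here on the Schur algebra is handled as the matrix algebra
  generated by the operators on tensor space.\<close>

lemma schur_alg_eq: "schur_alg n d = (mat_alg (tensor_basis n d))
  \<lparr>carrier := gen_alg (tensor_basis n d) (tensor_gen n d) (U_gens n)\<rparr>"
proof -
  interpret U: matrix_presentation "tensor_basis n d" "tensor_gen n d" "U_gens n" "U_rels n"
    by (rule U_presentation)
  have "tensor_rep n d ` carrier (U_gl n) = gen_alg (tensor_basis n d) (tensor_gen n d) (U_gens n)"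
    unfolding U_gl_def U.carrier_presented gen_alg_def image_image tensor_rep_def
    by (intro image_cong refl U.eval_coset(2))
  then show ?thesis unfolding schur_alg_def by simp
qed

lemma schur_U_eq: "g \<in> U_gens n \<Longrightarrow> schur_U n d g = tensor_gen n d g"
  unfolding schur_U_def tensor_rep_def
  by (rule matrix_presentation.eval_presented_gen[OF U_presentation])

end

section \<open>Weight idempotents\<close>

lemma finsum_free:
  fixes g :: "'w \<Rightarrow> 'g list \<Rightarrow> 'k::field"
  assumes "finite W" "\<And>x. x \<in> W \<Longrightarrow> g x \<in> carrier (free_alg S)"
  shows "finsum (free_alg S) g W = (\<lambda>w. \<Sum>x\<in>W. g x w) \<and> (\<lambda>w. \<Sum>x\<in>W. g x w) \<in> carrier (free_alg S)"
proof -
  interpret ring "free_alg S :: ('k, 'g list \<Rightarrow> 'k) module" by (rule ring_free_alg)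
  have 1: "finsum (free_alg S) g W = (\<lambda>w. \<Sum>x\<in>W. g x w)"
    using assms
  proof (induction W)
    case (insert x W)
    then have "finsum (free_alg S) g (insert x W) = g x + finsum (free_alg S) g W"
      by (subst finsum_insert) auto
    then show ?case using insert by (auto simp: fun_eq_iff)
  qed (auto simp: fun_eq_iff)
  have "finsum (free_alg S) g W \<in> carrier (free_alg S)" by (rule finsum_closed) (use assms in auto)
  then show ?thesis using 1 by simp
qed

lemma eval_mat_sum:
  assumes "finite W" "\<And>x. x \<in> W \<Longrightarrow> g x \<in> carrier (free_alg S)"
  shows "eval_mat B f (\<lambda>w. \<Sum>x\<in>W. g x w) = (\<lambda>a b. \<Sum>x\<in>W. eval_mat B f (g x) a b)"
  using assms
proof (induction W)
  case empty
  have "eval_mat B f (\<lambda>w. 0) = (\<lambda>a b. 0)" by (simp add: eval_mat_def)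
  then show ?case by simp
next
  case (insert x W)
  have cl: "(\<lambda>w. \<Sum>x\<in>W. g x w) \<in> carrier (free_alg S)" using finsum_free[of W g S] insert by blast
  have "eval_mat B f (\<lambda>w. \<Sum>x\<in>insert x W. g x w) = eval_mat B f (g x + (\<lambda>w. \<Sum>x\<in>W. g x w))"
    using insert by (intro arg_cong[where f = "eval_mat B f"]) (auto simp: fun_eq_iff)
  also have "\<dots> = eval_mat B f (g x) + eval_mat B f (\<lambda>w. \<Sum>x\<in>W. g x w)"
    by (rule eval_mat_add) (use insert.prems cl free_fin_support in blast)+
  finally show ?case using insert by (auto simp: fun_eq_iff)
qed

lemma word_prod_diag:
  "finite B \<Longrightarrow> word_prod (mat_alg B) (\<lambda>s. diag B (\<phi> s)) xs = diag B (\<lambda>b. \<Prod>s\<leftarrow>xs. \<phi> s b)"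
  by (induction xs) (simp_all add: mat_one_diag diag_mult)

lemma word_prod_cong: "(\<And>x. x \<in> set xs \<Longrightarrow> f x = g x) \<Longrightarrow> word_prod A f xs = word_prod A g xs"
  by (induction xs) simp_all

lemma prod_list_upt: "(\<Prod>s\<leftarrow>[1..<t + 1]. \<phi> s) = prod \<phi> {1..t}"
  for \<phi> :: "nat \<Rightarrow> 'a::comm_monoid_mult"
  by (induction t) (auto simp: mult.commute)

text \<open>The eigenvalue of the \<open>s\<close>-th factor of \<open>[K; t]\<close> on vectors
  with \<open>K = v^c\<close>; the product over \<open>s\<close> from 1 to \<open>t\<close> is the
  Gaussian binomial of \<open>c\<close> and \<open>t\<close>.\<close>

definition qfac :: "int \<Rightarrow> nat \<Rightarrow> Qv"
  where "qfac c s = (v powi (c - int s + 1) - v powi (int s - 1 - c)) / (v powi int s - v powi - int s)"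

lemma v_powi_strict_mono: "m < k \<Longrightarrow> v powi m < v powi k"
  using v_gt_1 by (intro power_int_strict_increasing) auto

text \<open>The numerators are the denominators in reverse order.\<close>

lemma prod_qfac_self: "(\<Prod>s=1..t. qfac (int t) s) = 1"
proof -
  let ?x = "\<lambda>s. v powi int s - v powi - int s"
  have nz: "?x s \<noteq> 0" if "s \<in> {1..t}" for s
    using v_powi_strict_mono[of "- int s" "int s"] that by auto
  have "(\<Prod>s=1..t. qfac (int t) s) = (\<Prod>s=1..t. ?x (t + 1 - s)) / (\<Prod>s=1..t. ?x s)"
    unfolding prod_dividef[symmetric]
    by (intro prod.cong) (auto simp: qfac_def of_nat_diff algebra_simps)
  also have "(\<Prod>s=1..t. ?x (t + 1 - s)) = (\<Prod>s=1..t. ?x s)"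
    by (rule prod.reindex_bij_witness[where i = "\<lambda>s. t + 1 - s" and j = "\<lambda>s. t + 1 - s"]) auto
  finally show ?thesis using nz by simp
qed

text \<open>The factor with \<open>s = c + 1\<close> has numerator zero.\<close>

lemma prod_qfac_less:
  assumes "0 \<le> c" "c < int t"
  shows "(\<Prod>s=1..t. qfac c s) = 0"
proof -
  have "qfac c (nat (c + 1)) = 0" using assms by (simp add: qfac_def)
  moreover have "nat (c + 1) \<in> {1..t}" using assms by auto
  ultimately show ?thesis by (meson finite_atLeastAtMost prod_zero)
qed

lemma finite_weights: "finite (weights n d)"
proof (rule finite_subset)
  show "finite {f. \<forall>x. (x \<in> {1..n} \<longrightarrow> f x \<in> {0..int d}) \<and> (x \<notin> {1..n} \<longrightarrow> f x = (0::int))}"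
    by (rule finite_set_of_finite_funs) auto
  show "weights n d \<subseteq> {f. \<forall>x. (x \<in> {1..n} \<longrightarrow> f x \<in> {0..int d}) \<and> (x \<notin> {1..n} \<longrightarrow> f x = 0)}"
  proof
    fix \<mu> assume \<mu>: "\<mu> \<in> weights n d"
    have "\<mu> x \<le> int d" if "x \<in> {1..n}" for x
      using \<mu> member_le_sum[of x "{1..n}" \<mu>] that by (auto simp: weights_def)
    then show "\<mu> \<in> {f. \<forall>x. (x \<in> {1..n} \<longrightarrow> f x \<in> {0..int d}) \<and> (x \<notin> {1..n} \<longrightarrow> f x = 0)}"
      using \<mu> by (auto simp: weights_def)
  qed
qed

lemma cnt_in_weights:
  assumes "bs \<in> tensor_basis n d"
  shows "cnt bs \<in> weights n d"
proof -
  have "(\<Sum>i=1..n. cnt bs i) = int (length bs)" if "set bs \<subseteq> {1..n}"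
    using that
  proof (induction bs)
    case (Cons b bs)
    have "(\<Sum>i=1..n. cnt (b # bs) i) = (\<Sum>i=1..n. of_bool (b = i)) + (\<Sum>i=1..n. cnt bs i)"
      by (simp add: sum.distrib)
    also have "(\<Sum>i=1..n. of_bool (b = i)) = (1::int)"
      using Cons.prems by (subst sum.cong[OF refl, of _ _ "\<lambda>i. if i = b then 1 else 0"]) auto
    finally show ?case using Cons by simp
  qed simp
  moreover have "cnt bs i = 0" if "i \<notin> {1..n}" for i
    using assms that by (auto simp: cnt_def tensor_basis_def count_list_0_iff)
  ultimately show ?thesis using assms by (auto simp: weights_def tensor_basis_def cnt_def)
qed

context
  fixes n d :: nat
begin

private abbreviation (input) "B \<equiv> tensor_basis n d"
private abbreviation (input) "H \<equiv> gen_alg B (tensor_gen n d) (U_gens n)"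

lemma K_binom_diag:
  assumes i: "i \<in> {1..n}"
  shows "K_binom (schur_alg n d) (schur_U n d (UK i)) (schur_U n d (UL i)) t =
      diag B (\<lambda>bs. \<Prod>s=1..t. qfac (cnt bs i) s)"
    and "K_binom (schur_alg n d) (schur_U n d (UK i)) (schur_U n d (UL i)) t \<in> H"
proof -
  let ?K = "tensor_gen n d (UK i)" and ?L = "tensor_gen n d (UL i)"
  have nz: "v \<noteq> 0" using v_pos by simp
  have mem: "UK i \<in> U_gens n" "UL i \<in> U_gens n" using i by (auto simp: U_gens_def)
  note clos = finite_tensor_basis[of n d] tensor_gen_closed[of n d]
  have KL: "?K \<in> H" "?L \<in> H" by (rule gen_alg_gen[OF clos], rule mem)+
  let ?g = "\<lambda>s. scl (inverse (v powi int s - v powi - int s))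
    (scl (v powi (- int s + 1)) ?K - scl (v powi (int s - 1)) ?L)"
  have g: "?g s \<in> H" for s by (intro gen_alg_scl[OF clos] gen_alg_minus[OF clos] KL)
  have eq: "K_binom (schur_alg n d) (schur_U n d (UK i)) (schur_U n d (UL i)) t =
    word_prod (mat_alg B) ?g [1..<t + 1]"
  proof -
    have "scl a ?K \<ominus>\<^bsub>(mat_alg B)\<lparr>carrier := H\<rparr>\<^esub> scl b ?L = scl a ?K - scl b ?L" for a b
      by (rule gen_alg_a_minus[OF clos]; rule gen_alg_scl[OF clos]; rule KL)
    then show ?thesis
      unfolding K_binom_def schur_U_eq[OF mem(1)] schur_U_eq[OF mem(2)] schur_alg_eq word_prod_carrier_update
      by (simp add: scl_def del: tensor_gen.simps upt_Suc)
  qed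
  have "?g s = diag B (\<lambda>bs. qfac (cnt bs i) s)" for s
  proof -
    have k: "v powi (- int s + 1) * v powi c - v powi (int s - 1) * v powi - c =
      v powi (c - int s + 1) - v powi (int s - 1 - c)" for c
    proof -
      have e: "c - int s + 1 = (- int s + 1) + c" "int s - 1 - c = (int s - 1) + - c" by simp_all
      show ?thesis unfolding e power_int_add[OF disjI1[OF nz]] ..
    qed
    show ?thesis
    proof (intro ext)
      fix as bs
      show "?g s as bs = diag B (\<lambda>bs. qfac (cnt bs i) s) as bs"
      proof (cases "as = bs \<and> bs \<in> B")
        case True
        then show ?thesis
          unfolding tensor_gen_KL scl_def diag_def minus_apply qfac_def divide_inverse k[symmetric]
          by (simp only: if_True mult.commute simp_thms)
      next
        case False
        then show ?thesis unfolding tensor_gen_KL scl_def diag_def minus_apply by (simp only: if_False) simp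
      qed
    qed
  qed
  then show "K_binom (schur_alg n d) (schur_U n d (UK i)) (schur_U n d (UL i)) t =
      diag B (\<lambda>bs. \<Prod>s=1..t. qfac (cnt bs i) s)"
    unfolding eq by (simp only: word_prod_diag[OF finite_tensor_basis] prod_list_upt)
  show "K_binom (schur_alg n d) (schur_U n d (UK i)) (schur_U n d (UL i)) t \<in> H"
    unfolding eq by (rule gen_alg_word[OF clos]) (rule g)
qed

text \<open>The product of Gaussian binomials is 1 at the weight \<mu> and vanishes at every weight
  with some coordinate below that of \<mu>. All weights have the same total, so a weight different
  from \<mu> does have such a coordinate.\<close>

lemma schur_idem_eq:
  assumes \<mu>: "\<mu> \<in> weights n d"
  shows "schur_idem n d \<mu> = diag B (\<lambda>bs. of_bool (cnt bs = \<mu>))" and "schur_idem n d \<mu> \<in> H"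
proof -
  note clos = finite_tensor_basis[of n d] tensor_gen_closed[of n d]
  have eq: "schur_idem n d \<mu> = word_prod (mat_alg B) (\<lambda>i. K_binom (schur_alg n d)
    (schur_U n d (UK i)) (schur_U n d (UL i)) (nat (\<mu> i))) [1..<n + 1]"
    unfolding schur_idem_def by (subst (1) schur_alg_eq) (rule word_prod_carrier_update)
  show "schur_idem n d \<mu> \<in> H"
    unfolding eq by (rule gen_alg_word[OF clos], rule K_binom_diag(2)) auto
  have "schur_idem n d \<mu> = word_prod (mat_alg B)
    (\<lambda>i. diag B (\<lambda>bs. \<Prod>s=1..nat (\<mu> i). qfac (cnt bs i) s)) [1..<n + 1]"
    unfolding eq by (intro word_prod_cong K_binom_diag(1)) auto
  also have "\<dots> = diag B (\<lambda>bs. \<Prod>i=1..n. \<Prod>s=1..nat (\<mu> i). qfac (cnt bs i) s)"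
    by (simp only: word_prod_diag[OF finite_tensor_basis] prod_list_upt)
  also have "\<dots> = diag B (\<lambda>bs. of_bool (cnt bs = \<mu>))"
  proof (rule diag_cong)
    fix bs assume "bs \<in> B"
    then have c: "cnt bs \<in> weights n d" by (rule cnt_in_weights)
    show "(\<Prod>i=1..n. \<Prod>s=1..nat (\<mu> i). qfac (cnt bs i) s) = of_bool (cnt bs = \<mu>)"
    proof (cases "cnt bs = \<mu>")
      case True
      have "(\<Prod>s=1..nat (\<mu> i). qfac (\<mu> i) s) = 1" for i
        using prod_qfac_self[of "nat (\<mu> i)"] \<mu> by (simp add: weights_def)
      then show ?thesis using True by simp
    next
      case False
      then obtain j where "cnt bs j \<noteq> \<mu> j" by auto
      then have "\<exists>i\<in>{1..n}. cnt bs i < \<mu> i"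
      proof -
        have "cnt bs i = 0 \<and> \<mu> i = 0" if "i \<notin> {1..n}" for i
          using c \<mu> that unfolding weights_def by blast
        then have j: "j \<in> {1..n}" using \<open>cnt bs j \<noteq> \<mu> j\<close> by metis
        have "(\<Sum>i=1..n. cnt bs i) = (\<Sum>i=1..n. \<mu> i)" using c \<mu> by (simp add: weights_def)
        then show ?thesis
          using sum_strict_mono_ex1[of "{1..n}" \<mu> "cnt bs"] j \<open>cnt bs j \<noteq> \<mu> j\<close>
          by (metis finite_atLeastAtMost less_irrefl linorder_neqE not_less)
      qed
      then obtain i where i: "i \<in> {1..n}" "cnt bs i < \<mu> i" by blast
      have "(\<Prod>s=1..nat (\<mu> i). qfac (cnt bs i) s) = 0"
        using i by (intro prod_qfac_less) (auto simp: cnt_def)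
      then show ?thesis using i(1) False by (auto intro!: prod_zero)
    qed
  qed
  finally show "schur_idem n d \<mu> = diag B (\<lambda>bs. of_bool (cnt bs = \<mu>))" .
qed

lemma schur_elem_eq:
  "i \<in> {1..<n} \<Longrightarrow> schur_elem n d (SE i) = tensor_gen n d (UE i)"
  "i \<in> {1..<n} \<Longrightarrow> schur_elem n d (SF i) = tensor_gen n d (UF i)"
  "\<mu> \<in> weights n d \<Longrightarrow> schur_elem n d (SI \<mu>) = diag B (\<lambda>bs. of_bool (cnt bs = \<mu>))"
  by (simp_all add: schur_U_eq U_gens_def schur_idem_eq del: tensor_gen.simps)

lemma schur_elem_closed: "schur_elem n d ` S_gens n d \<subseteq> carrier (mat_alg B)"
  by (auto simp: S_gens_def schur_elem_eq tensor_gen_EF_closed diag_closed simp del: schur_elem.simps tensor_gen.simps)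

lemma gen_alg_schur_elem: "gen_alg B (schur_elem n d) (S_gens n d) = H"
proof
  note closU = finite_tensor_basis[of n d] tensor_gen_closed[of n d]
  note closS = finite_tensor_basis[of n d] schur_elem_closed
  show "gen_alg B (schur_elem n d) (S_gens n d) \<subseteq> H"
  proof (rule gen_alg_least[OF closU])
    have "tensor_gen n d g \<in> H" if "g \<in> U_gens n" for g by (rule gen_alg_gen[OF closU that])
    then show "schur_elem n d ` S_gens n d \<subseteq> H"
      using schur_idem_eq(2)
      by (auto simp: S_gens_def schur_elem_eq(1,2) U_gens_def simp del: schur_elem.simps(2,3) tensor_gen.simps)
  qed
  show "H \<subseteq> gen_alg B (schur_elem n d) (S_gens n d)"
  proof (rule gen_alg_least[OF closS])
    let ?H = "gen_alg B (schur_elem n d) (S_gens n d)"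
    have EF: "tensor_gen n d (UE i) \<in> ?H" "tensor_gen n d (UF i) \<in> ?H" if "i \<in> {1..<n}" for i
      using gen_alg_gen[OF closS, of "SE i"] gen_alg_gen[OF closS, of "SF i"] that
      by (simp_all add: schur_elem_eq S_gens_def del: schur_elem.simps tensor_gen.simps)
    \<comment> \<open>Every function of the weight is interpolated by the idempotents; \<phi> will
      be the eigenvalue of \<open>K_i\<close> or of its inverse.\<close>
    have diag: "diag B (\<lambda>bs. \<phi> (cnt bs)) \<in> ?H" for \<phi>
    proof -
      have "scl (\<phi> \<mu>) (schur_elem n d (SI \<mu>)) \<in> ?H" if "\<mu> \<in> weights n d" for \<mu>
        by (rule gen_alg_scl[OF closS], rule gen_alg_gen[OF closS]) (use that in \<open>simp add: S_gens_def\<close>)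
      then have "(\<lambda>a b. \<Sum>\<mu>\<in>weights n d. scl (\<phi> \<mu>) (schur_elem n d (SI \<mu>)) a b) \<in> ?H"
        by (rule gen_alg_sum[OF closS finite_weights])
      also have "(\<lambda>a b. \<Sum>\<mu>\<in>weights n d. scl (\<phi> \<mu>) (schur_elem n d (SI \<mu>)) a b) = diag B (\<lambda>bs. \<phi> (cnt bs))"
      proof (intro ext)
        fix as bs
        have "(\<Sum>\<mu>\<in>weights n d. scl (\<phi> \<mu>) (schur_elem n d (SI \<mu>)) as bs) =
          (\<Sum>\<mu>\<in>weights n d. if \<mu> = cnt bs then diag B (\<lambda>bs. \<phi> (cnt bs)) as bs else 0)"
          by (intro sum.cong) (auto simp: schur_elem_eq(3) diag_def scl_def simp del: schur_elem.simps)
        also have "\<dots> = diag B (\<lambda>bs. \<phi> (cnt bs)) as bs"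
          using cnt_in_weights[of bs n d] finite_weights[of n d] by (auto simp: diag_def)
        finally show "(\<Sum>\<mu>\<in>weights n d. scl (\<phi> \<mu>) (schur_elem n d (SI \<mu>)) as bs) = diag B (\<lambda>bs. \<phi> (cnt bs)) as bs" .
      qed
      finally show ?thesis .
    qed
    have "tensor_gen n d (UK i) \<in> ?H" "tensor_gen n d (UL i) \<in> ?H" for i
      unfolding tensor_gen_KL using diag[of "\<lambda>\<mu>. v powi \<mu> i"] diag[of "\<lambda>\<mu>. v powi - \<mu> i"] by auto
    then show "tensor_gen n d ` U_gens n \<subseteq> ?H"
      using EF by (auto simp: U_gens_def simp del: tensor_gen.simps)
  qed
qed

end

lemma S_gens_mem:
  "\<mu> \<in> weights n d \<Longrightarrow> SI \<mu> \<in> S_gens n d"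
  "i \<in> {1..<n} \<Longrightarrow> SE i \<in> S_gens n d" "i \<in> {1..<n} \<Longrightarrow> SF i \<in> S_gens n d"
  by (auto simp: S_gens_def)

lemma S_rels_eq:
  "S_rels n d =
    {(basis_word [SI \<mu>, SI \<nu>], if \<mu> = \<nu> then basis_word [SI \<mu>] else 0)
      |\<mu> \<nu>. \<mu> \<in> weights n d \<and> \<nu> \<in> weights n d} \<union>
    {((\<lambda>w. \<Sum>\<mu>\<in>weights n d. basis_word [SI \<mu>] w), basis_word [])} \<union>
    {(basis_word [SE i, SI \<mu>], if \<mu> + root i \<in> weights n d then basis_word [SI (\<mu> + root i), SE i] else 0)
      |i \<mu>. i \<in> {1..<n} \<and> \<mu> \<in> weights n d} \<union>
    {(basis_word [SF i, SI \<mu>], if \<mu> - root i \<in> weights n d then basis_word [SI (\<mu> - root i), SF i] else 0)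
      |i \<mu>. i \<in> {1..<n} \<and> \<mu> \<in> weights n d} \<union>
    {(basis_word [SI \<mu>, SE i], if \<mu> - root i \<in> weights n d then basis_word [SE i, SI (\<mu> - root i)] else 0)
      |i \<mu>. i \<in> {1..<n} \<and> \<mu> \<in> weights n d} \<union>
    {(basis_word [SI \<mu>, SF i], if \<mu> + root i \<in> weights n d then basis_word [SF i, SI (\<mu> + root i)] else 0)
      |i \<mu>. i \<in> {1..<n} \<and> \<mu> \<in> weights n d} \<union>
    {(basis_word [SE i, SF j] - basis_word [SF j, SE i],
      if i = j then (\<lambda>w. \<Sum>\<mu>\<in>weights n d. qint (\<mu> j - \<mu> (j + 1)) * basis_word [SI \<mu>] w) else 0)
      |i j. i \<in> {1..<n} \<and> j \<in> {1..<n}} \<union>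
    serre_rels (free_alg (S_gens n d)) n (free_gen \<circ> SE) \<union>
    serre_rels (free_alg (S_gens n d)) n (free_gen \<circ> SF)"
proof -
  let ?F = "free_alg (S_gens n d) :: (Qv, sgen list \<Rightarrow> Qv) module"
  have cong: "{f i j |i j. P i j} = {g i j |i j. P i j}" if "\<And>i j. P i j \<Longrightarrow> f i j = g i j"
    for P and f g :: "nat \<Rightarrow> nat \<Rightarrow> (sgen list \<Rightarrow> Qv) \<times> (sgen list \<Rightarrow> Qv)"
    by (intro Collect_cong ex_cong1) (use that in auto)
  have cl: "basis_word [SI \<mu>] \<in> carrier ?F" if "\<mu> \<in> weights n d" for \<mu>
    using S_gens_mem(1)[OF that] by (intro basis_word_closed) auto
  have 1: "(\<Oplus>\<^bsub>?F\<^esub>\<mu>\<in>weights n d. basis_word [SI \<mu>]) = (\<lambda>w. \<Sum>\<mu>\<in>weights n d. basis_word [SI \<mu>] w)"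
    using finsum_free[OF finite_weights, of n d "\<lambda>\<mu>. basis_word [SI \<mu>]" "S_gens n d"] cl by blast
  have 2: "(\<Oplus>\<^bsub>?F\<^esub>\<mu>\<in>weights n d. (\<lambda>w. qint (\<mu> j - \<mu> (j + 1)) * basis_word [SI \<mu>] w)) =
    (\<lambda>w. \<Sum>\<mu>\<in>weights n d. qint (\<mu> j - \<mu> (j + 1)) * basis_word [SI \<mu>] w)" for j
    using finsum_free[OF finite_weights, of n d "\<lambda>\<mu> w. qint (\<mu> j - \<mu> (j + 1)) * basis_word [SI \<mu>] w" "S_gens n d"]
      cl free_scale_closed by blast
  have 3: "(basis_word [SE i, SF j] :: _ \<Rightarrow> Qv) \<ominus>\<^bsub>?F\<^esub> basis_word [SF j, SE i] = basis_word [SE i, SF j] - basis_word [SF j, SE i]"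
    if "i \<in> {1..<n}" "j \<in> {1..<n}" for i j
    using S_gens_mem(2)[OF that(1)] S_gens_mem(3)[OF that(2)] by (intro free_a_minus basis_word_closed) auto
  show ?thesis
    unfolding S_rels_def schur_rels_def comp_def free_alg_simps free_gen_conv
    unfolding free_gen_eq_basis_word 1 2
    by (intro arg_cong2[where f = "(\<union>)"] cong refl) (simp only: 3)
qed

text \<open>The four families of shift relations are instances of one fact about matrices whose
  nonzero entries change the weight by a fixed amount, proved once for idempotents on the right and
  once for idempotents on the left.\<close>

lemma S_presentation: "matrix_presentation (tensor_basis n d) (schur_elem n d) (S_gens n d) (S_rels n d)"
proof -
  let ?B = "tensor_basis n d" and ?f = "schur_elem n d" and ?S = "S_gens n d"
  let ?F = "free_alg ?S :: (Qv, sgen list \<Rightarrow> Qv) module"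
  have one: "mat_mult ?B (?f g) (mat_one ?B) = ?f g" if "g \<in> ?S" for g
    using schur_elem_closed[of n d] that by (intro mat_mult_one finite_tensor_basis) auto
  have w1: "eval_mat ?B ?f (basis_word [g]) = ?f g" if "g \<in> ?S" for g
    by (simp add: eval_mat_basis_word one that)
  have w2: "word_prod (mat_alg ?B) ?f [g, g'] = mat_mult ?B (?f g) (?f g')" if "g' \<in> ?S" for g g'
    by (simp add: one that)
  have cl2: "basis_word [g, g'] \<in> carrier ?F" if "g \<in> ?S" "g' \<in> ?S" for g g'
    using that by (intro basis_word_closed) auto
  have cl1: "basis_word [g] \<in> carrier ?F" if "g \<in> ?S" for g
    using that by (intro basis_word_closed) auto
  have z: "0 \<in> carrier ?F" by (simp add: carrier_free_alg)
  have cl0: "basis_word [] \<in> carrier ?F" by (simp add: basis_word_closed)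
  note mem = S_gens_mem
  note fin = finite_tensor_basis[of n d]
  let ?I = "\<lambda>\<mu>. diag ?B (\<lambda>bs. of_bool (cnt bs = \<mu>))"
  have I: "?f (SI \<mu>) = ?I \<mu>" if "\<mu> \<in> weights n d" for \<mu> using schur_elem_eq(3)[OF that] .
  have sumI: "(\<lambda>as bs. \<Sum>\<mu>\<in>weights n d. \<phi> \<mu> * ?I \<mu> as bs) = diag ?B (\<lambda>bs. \<phi> (cnt bs))" for \<phi>
  proof (intro ext)
    fix as bs
    have "(\<Sum>\<mu>\<in>weights n d. \<phi> \<mu> * ?I \<mu> as bs) =
      (\<Sum>\<mu>\<in>weights n d. if \<mu> = cnt bs then diag ?B (\<lambda>bs. \<phi> (cnt bs)) as bs else 0)"
      by (intro sum.cong) (auto simp: diag_def)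
    also have "\<dots> = diag ?B (\<lambda>bs. \<phi> (cnt bs)) as bs"
      using cnt_in_weights[of bs n d] finite_weights[of n d] by (auto simp: diag_def)
    finally show "(\<Sum>\<mu>\<in>weights n d. \<phi> \<mu> * ?I \<mu> as bs) = diag ?B (\<lambda>bs. \<phi> (cnt bs)) as bs" .
  qed
  \<comment> \<open>If \<nu> is not in \<open>weights n d\<close>, then \<open>M\<close> has no
    nonzero entry in a column of weight \<mu>, because every row index has a weight in that
    set.\<close>
  have shift: "mat_mult ?B M (?I \<mu>) = (if \<nu> \<in> weights n d then mat_mult ?B (?I \<nu>) M else 0)"
    if M: "M \<in> carrier (mat_alg ?B)" and wt: "\<And>as bs. M as bs \<noteq> 0 \<Longrightarrow> (cnt bs = \<mu> \<longleftrightarrow> cnt as = \<nu>)" for M \<mu> \<nu>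
  proof (intro ext)
    fix as bs
    show "mat_mult ?B M (?I \<mu>) as bs = (if \<nu> \<in> weights n d then mat_mult ?B (?I \<nu>) M else 0) as bs"
    proof (cases "M as bs = 0")
      case True
      then show ?thesis by (simp add: diag_mult_left[OF fin M] diag_mult_right[OF fin M])
    next
      case False
      then have "as \<in> ?B" using M by (auto simp: carrier_mat_alg)
      then have "cnt as \<in> weights n d" by (rule cnt_in_weights)
      then show ?thesis using wt[OF False]
        by (auto simp: diag_mult_left[OF fin M] diag_mult_right[OF fin M])
    qed
  qed
  have shift': "mat_mult ?B (?I \<mu>) M = (if \<nu> \<in> weights n d then mat_mult ?B M (?I \<nu>) else 0)"
    if M: "M \<in> carrier (mat_alg ?B)" and wt: "\<And>as bs. M as bs \<noteq> 0 \<Longrightarrow> (cnt as = \<mu> \<longleftrightarrow> cnt bs = \<nu>)" for M \<mu> \<nu>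
  proof (intro ext)
    fix as bs
    show "mat_mult ?B (?I \<mu>) M as bs = (if \<nu> \<in> weights n d then mat_mult ?B M (?I \<nu>) else 0) as bs"
    proof (cases "M as bs = 0")
      case True
      then show ?thesis by (simp add: diag_mult_left[OF fin M] diag_mult_right[OF fin M])
    next
      case False
      then have "bs \<in> ?B" using M by (auto simp: carrier_mat_alg)
      then have "cnt bs \<in> weights n d" by (rule cnt_in_weights)
      then show ?thesis using wt[OF False]
        by (auto simp: diag_mult_left[OF fin M] diag_mult_right[OF fin M])
    qed
  qed
  have EFcl: "tensor_gen n d (UE i) \<in> carrier (mat_alg ?B)" "tensor_gen n d (UF i) \<in> carrier (mat_alg ?B)"
    if "i \<in> {1..<n}" for i using tensor_gen_EF_closed that by auto
  have wE: "cnt as = cnt bs + root i" if "i \<in> {1..<n}" "tensor_gen n d (UE i) as bs \<noteq> 0" for i as bs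
    using tensor_gen_weight(1)[OF that] by (auto simp: fun_eq_iff)
  have wF: "cnt as = cnt bs - root i" if "i \<in> {1..<n}" "tensor_gen n d (UF i) as bs \<noteq> 0" for i as bs
    using tensor_gen_weight(2)[OF that] by (auto simp: fun_eq_iff)
  have shift_case: "eval_mat ?B ?f (basis_word [g, g']) = eval_mat ?B ?f (if P then basis_word [h, h'] else 0) \<and>
      basis_word [g, g'] \<in> carrier ?F \<and> (if P then basis_word [h, h'] else 0) \<in> carrier ?F"
    if "g \<in> ?S" "g' \<in> ?S" "P \<Longrightarrow> h \<in> ?S \<and> h' \<in> ?S"
      "mat_mult ?B (?f g) (?f g') = (if P then mat_mult ?B (?f h) (?f h') else 0)" for g g' h h' P
  proof -
    have "eval_mat ?B ?f (if P then basis_word [h, h'] else 0) = (if P then mat_mult ?B (?f h) (?f h') else 0)"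
      using that(3) by (simp add: eval_mat_basis_word w2 del: word_prod_simps)
    moreover have "eval_mat ?B ?f (basis_word [g, g']) = mat_mult ?B (?f g) (?f g')"
      using that(2) by (simp only: eval_mat_basis_word w2)
    ultimately show ?thesis using that cl2 z by simp
  qed
  have *: "eval_mat ?B ?f l = eval_mat ?B ?f r \<and> l \<in> carrier ?F \<and> r \<in> carrier ?F"
    if lr: "(l, r) \<in> S_rels n d" for l r
  proof -
    from lr[unfolded S_rels_eq] consider
      (1) \<mu> \<nu> where "l = basis_word [SI \<mu>, SI \<nu>]" "r = (if \<mu> = \<nu> then basis_word [SI \<mu>] else 0)"
        "\<mu> \<in> weights n d" "\<nu> \<in> weights n d"
      | (2) "l = (\<lambda>w. \<Sum>\<mu>\<in>weights n d. basis_word [SI \<mu>] w)" "r = basis_word []"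
      | (3) i \<mu> where "l = basis_word [SE i, SI \<mu>]"
        "r = (if \<mu> + root i \<in> weights n d then basis_word [SI (\<mu> + root i), SE i] else 0)"
        "i \<in> {1..<n}" "\<mu> \<in> weights n d"
      | (4) i \<mu> where "l = basis_word [SF i, SI \<mu>]"
        "r = (if \<mu> - root i \<in> weights n d then basis_word [SI (\<mu> - root i), SF i] else 0)"
        "i \<in> {1..<n}" "\<mu> \<in> weights n d"
      | (5) i \<mu> where "l = basis_word [SI \<mu>, SE i]"
        "r = (if \<mu> - root i \<in> weights n d then basis_word [SE i, SI (\<mu> - root i)] else 0)"
        "i \<in> {1..<n}" "\<mu> \<in> weights n d"
      | (6) i \<mu> where "l = basis_word [SI \<mu>, SF i]"
        "r = (if \<mu> + root i \<in> weights n d then basis_word [SF i, SI (\<mu> + root i)] else 0)"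
        "i \<in> {1..<n}" "\<mu> \<in> weights n d"
      | (7) i j where "l = basis_word [SE i, SF j] - basis_word [SF j, SE i]"
        "r = (if i = j then (\<lambda>w. \<Sum>\<mu>\<in>weights n d. qint (\<mu> j - \<mu> (j + 1)) * basis_word [SI \<mu>] w) else 0)"
        "i \<in> {1..<n}" "j \<in> {1..<n}"
      | (8) "(l, r) \<in> serre_rels ?F n (free_gen \<circ> SE)"
      | (9) "(l, r) \<in> serre_rels ?F n (free_gen \<circ> SF)"
      by blast
    then show ?thesis
    proof cases
      case 1
      have "eval_mat ?B ?f l = mat_mult ?B (?I \<mu>) (?I \<nu>)"
        unfolding 1(1) eval_mat_basis_word w2[OF mem(1)[OF 1(4)]] I[OF 1(3)] I[OF 1(4)] ..
      also have "\<dots> = (if \<mu> = \<nu> then ?I \<mu> else 0)"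
        unfolding diag_mult[OF fin] by (intro ext, cases "\<mu> = \<nu>") (auto simp: diag_def)
      also have "\<dots> = eval_mat ?B ?f r"
        unfolding 1(2) using w1[OF mem(1)[OF 1(3)]] I[OF 1(3)] by (cases "\<mu> = \<nu>") auto
      finally show ?thesis unfolding 1(1,2) using 1(3,4) cl1 cl2 mem(1) z by simp
    next
      case 2
      have "eval_mat ?B ?f l = (\<lambda>a b. \<Sum>\<mu>\<in>weights n d. eval_mat ?B ?f (basis_word [SI \<mu>]) a b)"
        unfolding 2(1) by (rule eval_mat_sum[OF finite_weights cl1[OF mem(1)]])
      also have "\<dots> = (\<lambda>a b. \<Sum>\<mu>\<in>weights n d. 1 * ?I \<mu> a b)"
        using w1[OF mem(1)] I by (intro ext sum.cong) simp_all
      also have "\<dots> = eval_mat ?B ?f r"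
        unfolding sumI[of "\<lambda>_. 1"] 2(2) eval_mat_basis_word by (simp add: mat_one_diag)
      finally have "eval_mat ?B ?f l = eval_mat ?B ?f r" .
      moreover have "l \<in> carrier ?F"
        unfolding 2(1) by (rule conjunct2[OF finsum_free[OF finite_weights cl1[OF mem(1)]]])
      ultimately show ?thesis using cl0 unfolding 2(2) by blast
    next
      case 3
      have "mat_mult ?B (?f (SE i)) (?f (SI \<mu>)) =
        (if \<mu> + root i \<in> weights n d then mat_mult ?B (?f (SI (\<mu> + root i))) (?f (SE i)) else 0)"
        using shift[OF EFcl(1)[OF 3(3)], of \<mu> "\<mu> + root i"] wE[OF 3(3)] schur_elem_eq(1)[OF 3(3)] I 3(4)
        by (simp del: schur_elem.simps tensor_gen.simps)
      then show ?thesis unfolding 3(1,2) using mem 3(3,4) by (intro shift_case) auto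
    next
      case 4
      have "mat_mult ?B (?f (SF i)) (?f (SI \<mu>)) =
        (if \<mu> - root i \<in> weights n d then mat_mult ?B (?f (SI (\<mu> - root i))) (?f (SF i)) else 0)"
        using shift[OF EFcl(2)[OF 4(3)], of \<mu> "\<mu> - root i"] wF[OF 4(3)] schur_elem_eq(2)[OF 4(3)] I 4(4)
        by (simp del: schur_elem.simps tensor_gen.simps)
      then show ?thesis unfolding 4(1,2) using mem 4(3,4) by (intro shift_case) auto
    next
      case 5
      have "mat_mult ?B (?f (SI \<mu>)) (?f (SE i)) =
        (if \<mu> - root i \<in> weights n d then mat_mult ?B (?f (SE i)) (?f (SI (\<mu> - root i))) else 0)"
        using shift'[OF EFcl(1)[OF 5(3)], of \<mu> "\<mu> - root i"] wE[OF 5(3)] schur_elem_eq(1)[OF 5(3)] I 5(4)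
        by (simp add: eq_diff_eq del: schur_elem.simps tensor_gen.simps)
      then show ?thesis unfolding 5(1,2) using mem 5(3,4) by (intro shift_case) auto
    next
      case 6
      have "mat_mult ?B (?f (SI \<mu>)) (?f (SF i)) =
        (if \<mu> + root i \<in> weights n d then mat_mult ?B (?f (SF i)) (?f (SI (\<mu> + root i))) else 0)"
        using shift'[OF EFcl(2)[OF 6(3)], of \<mu> "\<mu> + root i"] wF[OF 6(3)] schur_elem_eq(2)[OF 6(3)] I 6(4)
        by (simp add: diff_eq_eq del: schur_elem.simps tensor_gen.simps)
      then show ?thesis unfolding 6(1,2) using mem 6(3,4) by (intro shift_case) auto
    next
      case 7
      let ?r = "\<lambda>w. \<Sum>\<mu>\<in>weights n d. qint (\<mu> j - \<mu> (j + 1)) * basis_word [SI \<mu>] w"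
      have cl: "(\<lambda>w. qint (\<mu> j - \<mu> (j + 1)) * basis_word [SI \<mu>] w) \<in> carrier ?F" if "\<mu> \<in> weights n d" for \<mu>
        by (rule free_scale_closed[OF cl1[OF mem(1)[OF that]]])
      have "eval_mat ?B ?f ?r = (\<lambda>a b. \<Sum>\<mu>\<in>weights n d. eval_mat ?B ?f (\<lambda>w. qint (\<mu> j - \<mu> (j + 1)) * basis_word [SI \<mu>] w) a b)"
        by (rule eval_mat_sum[OF finite_weights cl])
      also have "\<dots> = (\<lambda>a b. \<Sum>\<mu>\<in>weights n d. qint (\<mu> j - \<mu> (j + 1)) * ?I \<mu> a b)"
        using w1[OF mem(1)] I by (intro ext sum.cong) (simp_all only: eval_mat_scale)
      finally have r: "eval_mat ?B ?f ?r = diag ?B (\<lambda>bs. qint (cnt bs j - cnt bs (j + 1)))"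
        unfolding sumI .
      have "eval_mat ?B ?f l = (if i = j then diag ?B (\<lambda>bs. qint (cnt bs i - cnt bs (i + 1))) else 0)"
        unfolding 7(1) eval_minus_word w2[OF mem(2)[OF 7(3)]] w2[OF mem(3)[OF 7(4)]]
          schur_elem_eq(1)[OF 7(3)] schur_elem_eq(2)[OF 7(4)]
        by (rule tensor_gen_EF[OF 7(3,4)])
      also have "\<dots> = eval_mat ?B ?f r" unfolding 7(2) by (cases "i = j") (simp_all only: r if_True if_False eval_mat_zero refl)
      finally have e: "eval_mat ?B ?f l = eval_mat ?B ?f r" .
      have "l \<in> carrier ?F" unfolding 7(1) by (intro free_minus_closed cl2 mem 7(3,4))
      moreover have "r \<in> carrier ?F"
        unfolding 7(2) using conjunct2[OF finsum_free[OF finite_weights cl]] z by (cases "i = j") (simp_all only: if_True if_False refl)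
      ultimately show ?thesis using e by blast
    next
      case 8
      have c: "SE ` {1..<n} \<subseteq> ?S" using mem by blast
      show ?thesis
        by (rule serre_rels_hold[OF c fin schur_elem_closed _ _ 8])
          (simp_all only: schur_elem_eq(1) tensor_gen_serre(1) tensor_gen_commute(1))
    next
      case 9
      have c: "SF ` {1..<n} \<subseteq> ?S" using mem by blast
      show ?thesis
        by (rule serre_rels_hold[OF c fin schur_elem_closed _ _ 9])
          (simp_all only: schur_elem_eq(2) tensor_gen_serre(2)[unfolded serre_mat_inverse] tensor_gen_commute(2))
    qed
  qed
  show ?thesis
    by unfold_locales (use finite_tensor_basis schur_elem_closed * in auto)
qed

section \<open>Linear independence of the monomials\<close>

text \<open>The recursion imitates that of \<open>tensor_gen\<close>: either the first factor
  changes, or it is kept and the change happens in the tail.\<close>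

fun change :: "nat \<Rightarrow> nat \<Rightarrow> nat list \<Rightarrow> nat list \<Rightarrow> bool"
  where
    "change x y (b # bs) (a # as) \<longleftrightarrow> b = x \<and> a = y \<and> as = bs \<or> a = b \<and> change x y bs as"
  | "change x y _ _ \<longleftrightarrow> False"

lemma change_iff: "change x y bs as \<longleftrightarrow> (\<exists>p<length bs. bs ! p = x \<and> as = bs[p := y])"
proof (induction x y bs as rule: change.induct)
  case (1 x y b bs a as)
  show ?case
    unfolding change.simps 1 by (auto simp: Ex_less_Suc2)
qed (auto dest: sym[of "[]"])

text \<open>Idempotents get no step; they do not occur in the words \<open>xword\<close>.\<close>

fun letter_step :: "sgen \<Rightarrow> nat list \<Rightarrow> nat list \<Rightarrow> bool"
  where
    "letter_step (SE i) = change (i + 1) i"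
  | "letter_step (SF i) = change i (i + 1)"
  | "letter_step (SI \<mu>) = (\<lambda>_ _. False)"

fun reach :: "sgen list \<Rightarrow> nat list \<Rightarrow> nat list \<Rightarrow> bool"
  where
    "reach [] bs as \<longleftrightarrow> as = bs"
  | "reach (g # w) bs as \<longleftrightarrow> (\<exists>cs. reach w bs cs \<and> letter_step g cs as)"

lemma reach_append: "reach (u @ w) bs as \<longleftrightarrow> (\<exists>cs. reach w bs cs \<and> reach u cs as)"
  by (induction u arbitrary: as) auto

text \<open>The two summands of the comultiplication match the two clauses of \<open>change\<close>,
  weighted by powers of \<open>v\<close>.\<close>

lemma tensor_gen_entry:
  assumes i: "i \<in> {1..<n}" and bs: "bs \<in> tensor_basis n d"
  shows "tensor_gen n d (UE i) as bs \<ge> 0 \<and> (tensor_gen n d (UE i) as bs > 0 \<longleftrightarrow> change (i + 1) i bs as)"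
    and "tensor_gen n d (UF i) as bs \<ge> 0 \<and> (tensor_gen n d (UF i) as bs > 0 \<longleftrightarrow> change i (i + 1) bs as)"
  using bs
proof (induction d arbitrary: as bs)
  case 0
  {
    case 1
    then show ?case using tensor_gen_0 by (simp add: tensor_basis_0 del: tensor_gen.simps)
  next
    case 2
    then show ?case using tensor_gen_0 by (simp add: tensor_basis_0 del: tensor_gen.simps)
  }
next
  case (Suc d)
  have pw: "v powi m > 0" for m using v_pos by (rule zero_less_power_int)
  {
    case 1
    then obtain b bs' where b: "bs = b # bs'" "b \<in> {1..n}" "bs' \<in> tensor_basis n d"
      by (auto simp: tensor_basis_Suc)
    show ?case
    proof (cases as)
      case Nil
      then show ?thesis unfolding tensor_gen_EF_closed(3)[OF i] by (simp add: b)
    next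
      case (Cons a as')
      have "tensor_gen n (Suc d) (UE i) as bs = (if b = i + 1 \<and> a = i \<and> as' = bs' then K_ratio i bs' else 0)
        + (if a = b then tensor_gen n d (UE i) as' bs' else 0)"
        unfolding tensor_gen_EF_closed(3)[OF i] using b
        by (auto simp: Cons mat_unit_E_def diag_def mat_one_def simp del: tensor_gen.simps)
      moreover have "K_ratio i bs' > 0" unfolding K_ratio_def by (rule pw)
      ultimately show ?thesis
        using Suc.IH(1)[OF b(3), of as'] unfolding b(1) Cons
        by (auto simp: add_pos_nonneg add_nonneg_pos simp del: tensor_gen.simps)
    qed
  next
    case 2
    then obtain b bs' where b: "bs = b # bs'" "b \<in> {1..n}" "bs' \<in> tensor_basis n d"
      by (auto simp: tensor_basis_Suc)
    show ?case
    proof (cases as)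
      case Nil
      then show ?thesis unfolding tensor_gen_EF_closed(4)[OF i] by (simp add: b)
    next
      case (Cons a as')
      have "tensor_gen n (Suc d) (UF i) as bs = (if b = i \<and> a = i + 1 \<and> as' = bs' then 1 else 0)
        + (if a = b then K_ratio_inv i b * tensor_gen n d (UF i) as' bs' else 0)"
        unfolding tensor_gen_EF_closed(4)[OF i] using b
        by (auto simp: Cons mat_unit_F_def diag_def mat_one_def simp del: tensor_gen.simps)
      moreover have "K_ratio_inv i b > 0" unfolding K_ratio_inv_def by (rule pw)
      ultimately show ?thesis
        using Suc.IH(2)[OF b(3), of as'] unfolding b(1) Cons
        by (auto simp: add_pos_nonneg add_nonneg_pos zero_less_mult_iff simp del: tensor_gen.simps)
    qed
  }
qed

lemma word_entry:
  assumes "set w \<subseteq> letters n" "bs \<in> tensor_basis n d" "as \<in> tensor_basis n d"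
  defines "M \<equiv> word_prod (mat_alg (tensor_basis n d)) (schur_elem n d) w"
  shows "M as bs \<ge> 0 \<and> (M as bs > 0 \<longleftrightarrow> reach w bs as)"
  unfolding M_def using assms(1,3)
proof (induction w arbitrary: as)
  case Nil
  then show ?case using assms(2) by (auto simp: mat_one_def)
next
  case (Cons g w)
  let ?B = "tensor_basis n d"
  let ?W = "word_prod (mat_alg ?B) (schur_elem n d) w" and ?g = "schur_elem n d g"
  have g: "?g as cs \<ge> 0 \<and> (?g as cs > 0 \<longleftrightarrow> letter_step g cs as)" if "cs \<in> ?B" for cs
    using Cons.prems(1) tensor_gen_entry[OF _ that]
    by (auto simp: letters_def schur_elem_eq simp del: schur_elem.simps tensor_gen.simps)
  have W: "?W cs bs \<ge> 0 \<and> (?W cs bs > 0 \<longleftrightarrow> reach w bs cs)" if "cs \<in> ?B" for cs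
    using Cons that by simp
  \<comment> \<open>\<open>reach\<close> does not restrict the intermediate lists, so paths have to
    be kept inside the basis over which the matrix product sums.\<close>
  have closed: "cs \<in> ?B" if "reach w bs cs" for cs
  proof -
    have "set w \<subseteq> letters n" using Cons.prems by simp
    then show ?thesis
      using that
    proof (induction w arbitrary: cs)
      case Nil
      then show ?case using assms(2) by simp
    next
      case (Cons g w)
      then obtain ds where ds: "ds \<in> ?B" "letter_step g ds cs" by auto
      then obtain p y where y: "cs = ds[p := y]" "y \<in> {1..n}"
        using Cons.prems(1) by (auto simp: letters_def change_iff)
      have "set cs \<subseteq> {1..n}"
        using set_update_subset_insert[of ds p y] y ds(1) unfolding tensor_basis_def by blast
      then show ?case using y ds(1) by (simp add: tensor_basis_def)
    qed
  qed
  have pos: "0 \<le> ?g as cs * ?W cs bs" if "cs \<in> ?B" for cs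
    using g[OF that] W[OF that] by simp
  have e: "word_prod (mat_alg ?B) (schur_elem n d) (g # w) as bs = (\<Sum>cs\<in>?B. ?g as cs * ?W cs bs)"
    by (simp add: mat_mult_def)
  have "0 < (\<Sum>cs\<in>?B. ?g as cs * ?W cs bs) \<longleftrightarrow> (\<exists>cs\<in>?B. 0 < ?g as cs * ?W cs bs)"
    using sum_nonneg[of ?B "\<lambda>cs. ?g as cs * ?W cs bs", OF pos]
      sum_nonneg_eq_0_iff[OF finite_tensor_basis, of n d "\<lambda>cs. ?g as cs * ?W cs bs", OF pos] pos
    by (auto simp: less_le)
  also have "\<dots> \<longleftrightarrow> reach (g # w) bs as"
    using g W closed by (fastforce simp: zero_less_mult_iff not_less)
  finally show ?case unfolding e using sum_nonneg[of ?B "\<lambda>cs. ?g as cs * ?W cs bs", OF pos] by blast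
qed

section \<open>Counting moved tensor factors\<close>

definition poscount :: "(nat \<Rightarrow> nat \<Rightarrow> bool) \<Rightarrow> nat list \<Rightarrow> nat"
  where "poscount Q u = card {p. p < length u \<and> Q p (u ! p)}"

text \<open>A step alters a single position, so the count grows by at most one; it does not grow if
  the property at the new value implies it at the old one.\<close>

lemma poscount_change:
  assumes "change x y s u"
  shows "poscount Q u \<le> poscount Q s + 1" and "(\<And>p. Q p y \<Longrightarrow> Q p x) \<Longrightarrow> poscount Q u \<le> poscount Q s"
proof -
  obtain p where p: "p < length s" "s ! p = x" "u = s[p := y]" using assms by (auto simp: change_iff)
  have "{q. q < length u \<and> Q q (u ! q)} \<subseteq> insert p {q. q < length s \<and> Q q (s ! q)}"
    using p by (auto simp: nth_list_update)
  then have "poscount Q u \<le> card (insert p {q. q < length s \<and> Q q (s ! q)})"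
    unfolding poscount_def by (intro card_mono) auto
  then show "poscount Q u \<le> poscount Q s + 1"
    unfolding poscount_def by (simp add: card_insert_if split: if_splits)
  assume Q: "\<And>p. Q p y \<Longrightarrow> Q p x"
  have "{q. q < length u \<and> Q q (u ! q)} \<subseteq> {q. q < length s \<and> Q q (s ! q)}"
  proof
    fix q assume "q \<in> {q. q < length u \<and> Q q (u ! q)}"
    then show "q \<in> {q. q < length s \<and> Q q (s ! q)}"
      using p Q[of q] by (cases "q = p") (auto simp: nth_list_update)
  qed
  then show "poscount Q u \<le> poscount Q s" unfolding poscount_def by (intro card_mono) auto
qed

lemma reach_length: "reach w s u \<Longrightarrow> length u = length s"
proof (induction w arbitrary: u)
  case (Cons g w)
  then show ?case by (cases g) (auto simp: change_iff)
qed simp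

text \<open>Only \<open>E_i\<close> takes a value across the threshold between \<open>i + 1\<close>
  and \<open>i\<close>; and since all \<open>E\<close> lower values, none newly becomes
  large.\<close>

lemma poscount_SE_le:
  assumes "reach (map SE w) s u"
  shows "poscount (\<lambda>p x. x \<le> i \<and> R p) u \<le> poscount (\<lambda>p x. x \<le> i \<and> R p) s + count_list w i"
    and "poscount (\<lambda>p x. i \<le> x \<and> R p) u \<le> poscount (\<lambda>p x. i \<le> x \<and> R p) s"
  using assms
proof (induction w arbitrary: u)
  case (Cons k w)
  {
    case 1
    then obtain c where c: "reach (map SE w) s c" "change (k + 1) k c u" by auto
    show ?case
      using Cons.IH(1)[OF c(1)] poscount_change[OF c(2), of "\<lambda>p x. x \<le> i \<and> R p"] by (cases "k = i") auto
  next
    case 2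
    then obtain c where c: "reach (map SE w) s c" "change (k + 1) k c u" by auto
    show ?case
      using Cons.IH(2)[OF c(1)] poscount_change(2)[OF c(2), of "\<lambda>p x. i \<le> x \<and> R p"] by auto
  }
qed auto

lemma poscount_SF_le:
  assumes "reach (map SF w) s u"
  shows "poscount (\<lambda>p x. Suc j \<le> x \<and> R p) u \<le> poscount (\<lambda>p x. Suc j \<le> x \<and> R p) s + count_list w j"
    and "p < length s \<Longrightarrow> s ! p \<le> u ! p"
  using assms
proof (induction w arbitrary: u)
  case (Cons k w)
  {
    case 1
    then obtain c where c: "reach (map SF w) s c" "change k (k + 1) c u" by auto
    show ?case
      using Cons.IH(1)[OF c(1)] poscount_change[OF c(2), of "\<lambda>p x. Suc j \<le> x \<and> R p"] by (cases "k = j") auto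
  next
    case 2
    then obtain c where c: "reach (map SF w) s c" "change k (k + 1) c u" by auto
    show ?case
      using Cons.IH(2)[OF 2(1) c(1)] c(2) by (fastforce simp: change_iff nth_list_update)
  }
qed auto

text \<open>Generators of index below \<open>k\<close> only exchange values that are at most
  \<open>k\<close>, hence neither touch nor create larger ones.\<close>

lemma reach_inert:
  assumes "reach w s u" "set w \<subseteq> letters k" "p < length s"
  shows "(k < u ! p \<longleftrightarrow> k < s ! p) \<and> (k < s ! p \<longrightarrow> u ! p = s ! p)"
  using assms(1,2)
proof (induction w arbitrary: u)
  case (Cons g w)
  then obtain c where c: "reach w s c" "letter_step g c u" by auto
  have len: "p < length c" using reach_length[OF c(1)] assms(3) by simp
  have "(k < u ! p \<longleftrightarrow> k < c ! p) \<and> (k < c ! p \<longrightarrow> u ! p = c ! p)"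
    using Cons.prems(2) c(2) len by (auto simp: letters_def change_iff nth_list_update split: if_splits)
  then show ?case using Cons.IH[OF c(1)] Cons.prems(2) by auto
qed simp

text \<open>A corner sum of \<open>A\<close>, cut off at index \<open>k\<close>. For
  \<open>i < j\<close> and \<open>k = n\<close> it will count the tensor factors that travel from
  index \<open>j\<close> or above to index \<open>i\<close> or below; \<open>lower_sum\<close>
  counts those travelling in the other direction.\<close>

definition upper_sum :: "nat \<Rightarrow> (nat \<Rightarrow> nat \<Rightarrow> nat) \<Rightarrow> nat \<Rightarrow> nat \<Rightarrow> nat"
  where "upper_sum k A i j = (\<Sum>q=j..k. \<Sum>i'=1..i. A i' q)"

definition lower_sum :: "nat \<Rightarrow> (nat \<Rightarrow> nat \<Rightarrow> nat) \<Rightarrow> nat \<Rightarrow> nat \<Rightarrow> nat"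
  where "lower_sum k A i j = (\<Sum>q=i..k. \<Sum>j'=1..j. A q j')"

lemma reach_xword_Suc:
  assumes "reach (xword (Suc k) A) s u"
  obtains s' u' where
    "reach (map SF (rev (seg 1 (Suc k) (\<lambda>j. \<Sum>j'=1..j. A (Suc k) j')))) s s'"
    "reach (xword k A) s' u'"
    "reach (map SE (seg 1 (Suc k) (\<lambda>i. \<Sum>i'=1..i. A i' (Suc k)))) u' u"
  using assms by (auto simp: reach_append)

text \<open>Only letters \<open>E_i\<close> increase the count, and stage \<open>q\<close> contains
  as many of them as the partial sum of column \<open>q\<close>. Stages below \<open>j\<close>
  contribute nothing: before their E-parts only \<open>F\<close> of outer stages and inner letters
  have acted, the former only raise values, and so a factor that began at \<open>j\<close> or above
  is still out of reach of the inner letters.\<close>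

lemma upper_bound:
  assumes "reach (xword k A) s u" "length s = length base" "\<And>p. p < length base \<Longrightarrow> base ! p \<le> s ! p"
    and "1 \<le> i" "i < j"
  shows "poscount (\<lambda>p x. x \<le> i \<and> j \<le> base ! p) u \<le> upper_sum k A i j"
  using assms(1-3)
proof (induction k arbitrary: s u)
  case 0
  have "poscount (\<lambda>p x. x \<le> i \<and> j \<le> base ! p) u = 0"
    using 0 assms(5) by (fastforce simp: poscount_def)
  then show ?case by simp
next
  case (Suc k)
  obtain s' u' where st:
    "reach (map SF (rev (seg 1 (Suc k) (\<lambda>j. \<Sum>j'=1..j. A (Suc k) j')))) s s'"
    "reach (xword k A) s' u'"
    "reach (map SE (seg 1 (Suc k) (\<lambda>i. \<Sum>i'=1..i. A i' (Suc k)))) u' u"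
    using reach_xword_Suc[OF Suc.prems(1)] by blast
  have len: "length s' = length base" using reach_length[OF st(1)] Suc.prems(2) by simp
  show ?case
  proof (cases "j \<le> Suc k")
    case True
    have "poscount (\<lambda>p x. x \<le> i \<and> j \<le> base ! p) u \<le> poscount (\<lambda>p x. x \<le> i \<and> j \<le> base ! p) u' +
      count_list (seg 1 (Suc k) (\<lambda>i. \<Sum>i'=1..i. A i' (Suc k))) i"
      using poscount_SE_le(1)[OF st(3), of i "\<lambda>p. j \<le> base ! p"] .
    also have "count_list (seg 1 (Suc k) (\<lambda>i. \<Sum>i'=1..i. A i' (Suc k))) i = (\<Sum>i'=1..i. A i' (Suc k))"
      using True assms(4,5) by (simp add: count_list_seg)
    also have "poscount (\<lambda>p x. x \<le> i \<and> j \<le> base ! p) u' \<le> upper_sum k A i j"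
    proof (rule Suc.IH[OF st(2) len])
      fix p assume "p < length base"
      then show "base ! p \<le> s' ! p"
        using Suc.prems(2) Suc.prems(3)[of p] poscount_SF_le(2)[OF st(1)] le_trans by metis
    qed
    finally show ?thesis using True by (simp add: upper_sum_def)
  next
    case False
    have "poscount (\<lambda>p x. x \<le> i \<and> j \<le> base ! p) u = 0"
    proof -
      have "\<not> (u ! p \<le> i \<and> j \<le> base ! p)" if "p < length u" for p
      proof
        assume a: "u ! p \<le> i \<and> j \<le> base ! p"
        have p: "p < length s" using that reach_length[OF Suc.prems(1)] by simp
        then have "Suc k < s ! p" using a False Suc.prems(2) Suc.prems(3)[of p] by simp
        then have "u ! p = s ! p" using reach_inert[OF Suc.prems(1) set_xword p] by simp
        then show False using a assms(5) Suc.prems(2) Suc.prems(3)[of p] p by simp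
      qed
      then show ?thesis by (simp add: poscount_def)
    qed
    then show ?thesis by simp
  qed
qed

text \<open>Unlike \<open>upper_bound\<close>, the estimate is relative to the starting list,
  because the F-part of a stage acts before the inner stages. A factor that began at
  \<open>j\<close> or below crosses the threshold only through a letter \<open>F_j\<close>. Asking
  for a final value of at least \<open>i\<close> stops the count at stage \<open>i\<close>, since
  the inner stages cannot produce such values.\<close>

lemma lower_bound:
  assumes "reach (xword k A) s u" and "1 \<le> j" "j < i" "i \<le> k"
  shows "poscount (\<lambda>p x. i \<le> x \<and> base ! p \<le> j) u \<le>
    poscount (\<lambda>p x. Suc j \<le> x \<and> base ! p \<le> j) s + lower_sum k A i j"
  using assms(1,4)
proof (induction k arbitrary: s u)
  case 0
  then show ?case using assms(2,3) by simp
next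
  case (Suc k)
  obtain s' u' where st:
    "reach (map SF (rev (seg 1 (Suc k) (\<lambda>j. \<Sum>j'=1..j. A (Suc k) j')))) s s'"
    "reach (xword k A) s' u'"
    "reach (map SE (seg 1 (Suc k) (\<lambda>i. \<Sum>i'=1..i. A i' (Suc k)))) u' u"
    using reach_xword_Suc[OF Suc.prems(1)] by blast
  let ?Q = "\<lambda>p x. i \<le> x \<and> base ! p \<le> j" and ?R = "\<lambda>p x. Suc j \<le> x \<and> base ! p \<le> j"
  have 1: "poscount ?Q u \<le> poscount ?Q u'" by (rule poscount_SE_le(2)[OF st(3)])
  have 2: "poscount ?R s' \<le> poscount ?R s + (\<Sum>j'=1..j. A (Suc k) j')"
    using poscount_SF_le(1)[OF st(1), of j "\<lambda>p. base ! p \<le> j"] assms(2,3) Suc.prems(2)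
    by (simp add: count_list_seg)
  show ?case
  proof (cases "i \<le> k")
    case True
    have "poscount ?Q u' \<le> poscount ?R s' + lower_sum k A i j" by (rule Suc.IH[OF st(2) True])
    then show ?thesis using 1 2 Suc.prems(2) by (simp add: lower_sum_def)
  next
    case False
    then have i: "i = Suc k" using Suc.prems(2) by simp
    have "{p. p < length u' \<and> ?Q p (u' ! p)} \<subseteq> {p. p < length s' \<and> ?R p (s' ! p)}"
      using reach_inert[OF st(2) set_xword] reach_length[OF st(2)] assms(3) i by fastforce
    then have "poscount ?Q u' \<le> poscount ?R s'" unfolding poscount_def by (intro card_mono) auto
    then show ?thesis using 1 2 i by (simp add: lower_sum_def)
  qed
qed

section \<open>The path of a monomial to an extremal list\<close>

lemma card_fibers:
  assumes "finite X" "finite J"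
  shows "card {p \<in> X. f p \<in> J} = (\<Sum>j\<in>J. card {p \<in> X. f p = j})"
proof -
  have "{p \<in> X. f p \<in> J} = (\<Union>j\<in>J. {p \<in> X. f p = j})" by auto
  then show ?thesis using assms by (simp only:) (rule card_UN_disjoint, auto)
qed

lemma reach_replicate:
  assumes "finite P" "P \<subseteq> {..<length s}" "\<And>p. p \<in> P \<Longrightarrow> s ! p = x" "length u = length s"
    and "\<And>p. p < length s \<Longrightarrow> u ! p = (if p \<in> P then y else s ! p)"
    and g: "letter_step g = change x y"
  shows "reach (replicate (card P) g) s u"
  using assms(1-5)
proof (induction P arbitrary: u)
  case empty
  then show ?case by (simp add: list_eq_iff_nth_eq)
next
  case (insert p P)
  have p: "p < length s" using insert.prems(1) by simp
  let ?c = "u[p := x]"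
  have "reach (replicate (card P) g) s ?c"
  proof (rule insert.IH)
    fix q assume "q < length s"
    then show "?c ! q = (if q \<in> P then y else s ! q)"
      using insert.hyps insert.prems by (auto simp: nth_list_update)
  qed (use insert.prems in auto)
  moreover have "change x y ?c u"
    unfolding change_iff using p insert.prems by (intro exI[of _ p]) (auto simp: list_eq_iff_nth_eq nth_list_update)
  ultimately show ?case using insert.hyps g by auto
qed

text \<open>The pair counts of \<open>u\<close> against \<open>base\<close> form the matrix
  \<open>A\<close> off the diagonal. At such a list all bounds for the word of \<open>A\<close> are
  attained.\<close>

locale target =
  fixes base u :: "nat list" and n :: nat and A :: "nat \<Rightarrow> nat \<Rightarrow> nat"
  assumes len: "length u = length base"
    and base: "set base \<subseteq> {1..n}" and u: "set u \<subseteq> {1..n}"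
    and fibers: "\<And>i j. \<lbrakk>i \<in> {1..n}; j \<in> {1..n}; i \<noteq> j\<rbrakk> \<Longrightarrow>
      card {p. p < length base \<and> u ! p = i \<and> base ! p = j} = A i j"
begin

abbreviation "D \<equiv> length base"

lemma nth_bounds: "p < D \<Longrightarrow> 1 \<le> base ! p \<and> base ! p \<le> n \<and> 1 \<le> u ! p \<and> u ! p \<le> n"
  using base u len by (metis atLeastAtMost_iff nth_mem subsetD)

lemma card_row:
  assumes "i \<in> {1..n}" "m < i"
  shows "card {p. p < D \<and> u ! p = i \<and> base ! p \<le> m} = (\<Sum>j=1..m. A i j)"
proof -
  have "{p. p < D \<and> u ! p = i \<and> base ! p \<le> m} = {p \<in> {p. p < D \<and> u ! p = i}. base ! p \<in> {1..m}}"
    using nth_bounds by auto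
  also have "card \<dots> = (\<Sum>j=1..m. card {p \<in> {p. p < D \<and> u ! p = i}. base ! p = j})"
    by (rule card_fibers) auto
  also have "\<dots> = (\<Sum>j=1..m. A i j)"
    using fibers[OF assms(1)] assms by (intro sum.cong) (auto simp: conj_assoc)
  finally show ?thesis .
qed

lemma card_col:
  assumes "j \<in> {1..n}" "m < j"
  shows "card {p. p < D \<and> base ! p = j \<and> u ! p \<le> m} = (\<Sum>i=1..m. A i j)"
proof -
  have "{p. p < D \<and> base ! p = j \<and> u ! p \<le> m} = {p \<in> {p. p < D \<and> base ! p = j}. u ! p \<in> {1..m}}"
    using nth_bounds by auto
  also have "card \<dots> = (\<Sum>i=1..m. card {p \<in> {p. p < D \<and> base ! p = j}. u ! p = i})"
    by (rule card_fibers) auto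
  also have "\<dots> = (\<Sum>i=1..m. A i j)"
  proof (intro sum.cong refl)
    fix i assume "i \<in> {1..m}"
    moreover have "{p \<in> {p. p < D \<and> base ! p = j}. u ! p = i} = {p. p < D \<and> u ! p = i \<and> base ! p = j}" by auto
    ultimately show "card {p \<in> {p. p < D \<and> base ! p = j}. u ! p = i} = A i j"
      using fibers[of i j] assms by simp
  qed
  finally show ?thesis .
qed

text \<open>The state before the raising stage \<open>k\<close>, respectively after the lowering stage \<open>k\<close>.\<close>

definition raised :: "nat \<Rightarrow> nat list"
  where "raised k = map (\<lambda>p. if k < u ! p \<and> base ! p < u ! p then u ! p else base ! p) [0..<D]"

definition lowered :: "nat \<Rightarrow> nat list"
  where "lowered k = map (\<lambda>p. if u ! p < base ! p \<and> base ! p \<le> k \<or> base ! p < u ! p then u ! p else base ! p) [0..<D]"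

lemma reach_raised:
  assumes k: "Suc k \<le> n"
  shows "reach (map SF (rev (seg 1 (Suc k) (\<lambda>j. \<Sum>j'=1..j. A (Suc k) j')))) (raised (Suc k)) (raised k)"
proof -
  \<comment> \<open>The state after the powers of \<open>F_1\<close> up to \<open>F_m\<close>: the
    factors destined for \<open>k + 1\<close> that began at \<open>m\<close> or below have all been
    collected at \<open>m + 1\<close>.\<close>
  define r where "r m = map (\<lambda>p. if u ! p = Suc k \<and> base ! p \<le> k then max (base ! p) (Suc m)
    else if Suc k < u ! p \<and> base ! p < u ! p then u ! p else base ! p) [0..<D]" for m
  have r0: "r 0 = raised (Suc k)" 
    unfolding r_def raised_def
  proof (intro map_cong refl)
    fix p assume "p \<in> set [0..<D]"
    then have "1 \<le> base ! p" using nth_bounds by simp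
    then show "(if u ! p = Suc k \<and> base ! p \<le> k then max (base ! p) (Suc 0)
      else if Suc k < u ! p \<and> base ! p < u ! p then u ! p else base ! p) =
      (if Suc k < u ! p \<and> base ! p < u ! p then u ! p else base ! p)" by (auto simp: max_def)
  qed
  have rk: "r k = raised k" unfolding r_def raised_def by (intro map_cong) (auto simp: max_def)
  have "reach (map SF (rev (seg 1 (Suc m) (\<lambda>j. \<Sum>j'=1..j. A (Suc k) j')))) (raised (Suc k)) (r m)"
    if "m \<le> k" for m
    using that
  proof (induction m)
    case 0
    then show ?case using r0 by simp
  next
    case (Suc m)
    let ?P = "{p. p < D \<and> u ! p = Suc k \<and> base ! p \<le> Suc m}"
    have "reach (replicate (card ?P) (SF (Suc m))) (r m) (r (Suc m))"
    proof (rule reach_replicate[where x = "Suc m" and y = "Suc (Suc m)"])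
      fix p assume "p \<in> ?P"
      then show "r m ! p = Suc m" using Suc.prems by (auto simp: r_def max_def)
    next
      fix p assume "p < length (r m)"
      then show "r (Suc m) ! p = (if p \<in> ?P then Suc (Suc m) else r m ! p)"
        using Suc.prems by (auto simp: r_def max_def)
    qed (auto simp: r_def)
    moreover have "card ?P = (\<Sum>j'=1..Suc m. A (Suc k) j')"
      by (rule card_row) (use Suc.prems k in auto)
    moreover have "seg 1 (Suc (Suc m)) f = seg 1 (Suc m) f @ replicate (f (Suc m)) (Suc m)" for f
      using seg_split[of 1 "Suc m" "Suc (Suc m)" f] seg_Cons[of "Suc m" "Suc (Suc m)" f] by simp
    ultimately show ?case using Suc by (auto simp: reach_append simp del: sum.cl_ivl_Suc)
  qed
  from this[of k] show ?thesis using rk by simp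
qed

lemma reach_lowered:
  assumes k: "Suc k \<le> n"
  shows "reach (map SE (seg 1 (Suc k) (\<lambda>i. \<Sum>i'=1..i. A i' (Suc k)))) (lowered k) (lowered (Suc k))"
proof -
  let ?b = "\<lambda>i. \<Sum>i'=1..i. A i' (Suc k)"
  \<comment> \<open>The mirror image: factors that began at \<open>k + 1\<close> have come down to
    \<open>m\<close>, or have stopped before at their destination.\<close>
  define e where "e m = map (\<lambda>p. if base ! p = Suc k \<and> u ! p \<le> k then max (u ! p) m
    else if u ! p < base ! p \<and> base ! p \<le> k \<or> base ! p < u ! p then u ! p else base ! p) [0..<D]" for m
  have e1: "e 1 = lowered (Suc k)" 
    unfolding e_def lowered_def
  proof (intro map_cong refl)
    fix p assume "p \<in> set [0..<D]"
    then have "1 \<le> u ! p" using nth_bounds by simp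
    then show "(if base ! p = Suc k \<and> u ! p \<le> k then max (u ! p) 1
      else if u ! p < base ! p \<and> base ! p \<le> k \<or> base ! p < u ! p then u ! p else base ! p) =
      (if u ! p < base ! p \<and> base ! p \<le> Suc k \<or> base ! p < u ! p then u ! p else base ! p)"
      by (auto simp: max_def)
  qed
  have ek: "e (Suc k) = lowered k" unfolding e_def lowered_def by (intro map_cong) (auto simp: max_def)
  have "reach (map SE (seg m (Suc k) ?b)) (lowered k) (e m)" if "m \<le> Suc k" "1 \<le> m" for m
    using that
  proof (induction m rule: inc_induct)
    case base
    then show ?case using ek by simp
  next
    case (step m)
    let ?P = "{p. p < D \<and> base ! p = Suc k \<and> u ! p \<le> m}"
    have "reach (replicate (card ?P) (SE m)) (e (Suc m)) (e m)"
    proof (rule reach_replicate[where x = "Suc m" and y = m])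
      fix p assume "p \<in> ?P"
      then show "e (Suc m) ! p = Suc m" using step by (auto simp: e_def max_def)
    next
      fix p assume "p < length (e (Suc m))"
      then show "e m ! p = (if p \<in> ?P then m else e (Suc m) ! p)"
        using step by (auto simp: e_def max_def)
    qed (auto simp: e_def)
    moreover have "card ?P = ?b m" by (rule card_col) (use step k in auto)
    moreover have "seg m (Suc k) f = replicate (f m) m @ seg (Suc m) (Suc k) f" for f
      using step seg_Cons[of m "Suc k" f] by simp
    ultimately show ?case using step by (auto simp: reach_append)
  qed
  from this[of 1] show ?thesis using e1 by simp
qed

text \<open>The F-parts run from stage \<open>n\<close> inwards and the E-parts back outwards. At
  the turning point every factor with a larger destination has arrived, and all others are still at
  their start.\<close>

lemma reach_target: "reach (xword n A) base u"
proof -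
  have "reach (xword k A) (raised k) (lowered k)" if "k \<le> n" for k
    using that
  proof (induction k)
    case 0
    have "raised 0 = lowered 0" unfolding raised_def lowered_def using nth_bounds by (intro map_cong) auto
    then show ?case by simp
  next
    case (Suc k)
    then show ?case using reach_raised[of k] reach_lowered[of k] by (auto simp: reach_append)
  qed
  moreover have "raised n = base"
  proof (rule nth_equalityI)
    fix p assume "p < length (raised n)"
    then show "raised n ! p = base ! p" using nth_bounds[of p] by (simp add: raised_def)
  qed (simp add: raised_def)
  moreover have "lowered n = u"
  proof (rule nth_equalityI)
    fix p assume "p < length (lowered n)"
    then show "lowered n ! p = u ! p" using nth_bounds[of p] by (simp add: lowered_def)
  qed (simp add: lowered_def len)
  ultimately show ?thesis by (metis order_refl)
qed

lemma poscount_upper: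
  assumes "1 \<le> i" "i < j" "j \<le> n"
  shows "poscount (\<lambda>p x. x \<le> i \<and> j \<le> base ! p) u = upper_sum n A i j"
proof -
  have "{p. p < length u \<and> u ! p \<le> i \<and> j \<le> base ! p} = {p \<in> {p. p < D \<and> u ! p \<le> i}. base ! p \<in> {j..n}}"
    using nth_bounds len by auto
  then have "poscount (\<lambda>p x. x \<le> i \<and> j \<le> base ! p) u = (\<Sum>q=j..n. card {p \<in> {p. p < D \<and> u ! p \<le> i}. base ! p = q})"
    unfolding poscount_def using card_fibers[of "{p. p < D \<and> u ! p \<le> i}" "{j..n}"] by simp
  also have "\<dots> = (\<Sum>q=j..n. \<Sum>i'=1..i. A i' q)"
  proof (intro sum.cong refl)
    fix q assume "q \<in> {j..n}"
    moreover have "{p \<in> {p. p < D \<and> u ! p \<le> i}. base ! p = q} = {p. p < D \<and> base ! p = q \<and> u ! p \<le> i}" by auto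
    ultimately show "card {p \<in> {p. p < D \<and> u ! p \<le> i}. base ! p = q} = (\<Sum>i'=1..i. A i' q)"
      using card_col[of q i] assms by simp
  qed
  finally show ?thesis by (simp add: upper_sum_def)
qed

lemma poscount_lower:
  assumes "1 \<le> j" "j < i" "i \<le> n"
  shows "poscount (\<lambda>p x. i \<le> x \<and> base ! p \<le> j) u = lower_sum n A i j"
proof -
  have "{p. p < length u \<and> i \<le> u ! p \<and> base ! p \<le> j} = {p \<in> {p. p < D \<and> base ! p \<le> j}. u ! p \<in> {i..n}}"
    using nth_bounds len by auto
  then have "poscount (\<lambda>p x. i \<le> x \<and> base ! p \<le> j) u = (\<Sum>q=i..n. card {p \<in> {p. p < D \<and> base ! p \<le> j}. u ! p = q})"
    unfolding poscount_def using card_fibers[of "{p. p < D \<and> base ! p \<le> j}" "{i..n}"] by simp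
  also have "\<dots> = (\<Sum>q=i..n. \<Sum>j'=1..j. A q j')"
  proof (intro sum.cong refl)
    fix q assume "q \<in> {i..n}"
    moreover have "{p \<in> {p. p < D \<and> base ! p \<le> j}. u ! p = q} = {p. p < D \<and> u ! p = q \<and> base ! p \<le> j}" by auto
    ultimately show "card {p \<in> {p. p < D \<and> base ! p \<le> j}. u ! p = q} = (\<Sum>j'=1..j. A q j')"
      using card_row[of q j] assms by simp
  qed
  finally show ?thesis by (simp add: lower_sum_def)
qed

end

section \<open>Triangularity and linear independence\<close>

lemma entry_upper_sum:
  assumes "1 \<le> i" "i < j" "j \<le> n"
  shows "int (A i j) = int (upper_sum n A i j) - int (upper_sum n A i (Suc j))
    - (if i = 1 then 0 else int (upper_sum n A (i - 1) j) - int (upper_sum n A (i - 1) (Suc j)))"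
proof -
  have c: "upper_sum n A k j = (\<Sum>i'=1..k. A i' j) + upper_sum n A k (Suc j)" for k
    unfolding upper_sum_def using assms by (simp add: sum.atLeast_Suc_atMost)
  have "(\<Sum>i'=1..i. A i' j) = A i j + (if i = 1 then 0 else \<Sum>i'=1..i - 1. A i' j)"
    using assms by (cases i) auto
  then show ?thesis using c[of i] c[of "i - 1"] by auto
qed

lemma entry_lower_sum:
  assumes "1 \<le> j" "j < i" "i \<le> n"
  shows "int (A i j) = int (lower_sum n A i j) - int (lower_sum n A (Suc i) j)
    - (if j = 1 then 0 else int (lower_sum n A i (j - 1)) - int (lower_sum n A (Suc i) (j - 1)))"
proof -
  have c: "lower_sum n A i k = (\<Sum>j'=1..k. A i j') + lower_sum n A (Suc i) k" for k
    unfolding lower_sum_def using assms by (simp add: sum.atLeast_Suc_atMost)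
  have "(\<Sum>j'=1..j. A i j') = A i j + (if j = 1 then 0 else \<Sum>j'=1..j - 1. A i j')"
    using assms by (cases j) auto
  then show ?thesis using c[of j] c[of "j - 1"] by auto
qed

text \<open>An off-diagonal entry is a mixed second difference of corner sums, and the corners
  involved stay strictly on the same side of the diagonal. The diagonals are zero by definition of
  \<open>col_mats\<close>.\<close>

lemma col_mats_eqI:
  assumes A: "A \<in> col_mats n \<mu>" and B: "B \<in> col_mats n \<mu>"
    and up: "\<And>i j. 1 \<le> i \<Longrightarrow> i < j \<Longrightarrow> j \<le> n \<Longrightarrow> upper_sum n A i j = upper_sum n B i j"
    and lo: "\<And>i j. 1 \<le> j \<Longrightarrow> j < i \<Longrightarrow> i \<le> n \<Longrightarrow> lower_sum n A i j = lower_sum n B i j"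
  shows "A = B"
proof (intro ext)
  fix i j
  \<comment> \<open>Second differences at the border involve the index \<open>n + 1\<close>, where
    the corner sums are empty.\<close>
  have up': "upper_sum n A i j = upper_sum n B i j" if "1 \<le> i" "i < j" for i j
    using up[OF that] by (cases "j \<le> n") (auto simp: upper_sum_def)
  have lo': "lower_sum n A i j = lower_sum n B i j" if "1 \<le> j" "j < i" for i j
    using lo[OF that] by (cases "i \<le> n") (auto simp: lower_sum_def)
  show "A i j = B i j"
  proof (cases "i \<in> {1..n} \<and> j \<in> {1..n} \<and> i \<noteq> j")
    case True
    then consider "i < j" | "j < i" by linarith
    then show ?thesis
    proof cases
      case 1
      then have "int (A i j) = int (B i j)"
        using True entry_upper_sum[of i j n A] entry_upper_sum[of i j n B] up'[of i j] up'[of i "Suc j"]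
          up'[of "i - 1" j] up'[of "i - 1" "Suc j"] by auto
      then show ?thesis by simp
    next
      case 2
      then have "int (A i j) = int (B i j)"
        using True entry_lower_sum[of j i n A] entry_lower_sum[of j i n B] lo'[of j i] lo'[of j "Suc i"]
          lo'[of "j - 1" i] lo'[of "j - 1" "Suc i"] by auto
      then show ?thesis by simp
    qed
  next
    case False
    then have "A i j = 0" "B i j = 0" using A B unfolding col_mats_def by blast+
    then show ?thesis by simp
  qed
qed

text \<open>\<open>j\<close> is the value for the elements that the prescribed fibers leave
  over.\<close>

lemma exists_fibers:
  fixes a :: "'i \<Rightarrow> nat"
  assumes "finite I" "finite P" "sum a I \<le> card P" "j \<notin> I"
  shows "\<exists>f. (\<forall>p. f p \<in> insert j I) \<and> (\<forall>i\<in>I. card {p \<in> P. f p = i} = a i)"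
  using assms
proof (induction I arbitrary: P)
  case empty
  then show ?case by auto
next
  case (insert i I)
  have "a i \<le> card P" using insert.prems insert.hyps by simp
  then obtain Q where Q: "Q \<subseteq> P" "card Q = a i" by (meson obtain_subset_with_card_n)
  have "sum a I \<le> card (P - Q)"
    using insert.prems insert.hyps Q by (simp add: card_Diff_subset finite_subset)
  then obtain f where f: "\<And>p. f p \<in> insert j I" "\<And>i. i \<in> I \<Longrightarrow> card {p \<in> P - Q. f p = i} = a i"
    using insert.IH[of "P - Q"] insert.prems by auto
  let ?f = "\<lambda>p. if p \<in> Q then i else f p"
  have "f p \<noteq> i" for p using f(1)[of p] insert.hyps insert.prems by auto
  then have "{p \<in> P. ?f p = i} = Q" using Q by auto
  moreover have "{p \<in> P. ?f p = i'} = {p \<in> P - Q. f p = i'}" if "i' \<in> I" for i'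
    using that insert.hyps by auto
  ultimately have "(\<forall>p. ?f p \<in> insert j (insert i I)) \<and> (\<forall>i'\<in>insert i I. card {p \<in> P. ?f p = i'} = a i')"
    using f Q by auto
  then show ?case by (rule exI[of _ ?f])
qed

text \<open>Among the positions of \<open>base\<close> with value \<open>j\<close>,
  \<open>A i j\<close> are sent to each other value \<open>i\<close> and the rest stay. The column
  bound in \<open>col_mats\<close> is what makes this possible.\<close>

lemma exists_target:
  assumes A: "A \<in> col_mats n (cnt base)" and base: "base \<in> tensor_basis n d"
  shows "\<exists>u \<in> tensor_basis n d. target base u n A"
proof -
  let ?P = "\<lambda>j. {p. p < length base \<and> base ! p = j}"
  have ex: "\<exists>f. (\<forall>p. f p \<in> insert j ({1..n} - {j})) \<and> (\<forall>i\<in>{1..n} - {j}. card {p \<in> ?P j. f p = i} = A i j)"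
    if "j \<in> {1..n}" for j
  proof (rule exists_fibers)
    have "A j j = 0" using A unfolding col_mats_def by blast
    then have "(\<Sum>i\<in>{1..n} - {j}. A i j) = (\<Sum>i=1..n. A i j)"
      using that by (simp add: sum_diff1_nat)
    also have "int \<dots> \<le> cnt base j" using A that unfolding col_mats_def by blast
    also have "\<dots> = int (card (?P j))"
      unfolding cnt_def by (simp add: count_list_eq_length_filter length_filter_conv_card eq_commute)
    finally show "(\<Sum>i\<in>{1..n} - {j}. A i j) \<le> card (?P j)" by (simp only: of_nat_le_iff)
  qed auto
  have "\<exists>f. \<forall>j\<in>{1..n}. (\<forall>p. f j p \<in> insert j ({1..n} - {j})) \<and>
      (\<forall>i\<in>{1..n} - {j}. card {p \<in> ?P j. f j p = i} = A i j)"
    by (rule bchoice) (rule ballI, rule ex)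
  then obtain f where f: "\<And>j p. j \<in> {1..n} \<Longrightarrow> f j p \<in> insert j ({1..n} - {j})"
    "\<And>i j. j \<in> {1..n} \<Longrightarrow> i \<in> {1..n} - {j} \<Longrightarrow> card {p \<in> ?P j. f j p = i} = A i j"
    by blast
  let ?u = "map (\<lambda>p. f (base ! p) p) [0..<length base]"
  have b: "base ! p \<in> {1..n}" if "p < length base" for p
    using base nth_mem[OF that] unfolding tensor_basis_def by blast
  have "f (base ! p) p \<in> {1..n}" if "p < length base" for p
    using f(1)[OF b[OF that], of p] b[OF that] by auto
  then have u: "set ?u \<subseteq> {1..n}" by auto
  have "target base ?u n A"
  proof
    fix i j assume ij: "i \<in> {1..n}" "j \<in> {1..n}" "i \<noteq> j"
    have "{p. p < length base \<and> ?u ! p = i \<and> base ! p = j} = {p \<in> ?P j. f j p = i}" by auto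
    then show "card {p. p < length base \<and> ?u ! p = i \<and> base ! p = j} = A i j" using f(2) ij by simp
  qed (use base u in \<open>auto simp: tensor_basis_def\<close>)
  moreover have "?u \<in> tensor_basis n d" using u base by (auto simp: tensor_basis_def)
  ultimately show ?thesis by blast
qed

text \<open>Strictly monotone for the entrywise order on corner sums, so maximizing this number
  selects a maximal matrix for that order.\<close>

definition mat_weight :: "nat \<Rightarrow> (nat \<Rightarrow> nat \<Rightarrow> nat) \<Rightarrow> nat"
  where "mat_weight n A = (\<Sum>(i, j)\<in>{(i, j). 1 \<le> i \<and> i < j \<and> j \<le> n}. upper_sum n A i j)
    + (\<Sum>(i, j)\<in>{(i, j). 1 \<le> j \<and> j < i \<and> i \<le> n}. lower_sum n A i j)"

text \<open>At a target of \<open>A\<close> the counts equal the corner sums of \<open>A\<close>,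
  while along the word of \<open>B\<close> they are bounded by those of \<open>B\<close>. The
  comparison of totals then forces equality everywhere.\<close>

lemma reach_dominance:
  assumes "target base u n A" "reach (xword n B) base u" "A \<in> col_mats n \<mu>" "B \<in> col_mats n \<mu>"
    and "mat_weight n B \<le> mat_weight n A"
  shows "A = B"
proof -
  interpret target base u n A by fact
  let ?U = "{(i, j). 1 \<le> i \<and> i < j \<and> j \<le> n}" and ?L = "{(i, j). 1 \<le> j \<and> j < i \<and> i \<le> n}"
  have fin: "finite ?U" "finite ?L"
    by (rule finite_subset[of _ "{..n} \<times> {..n}"]; auto)+
  have up: "upper_sum n A i j \<le> upper_sum n B i j" if "1 \<le> i" "i < j" "j \<le> n" for i j
    using upper_bound[OF assms(2) _ _ that(1,2), of base] poscount_upper[OF that] by simp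
  have lo: "lower_sum n A i j \<le> lower_sum n B i j" if "1 \<le> j" "j < i" "i \<le> n" for i j
  proof -
    have "poscount (\<lambda>p x. Suc j \<le> x \<and> base ! p \<le> j) base = 0" by (auto simp: poscount_def)
    then show ?thesis using lower_bound[OF assms(2) that, of base] poscount_lower[OF that] by simp
  qed
  have le: "(\<Sum>(i, j)\<in>?U. upper_sum n A i j) \<le> (\<Sum>(i, j)\<in>?U. upper_sum n B i j)"
    "(\<Sum>(i, j)\<in>?L. lower_sum n A i j) \<le> (\<Sum>(i, j)\<in>?L. lower_sum n B i j)"
    using up lo by (auto intro!: sum_mono)
  then have eq: "(\<Sum>(i, j)\<in>?U. upper_sum n A i j) = (\<Sum>(i, j)\<in>?U. upper_sum n B i j)"
    "(\<Sum>(i, j)\<in>?L. lower_sum n A i j) = (\<Sum>(i, j)\<in>?L. lower_sum n B i j)"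
    using assms(5) unfolding mat_weight_def by linarith+
  show ?thesis
  proof (rule col_mats_eqI[OF assms(3,4)])
    fix i j :: nat assume ij: "1 \<le> i" "i < j" "j \<le> n"
    show "upper_sum n A i j = upper_sum n B i j"
      using sum_mono_inv[OF eq(1) _ _ fin(1), of "(i, j)"] up ij by auto
  next
    fix i j :: nat assume ij: "1 \<le> j" "j < i" "i \<le> n"
    show "lower_sum n A i j = lower_sum n B i j"
      using sum_mono_inv[OF eq(2) _ _ fin(2), of "(i, j)"] lo ij by auto
  qed
qed

text \<open>Among the words with nonzero coefficient take one of largest \<open>mat_weight\<close>.
  In the matrix entry at its target every other such word vanishes by
  \<open>reach_dominance\<close>, while its own entry is positive.\<close>

theorem xword_independent:
  assumes base: "base \<in> tensor_basis n d" and fin: "finite (col_mats n (cnt base))"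
    and zero: "\<And>u. u \<in> tensor_basis n d \<Longrightarrow> (\<Sum>A\<in>col_mats n (cnt base).
      c A * word_prod (mat_alg (tensor_basis n d)) (schur_elem n d) (xword n A) u base) = 0"
    and A: "A \<in> col_mats n (cnt base)"
  shows "c A = 0"
proof (rule ccontr)
  assume "c A \<noteq> 0"
  let ?C = "{A \<in> col_mats n (cnt base). c A \<noteq> 0}"
  let ?M = "\<lambda>A. word_prod (mat_alg (tensor_basis n d)) (schur_elem n d) (xword n A)"
  have C: "finite ?C" "?C \<noteq> {}" using fin A \<open>c A \<noteq> 0\<close> by auto
  then have "Max (mat_weight n ` ?C) \<in> mat_weight n ` ?C" by (intro Max_in) auto
  then obtain Z where Z: "Z \<in> ?C" "mat_weight n Z = Max (mat_weight n ` ?C)" by auto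
  have max: "mat_weight n Y \<le> mat_weight n Z" if "Y \<in> ?C" for Y using C(1) that Z(2) by simp
  obtain u where u: "u \<in> tensor_basis n d" "target base u n Z"
    using exists_target[OF _ base] Z(1) by blast
  have others: "c Y * ?M Y u base = 0" if "Y \<in> col_mats n (cnt base)" "Y \<noteq> Z" for Y
  proof (cases "c Y = 0")
    case False
    then have "\<not> reach (xword n Y) base u"
      using reach_dominance[OF u(2) _ _ that(1)] Z(1) max[of Y] that by blast
    then have "?M Y u base = 0" using word_entry[OF set_xword base u(1), of Y] by force
    then show ?thesis by simp
  qed simp
  have "?M Z u base > 0"
    using word_entry[OF set_xword base u(1), of Z] target.reach_target[OF u(2)] by simp
  moreover have "c Z * ?M Z u base = 0"
    using zero[OF u(1)] sum.remove[OF fin, of Z "\<lambda>A. c A * ?M A u base"] others Z(1)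
    by (simp add: sum.neutral)
  ultimately show False using Z(1) by simp
qed

section \<open>The presentation\<close>

lemma finite_col_mats:
  assumes \<mu>: "\<mu> \<in> weights n d"
  shows "finite (col_mats n \<mu>)"
proof (rule finite_subset)
  let ?R = "{f. \<forall>j. (j \<in> {1..n} \<longrightarrow> f j \<in> {..d}) \<and> (j \<notin> {1..n} \<longrightarrow> f j = (0::nat))}"
  let ?M = "{A. \<forall>i. (i \<in> {1..n} \<longrightarrow> A i \<in> ?R) \<and> (i \<notin> {1..n} \<longrightarrow> A i = (\<lambda>_. 0))}"
  have "finite ?R" by (rule finite_set_of_finite_funs) auto
  then show "finite ?M" by (intro finite_set_of_finite_funs) auto
  show "col_mats n \<mu> \<subseteq> ?M"
  proof
    fix A assume A: "A \<in> col_mats n \<mu>"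
    then have z: "A i j = 0" if "i \<notin> {1..n} \<or> j \<notin> {1..n}" for i j using that unfolding col_mats_def by blast
    have "A i j \<le> d" if "i \<in> {1..n}" "j \<in> {1..n}" for i j
    proof -
      have "A i j \<le> (\<Sum>i=1..n. A i j)" using that by (intro member_le_sum) auto
      moreover have "int (\<Sum>i=1..n. A i j) \<le> \<mu> j" using A that unfolding col_mats_def by blast
      moreover have "\<mu> j \<le> (\<Sum>j=1..n. \<mu> j)" using that \<mu> by (intro member_le_sum) (auto simp: weights_def)
      moreover have "(\<Sum>j=1..n. \<mu> j) = int d" using \<mu> by (simp add: weights_def)
      ultimately show ?thesis by linarith
    qed
    then show "A \<in> ?M" using z by auto
  qed
qed

lemma exists_base:
  assumes \<mu>: "\<mu> \<in> weights n d"
  shows "\<exists>base \<in> tensor_basis n d. cnt base = \<mu>"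
proof
  let ?b = "seg 1 (Suc n) (\<lambda>i. nat (\<mu> i))"
  show c: "cnt ?b = \<mu>"
  proof
    fix i
    have "\<mu> i \<ge> 0" "i \<notin> {1..n} \<Longrightarrow> \<mu> i = 0" using \<mu> unfolding weights_def by blast+
    then show "cnt ?b i = \<mu> i" by (auto simp: cnt_def count_list_seg)
  qed
  have set: "set ?b \<subseteq> {1..n}" using set_seg[of 1 "Suc n"] by (simp add: atLeastLessThanSuc_atLeastAtMost)
  then have "?b \<in> tensor_basis n (length ?b)" by (simp add: tensor_basis_def)
  then have "\<mu> \<in> weights n (length ?b)" using cnt_in_weights c by metis
  then have "length ?b = d" using \<mu> by (simp add: weights_def)
  then show "?b \<in> tensor_basis n d" using set by (simp add: tensor_basis_def)
qed

section \<open>Sums and spans of functions on words\<close>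

lemma sum_apply: "(\<Sum>x\<in>W. f x) u = (\<Sum>x\<in>W. f x u)" for f :: "'i \<Rightarrow> 'a \<Rightarrow> 'b::comm_monoid_add"
  by (induction W rule: infinite_finite_induct) auto

lemma conv_sum:
  "conv (\<lambda>w. \<Sum>i\<in>I. q i * f i w) p = (\<lambda>w. \<Sum>i\<in>I. q i * conv (f i) p w)"
  "conv p (\<lambda>w. \<Sum>i\<in>I. q i * f i w) = (\<lambda>w. \<Sum>i\<in>I. q i * conv p (f i) w)"
proof -
  show "conv (\<lambda>w. \<Sum>i\<in>I. q i * f i w) p = (\<lambda>w. \<Sum>i\<in>I. q i * conv (f i) p w)"
  proof
    fix w
    have "conv (\<lambda>w. \<Sum>i\<in>I. q i * f i w) p w =
      (\<Sum>k\<le>length w. \<Sum>i\<in>I. q i * (f i (take k w) * p (drop k w)))"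
      by (simp add: conv_def sum_distrib_right mult.assoc)
    also have "\<dots> = (\<Sum>i\<in>I. \<Sum>k\<le>length w. q i * (f i (take k w) * p (drop k w)))" by (rule sum.swap)
    also have "\<dots> = (\<Sum>i\<in>I. q i * conv (f i) p w)" by (simp add: conv_def sum_distrib_left)
    finally show "conv (\<lambda>w. \<Sum>i\<in>I. q i * f i w) p w = (\<Sum>i\<in>I. q i * conv (f i) p w)" .
  qed
  show "conv p (\<lambda>w. \<Sum>i\<in>I. q i * f i w) = (\<lambda>w. \<Sum>i\<in>I. q i * conv p (f i) w)"
  proof
    fix w
    have "conv p (\<lambda>w. \<Sum>i\<in>I. q i * f i w) w =
      (\<Sum>k\<le>length w. \<Sum>i\<in>I. q i * (p (take k w) * f i (drop k w)))"
      by (simp add: conv_def sum_distrib_left mult.left_commute)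
    also have "\<dots> = (\<Sum>i\<in>I. \<Sum>k\<le>length w. q i * (p (take k w) * f i (drop k w)))" by (rule sum.swap)
    also have "\<dots> = (\<Sum>i\<in>I. q i * conv p (f i) w)" by (simp add: conv_def sum_distrib_left)
    finally show "conv p (\<lambda>w. \<Sum>i\<in>I. q i * f i w) w = (\<Sum>i\<in>I. q i * conv p (f i) w)" .
  qed
qed

interpretation fun_space: vector_space "\<lambda>c (p :: 'a \<Rightarrow> 'k::field) w. c * p w"
  by unfold_locales (auto simp: fun_eq_iff algebra_simps)

text \<open>Coefficients are indexed by \<open>I\<close> and not by vectors, because
  \<open>g\<close> may fail to be injective.\<close>

lemma span_image_sum:
  fixes g :: "'i \<Rightarrow> 'a \<Rightarrow> 'k::field"
  assumes J: "fun_space.subspace J" and I: "finite I" and x: "x \<in> fun_space.span (J \<union> g ` I)"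
  shows "\<exists>j\<in>J. \<exists>c. x = j + (\<lambda>w. \<Sum>i\<in>I. c i * g i w)"
proof -
  let ?X = "{j + (\<lambda>w. \<Sum>i\<in>I. c i * g i w) |j c. j \<in> J}"
  have "fun_space.span (J \<union> g ` I) \<subseteq> ?X"
  proof (rule fun_space.span_minimal)
    show "J \<union> g ` I \<subseteq> ?X"
    proof
      fix y assume "y \<in> J \<union> g ` I"
      then show "y \<in> ?X"
      proof
        assume "y \<in> J"
        then show ?thesis by (intro CollectI exI[of _ y] exI[of _ "\<lambda>_. 0"]) (auto simp: fun_eq_iff)
      next
        assume "y \<in> g ` I"
        then obtain i where i: "i \<in> I" "y = g i" by blast
        have "(\<Sum>k\<in>I. of_bool (k = i) * g k w) = (\<Sum>k\<in>I. if k = i then g i w else 0)" for w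
          by (intro sum.cong) auto
        then have "y = 0 + (\<lambda>w. \<Sum>k\<in>I. of_bool (k = i) * g k w)"
          using I i by (auto simp: fun_eq_iff)
        then show ?thesis using fun_space.subspace_0[OF J]
          by (intro CollectI exI[of _ 0] exI[of _ "\<lambda>k. of_bool (k = i)"] conjI)
      qed
    qed
    show "fun_space.subspace ?X"
    proof (rule fun_space.subspaceI)
      have "(0 :: 'a \<Rightarrow> 'k) = 0 + (\<lambda>w. \<Sum>i\<in>I. 0 * g i w)" by (auto simp: fun_eq_iff)
      then show "0 \<in> ?X" using fun_space.subspace_0[OF J] by (intro CollectI exI[of _ 0] exI[of _ "\<lambda>_. 0"]) auto
    next
      fix y z assume "y \<in> ?X" "z \<in> ?X"
      then obtain j c j' c' where y: "y = j + (\<lambda>w. \<Sum>i\<in>I. c i * g i w)" "j \<in> J"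
        and z: "z = j' + (\<lambda>w. \<Sum>i\<in>I. c' i * g i w)" "j' \<in> J" by blast
      have "y + z = (j + j') + (\<lambda>w. \<Sum>i\<in>I. (c i + c' i) * g i w)"
        unfolding y z by (auto simp: fun_eq_iff algebra_simps sum.distrib)
      moreover have "j + j' \<in> J" using fun_space.subspace_add[OF J] y z by blast
      ultimately show "y + z \<in> ?X" by (intro CollectI exI[of _ "j + j'"] exI[of _ "\<lambda>i. c i + c' i"]) auto
    next
      fix a y assume "y \<in> ?X"
      then obtain j c where y: "y = j + (\<lambda>w. \<Sum>i\<in>I. c i * g i w)" "j \<in> J" by blast
      have "(\<lambda>w. a * y w) = (\<lambda>w. a * j w) + (\<lambda>w. \<Sum>i\<in>I. (a * c i) * g i w)"
        unfolding y by (auto simp: fun_eq_iff algebra_simps sum_distrib_left)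
      moreover have "(\<lambda>w. a * j w) \<in> J" using fun_space.subspace_scale[OF J] y by blast
      ultimately show "(\<lambda>w. a * y w) \<in> ?X" by (intro CollectI exI[of _ "\<lambda>w. a * j w"] exI[of _ "\<lambda>i. a * c i"]) auto
    qed
  qed
  then show ?thesis using x by blast
qed

context
  fixes n d :: nat
begin

private abbreviation (input) "S \<equiv> S_gens n d"
private abbreviation (input) "J \<equiv> rel_ideal S (S_rels n d)"
private abbreviation (input) "F \<equiv> free_alg S :: (Qv, sgen list \<Rightarrow> Qv) module"

interpretation P: matrix_presentation "tensor_basis n d" "schur_elem n d" S "S_rels n d"
  by (rule S_presentation)

section \<open>Calculus modulo the ideal of relations\<close>

lemma J_add: "p \<in> J \<Longrightarrow> q \<in> J \<Longrightarrow> p + q \<in> J"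
  using additive_subgroup.a_closed[OF ideal.axioms(1)[OF P.ideal_rel_ideal]] by simp

lemma J_conv: "p \<in> J \<Longrightarrow> q \<in> carrier F \<Longrightarrow> conv q p \<in> J" "p \<in> J \<Longrightarrow> q \<in> carrier F \<Longrightarrow> conv p q \<in> J"
  using ideal.I_l_closed[OF P.ideal_rel_ideal] ideal.I_r_closed[OF P.ideal_rel_ideal] by simp_all

lemma J_subspace: "fun_space.subspace J"
proof (rule fun_space.subspaceI)
  show "0 \<in> J" using additive_subgroup.zero_closed[OF ideal.axioms(1)[OF P.ideal_rel_ideal]] by simp
  show "(\<lambda>w. c * p w) \<in> J" if "p \<in> J" for c p
    using J_conv(1)[OF that free_scale_closed[OF basis_word_closed, of "[]" S c]] by (simp add: conv_scale)
qed (rule J_add)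

lemma J_zero: "0 \<in> J" by (rule fun_space.subspace_0[OF J_subspace])
lemma J_diff: "p \<in> J \<Longrightarrow> q \<in> J \<Longrightarrow> p - q \<in> J" by (rule fun_space.subspace_diff[OF J_subspace])
lemma J_scale: "p \<in> J \<Longrightarrow> (\<lambda>w. c * p w) \<in> J" by (rule fun_space.subspace_scale[OF J_subspace])

lemma J_trans: "p - q \<in> J \<Longrightarrow> q - r \<in> J \<Longrightarrow> p - r \<in> J"
  using J_add[of "p - q" "q - r"] by simp

lemma J_trans0: "p - q \<in> J \<Longrightarrow> q \<in> J \<Longrightarrow> p \<in> J"
  using J_add[of "p - q" q] by simp

lemma J_ctx:
  assumes "p \<in> J" "set a \<subseteq> S" "set b \<subseteq> S"
  shows "conv (basis_word a) (conv p (basis_word b)) \<in> J"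
  by (intro J_conv assms basis_word_closed)

lemma J_word_ctx:
  assumes "basis_word u - basis_word w \<in> J" "set a \<subseteq> S" "set b \<subseteq> S"
  shows "basis_word (a @ u @ b) - basis_word (a @ w @ b) \<in> J"
  using J_ctx[OF assms] by (simp add: conv_minus conv_basis_word)

lemma J_word_ctx0:
  assumes "basis_word u \<in> J" "set a \<subseteq> S" "set b \<subseteq> S"
  shows "basis_word (a @ u @ b) \<in> J"
  using J_ctx[OF assms] by (simp add: conv_basis_word)

lemma J_idem:
  assumes "\<mu> \<in> weights n d" "\<nu> \<in> weights n d"
  shows "basis_word [SI \<mu>, SI \<nu>] - (if \<mu> = \<nu> then basis_word [SI \<mu>] else 0) \<in> J"
  by (rule P.rel_in_ideal) (use assms in \<open>unfold S_rels_eq, blast\<close>)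

lemma J_shift:
  assumes "g \<in> letters n" "\<mu> \<in> weights n d"
  shows "basis_word [g, SI \<mu>] - (if \<mu> + letter_weight g \<in> weights n d
    then basis_word [SI (\<mu> + letter_weight g), g] else 0) \<in> J"
proof -
  consider i where "g = SE i" "i \<in> {1..<n}" | i where "g = SF i" "i \<in> {1..<n}"
    using assms(1) by (auto simp: letters_def)
  then show ?thesis
  proof cases
    case 1
    have "(basis_word [SE i, SI \<mu>], if \<mu> + root i \<in> weights n d
      then basis_word [SI (\<mu> + root i), SE i] else 0) \<in> S_rels n d"
      unfolding S_rels_eq using 1 assms(2) by blast
    then show ?thesis unfolding 1 letter_weight.simps by (rule P.rel_in_ideal)
  next
    case 2
    have "(basis_word [SF i, SI \<mu>], if \<mu> - root i \<in> weights n d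
      then basis_word [SI (\<mu> - root i), SF i] else 0) \<in> S_rels n d"
      unfolding S_rels_eq using 2 assms(2) by blast
    moreover have "\<mu> + - root i = \<mu> - root i" by simp
    ultimately show ?thesis unfolding 2 letter_weight.simps by (metis P.rel_in_ideal)
  qed
qed

lemma letters_S: "letters n \<subseteq> S"
  by (auto simp: letters_def S_gens_def)

lemma word_weight:
  assumes \<mu>: "\<mu> \<in> weights n d" and w: "set w \<subseteq> letters n"
  shows "(\<mu> + weight w \<notin> weights n d \<longrightarrow> basis_word (w @ [SI \<mu>]) \<in> J) \<and>
    (\<mu> + weight w \<in> weights n d \<longrightarrow>
      basis_word (w @ [SI \<mu>]) - basis_word (SI (\<mu> + weight w) # w @ [SI \<mu>]) \<in> J)"
  using w
proof (induction w)
  case Nil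
  have "basis_word [SI \<mu>] - basis_word [SI \<mu>, SI \<mu>] \<in> J"
    using fun_space.subspace_neg[OF J_subspace J_idem[OF \<mu> \<mu>]] by (simp only: if_True refl minus_diff_eq)
  moreover have "\<mu> + weight [] = \<mu>" by (simp add: weight_Nil)
  ultimately show ?case using \<mu> by (simp only: append_Nil simp_thms)
next
  case (Cons g w)
  let ?\<nu> = "\<mu> + weight w"
  have g: "g \<in> letters n" "g \<in> S" and w: "set w \<subseteq> letters n" using Cons.prems letters_S by auto
  have b: "set (w @ [SI \<mu>]) \<subseteq> S" using w letters_S \<mu> by (auto simp: S_gens_def)
  have wt: "\<mu> + weight (g # w) = ?\<nu> + letter_weight g"
    by (auto simp: weight_def fun_eq_iff)
  show ?case
  proof (cases "?\<nu> \<in> weights n d")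
    \<comment> \<open>Once the weight has left \<open>weights n d\<close> the word lies in
      \<open>J\<close>, even if the next letter leads back to an admissible weight; both parts of
      the claim then hold.\<close>
    case False
    then have 1: "basis_word (w @ [SI \<mu>]) \<in> J" using Cons.IH w by blast
    have "basis_word (g # w @ [SI \<mu>]) \<in> J" using J_word_ctx0[OF 1, of "[g]" "[]"] g by simp
    moreover have "basis_word (SI \<kappa> # g # w @ [SI \<mu>]) \<in> J" if "\<kappa> \<in> weights n d" for \<kappa>
      using J_word_ctx0[OF 1, of "[SI \<kappa>, g]" "[]"] g that by (simp add: S_gens_def)
    ultimately show ?thesis unfolding append_Cons using J_diff by blast
  next
    case True
    then have "basis_word (w @ [SI \<mu>]) - basis_word (SI ?\<nu> # w @ [SI \<mu>]) \<in> J" using Cons.IH w by blast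
    then have 1: "basis_word (g # w @ [SI \<mu>]) - basis_word (g # SI ?\<nu> # w @ [SI \<mu>]) \<in> J"
      using J_word_ctx[of _ _ "[g]" "[]"] g by simp
    show ?thesis
    proof (cases "?\<nu> + letter_weight g \<in> weights n d")
      case in_w: True
      then have "basis_word [g, SI ?\<nu>] - basis_word [SI (?\<nu> + letter_weight g), g] \<in> J"
        using J_shift[OF g(1) True] by simp
      from J_word_ctx[OF this, of "[]" "w @ [SI \<mu>]"]
      have "basis_word (g # SI ?\<nu> # w @ [SI \<mu>]) - basis_word (SI (?\<nu> + letter_weight g) # g # w @ [SI \<mu>]) \<in> J"
        using b by simp
      then show ?thesis unfolding wt append_Cons using in_w J_trans[OF 1] by blast
    next
      case out: False
      then have "basis_word [g, SI ?\<nu>] \<in> J" using J_shift[OF g(1) True] by simp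
      from J_word_ctx0[OF this, of "[]" "w @ [SI \<mu>]"]
      have "basis_word (g # SI ?\<nu> # w @ [SI \<mu>]) \<in> J" using b by simp
      then show ?thesis unfolding wt append_Cons using out J_trans0[OF 1] by blast
    qed
  qed
qed

lemma word_idem:
  assumes \<mu>: "\<mu> \<in> weights n d" and \<nu>: "\<nu> \<in> weights n d" and w: "set w \<subseteq> letters n"
  shows "basis_word (SI \<nu> # w @ [SI \<mu>]) - (if \<nu> = \<mu> + weight w then basis_word (w @ [SI \<mu>]) else 0) \<in> J"
proof (cases "\<mu> + weight w \<in> weights n d")
  case False
  then have "basis_word (w @ [SI \<mu>]) \<in> J" using word_weight[OF \<mu> w] by blast
  from J_word_ctx0[OF this, of "[SI \<nu>]" "[]"] show ?thesis
    using False \<nu> by (auto simp: S_gens_def)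
next
  case True
  let ?\<kappa> = "\<mu> + weight w"
  have b: "set (w @ [SI \<mu>]) \<subseteq> S" using w letters_S \<mu> by (auto simp: S_gens_def)
  have 1: "basis_word (w @ [SI \<mu>]) - basis_word (SI ?\<kappa> # w @ [SI \<mu>]) \<in> J"
    using word_weight[OF \<mu> w] True by blast
  have 2: "basis_word (SI \<nu> # w @ [SI \<mu>]) - basis_word (SI \<nu> # SI ?\<kappa> # w @ [SI \<mu>]) \<in> J"
    using J_word_ctx[OF 1, of "[SI \<nu>]" "[]"] \<nu> by (simp add: S_gens_def)
  show ?thesis
  proof (cases "\<nu> = ?\<kappa>")
    case True
    then show ?thesis
      using fun_space.subspace_neg[OF J_subspace 1] by simp
  next
    case False
    then have "basis_word [SI \<nu>, SI ?\<kappa>] \<in> J" using J_idem[OF \<nu> True] by simp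
    from J_word_ctx0[OF this, of "[]" "w @ [SI \<mu>]"]
    have "basis_word (SI \<nu> # SI ?\<kappa> # w @ [SI \<mu>]) \<in> J" using b by simp
    then show ?thesis using False J_trans0[OF 2] by simp
  qed
qed

text \<open>Zero on words in other letters, so that the contexts in \<open>schur_words\<close> need no restriction.\<close>

definition word_vec :: "(nat \<Rightarrow> int) \<Rightarrow> sgen list \<Rightarrow> sgen list \<Rightarrow> Qv"
  where "word_vec \<mu> w = (if set w \<subseteq> letters n then basis_word (w @ [SI \<mu>]) else 0)"

lemma serre_words_J:
  assumes \<mu>: "\<mu> \<in> weights n d" and x: "x ` {1..<n} \<subseteq> letters n"
    and rel: "\<And>l r. (l, r) \<in> serre_rels F n (free_gen \<circ> x) \<Longrightarrow> l - r \<in> J"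
  shows "serre_words (\<lambda>c p w. c * p w) J (word_vec \<mu>) x n (v + inverse v)"
proof
  show "fun_space.subspace J" by (rule J_subspace)
  \<comment> \<open>The bound required of \<open>t\<close> amounts to a square being
    nonnegative.\<close>
  have "(v - 1) * (v - 1) \<ge> 0" by simp
  then have "v * v + 1 \<ge> 2 * v" by (simp add: algebra_simps)
  then have "(v * v + 1) / v \<ge> 2" using v_pos by (simp add: field_simps)
  then show "2 \<le> v + inverse v" using v_pos by (simp add: field_simps)
next
  fix i j a b assume ij: "i \<in> {1..<n}" "j \<in> {1..<n}"
  have xS: "x ` {1..<n} \<subseteq> S" using x letters_S by blast
  have xij: "x i \<in> letters n" "x j \<in> letters n" using x ij by blast+
  have wv: "word_vec \<mu> (a @ w @ b) = (if set a \<subseteq> letters n \<and> set b \<subseteq> letters n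
    then basis_word (a @ w @ b @ [SI \<mu>]) else 0)" if "set w \<subseteq> {x i, x j}" for w
    using that xij by (auto simp: word_vec_def)
  have bS: "set (b @ [SI \<mu>]) \<subseteq> S" if "set b \<subseteq> letters n" using that letters_S \<mu> by (auto simp: S_gens_def)
  have aS: "set a \<subseteq> S" if "set a \<subseteq> letters n" using that letters_S by blast
  show "word_vec \<mu> (a @ [x i, x i, x j] @ b) - (\<lambda>w. (v + inverse v) * word_vec \<mu> (a @ [x i, x j, x i] @ b) w) +
      word_vec \<mu> (a @ [x j, x i, x i] @ b) \<in> J" if adj: "\<bar>int i - int j\<bar> = 1"
  proof (cases "set a \<subseteq> letters n \<and> set b \<subseteq> letters n")
    case True
    have "(basis_word [x i, x i, x j] - (\<lambda>w. (v + inverse v) * basis_word [x i, x j, x i] w) + basis_word [x j, x i, x i], 0)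
      \<in> serre_rels F n (free_gen \<circ> x)"
      unfolding serre_rels_free[OF xS] using ij adj by blast
    from J_ctx[OF rel[OF this], of a "b @ [SI \<mu>]"] True aS bS
    have "basis_word (a @ [x i, x i, x j] @ b @ [SI \<mu>]) -
        (\<lambda>w. (v + inverse v) * basis_word (a @ [x i, x j, x i] @ b @ [SI \<mu>]) w) +
        basis_word (a @ [x j, x i, x i] @ b @ [SI \<mu>]) \<in> J"
      by (simp only: diff_zero conv_minus conv_distrib conv_scale conv_basis_word append_assoc)
    moreover have "word_vec \<mu> (a @ w @ b) = basis_word (a @ w @ b @ [SI \<mu>])" if "set w \<subseteq> {x i, x j}" for w
      using wv[OF that] True by simp
    ultimately show ?thesis by (simp only: list.set insert_subset insertI1 insert_iff empty_subsetI simp_thms)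
  next
    case False
    then have z: "word_vec \<mu> (a @ [x i, x i, x j] @ b) = 0" "word_vec \<mu> (a @ [x i, x j, x i] @ b) = 0"
      "word_vec \<mu> (a @ [x j, x i, x i] @ b) = 0"
      using wv[of "[x i, x i, x j]"] wv[of "[x i, x j, x i]"] wv[of "[x j, x i, x i]"] by auto
    have "(\<lambda>w. (v + inverse v) * (0 :: sgen list \<Rightarrow> Qv) w) = 0" by (simp add: fun_eq_iff)
    then show ?thesis unfolding z using J_zero by (simp only: diff_zero add_0_left)
  qed
  show "word_vec \<mu> (a @ [x i, x j] @ b) - word_vec \<mu> (a @ [x j, x i] @ b) \<in> J" if nadj: "\<bar>int i - int j\<bar> \<noteq> 1"
  proof (cases "set a \<subseteq> letters n \<and> set b \<subseteq> letters n")
    case True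
    have "(basis_word [x i, x j] - basis_word [x j, x i], 0) \<in> serre_rels F n (free_gen \<circ> x)"
      unfolding serre_rels_free[OF xS] using ij nadj by blast
    from J_ctx[OF rel[OF this], of a "b @ [SI \<mu>]"] True aS bS
    have "basis_word (a @ [x i, x j] @ b @ [SI \<mu>]) - basis_word (a @ [x j, x i] @ b @ [SI \<mu>]) \<in> J"
      by (simp only: diff_zero conv_minus conv_basis_word append_assoc)
    moreover have "word_vec \<mu> (a @ w @ b) = basis_word (a @ w @ b @ [SI \<mu>])" if "set w \<subseteq> {x i, x j}" for w
      using wv[OF that] True by simp
    ultimately show ?thesis by (simp only: list.set insert_subset insertI1 insert_iff empty_subsetI simp_thms)
  next
    case False
    then have z: "word_vec \<mu> (a @ [x i, x j] @ b) = 0" "word_vec \<mu> (a @ [x j, x i] @ b) = 0"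
      using wv[of "[x i, x j]"] wv[of "[x j, x i]"] by auto
    show ?thesis unfolding z diff_zero by (rule J_zero)
  qed
qed

text \<open>The relation puts a combination of idempotents between \<open>a\<close> and
  \<open>b\<close>. Against \<open>b\<close> and the idempotent of weight \<mu> on the right, only
  the idempotent of weight \<open>\<mu> + weight b\<close> survives, so a single scalar
  remains.\<close>

lemma commutator_J:
  assumes \<mu>: "\<mu> \<in> weights n d" and i: "i \<in> {1..<n}" and j: "j \<in> {1..<n}"
  shows "\<exists>c. word_vec \<mu> (a @ [SE i, SF j] @ b) - word_vec \<mu> (a @ [SF j, SE i] @ b)
    - (\<lambda>w. c * word_vec \<mu> (a @ b) w) \<in> J"
proof (cases "set a \<subseteq> letters n \<and> set b \<subseteq> letters n")
  case False
  then have z: "word_vec \<mu> (a @ w @ b) = 0" "word_vec \<mu> (a @ b) = 0" for w by (auto simp: word_vec_def)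
  show ?thesis
    unfolding z by (intro exI[of _ 0]) (use J_zero in \<open>simp add: zero_fun_def[symmetric]\<close>)
next
  case True
  have mem: "SE i \<in> letters n" "SF j \<in> letters n" using i j by (auto simp: letters_def)
  have bS: "set (b @ [SI \<mu>]) \<subseteq> S" using True letters_S \<mu> by (auto simp: S_gens_def)
  have aS: "set a \<subseteq> S" using True letters_S by blast
  define q where "q \<nu> = (if i = j then qint (\<nu> j - \<nu> (j + 1)) else 0)" for \<nu>
  \<comment> \<open>No idempotent survives when the weight reached by \<open>b\<close> is not
    admissible; the scalar is then zero.\<close>
  let ?c = "if \<mu> + weight b \<in> weights n d then q (\<mu> + weight b) else 0"
  let ?w = "\<lambda>x. basis_word (a @ x @ b @ [SI \<mu>]) :: _ \<Rightarrow> Qv"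
  let ?s = "\<lambda>w. \<Sum>\<nu>\<in>weights n d. q \<nu> * basis_word [SI \<nu>] w"
  have rel: "basis_word [SE i, SF j] - basis_word [SF j, SE i] - ?s \<in> J"
  proof -
    have "(basis_word [SE i, SF j] - basis_word [SF j, SE i],
      if i = j then (\<lambda>w. \<Sum>\<nu>\<in>weights n d. qint (\<nu> j - \<nu> (j + 1)) * basis_word [SI \<nu>] w) else 0) \<in> S_rels n d"
      unfolding S_rels_eq using i j by blast
    then have "basis_word [SE i, SF j] - basis_word [SF j, SE i] -
      (if i = j then (\<lambda>w. \<Sum>\<nu>\<in>weights n d. qint (\<nu> j - \<nu> (j + 1)) * basis_word [SI \<nu>] w) else 0) \<in> J"
      by (rule P.rel_in_ideal)
    also have "(if i = j then (\<lambda>w. \<Sum>\<nu>\<in>weights n d. qint (\<nu> j - \<nu> (j + 1)) * basis_word [SI \<nu>] w) else 0) = ?s"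
      by (auto simp: q_def fun_eq_iff)
    finally show ?thesis .
  qed
  have conv_s: "conv (basis_word a) (conv ?s (basis_word (b @ [SI \<mu>]))) =
    (\<lambda>w. \<Sum>\<nu>\<in>weights n d. q \<nu> * ?w [SI \<nu>] w)"
  proof -
    have "conv ?s (basis_word (b @ [SI \<mu>])) =
      (\<lambda>w. \<Sum>\<nu>\<in>weights n d. q \<nu> * conv (basis_word [SI \<nu>]) (basis_word (b @ [SI \<mu>])) w)"
      by (rule conv_sum(1))
    then have "conv (basis_word a) (conv ?s (basis_word (b @ [SI \<mu>]))) = conv (basis_word a)
      (\<lambda>w. \<Sum>\<nu>\<in>weights n d. q \<nu> * conv (basis_word [SI \<nu>]) (basis_word (b @ [SI \<mu>])) w)"
      by (rule arg_cong)
    also have "\<dots> = (\<lambda>w. \<Sum>\<nu>\<in>weights n d. q \<nu> *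
        conv (basis_word a) (conv (basis_word [SI \<nu>]) (basis_word (b @ [SI \<mu>]))) w)"
      by (rule conv_sum(2))
    finally show ?thesis by (simp only: conv_basis_word append_assoc)
  qed
  have 1: "?w [SE i, SF j] - ?w [SF j, SE i] - (\<lambda>w. \<Sum>\<nu>\<in>weights n d. q \<nu> * ?w [SI \<nu>] w) \<in> J"
    using J_ctx[OF rel aS bS] unfolding conv_minus conv_s by (simp only: conv_basis_word append_assoc)
  have 2: "(\<lambda>w. \<Sum>\<nu>\<in>weights n d. q \<nu> * ?w [SI \<nu>] w) - (\<lambda>w. ?c * ?w [] w) \<in> J"
  proof -
    have summand: "(\<lambda>w. q \<nu> * (?w [SI \<nu>] w - (if \<nu> = \<mu> + weight b then ?w [] w else 0))) \<in> J"
      if \<nu>: "\<nu> \<in> weights n d" for \<nu>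
    proof -
      have "conv (basis_word a) (basis_word (SI \<nu> # b @ [SI \<mu>]) - (if \<nu> = \<mu> + weight b then basis_word (b @ [SI \<mu>]) else 0)) \<in> J"
        using J_conv(1)[OF word_idem[OF \<mu> \<nu>] basis_word_closed[OF aS]] True by blast
      also have "conv (basis_word a) (basis_word (SI \<nu> # b @ [SI \<mu>]) - (if \<nu> = \<mu> + weight b then basis_word (b @ [SI \<mu>]) else 0))
        = (\<lambda>w. ?w [SI \<nu>] w - (if \<nu> = \<mu> + weight b then ?w [] w else 0))"
        by (auto simp: conv_minus conv_basis_word fun_eq_iff)
      finally show ?thesis by (rule J_scale)
    qed
    have sum: "(\<lambda>w. \<Sum>\<nu>\<in>W. f \<nu> w) \<in> J" if "finite W" "\<And>\<nu>. \<nu> \<in> W \<Longrightarrow> f \<nu> \<in> J" for W and f :: "_ \<Rightarrow> sgen list \<Rightarrow> Qv"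
      using that
    proof (induction W)
      case empty
      then show ?case using J_zero by (simp add: zero_fun_def)
    next
      case (insert x W)
      have "(\<lambda>w. \<Sum>\<nu>\<in>insert x W. f \<nu> w) = f x + (\<lambda>w. \<Sum>\<nu>\<in>W. f \<nu> w)"
        using insert by (auto simp: fun_eq_iff)
      then show ?case using insert J_add by simp
    qed
    have "(\<lambda>w. \<Sum>\<nu>\<in>weights n d. q \<nu> * (?w [SI \<nu>] w - (if \<nu> = \<mu> + weight b then ?w [] w else 0))) \<in> J"
      by (rule sum[OF finite_weights summand])
    also have "(\<lambda>w. \<Sum>\<nu>\<in>weights n d. q \<nu> * (?w [SI \<nu>] w - (if \<nu> = \<mu> + weight b then ?w [] w else 0))) =
      (\<lambda>w. \<Sum>\<nu>\<in>weights n d. q \<nu> * ?w [SI \<nu>] w) - (\<lambda>w. ?c * ?w [] w)"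
    proof
      fix w
      have "(\<Sum>\<nu>\<in>weights n d. q \<nu> * (if \<nu> = \<mu> + weight b then ?w [] w else 0)) =
        (\<Sum>\<nu>\<in>weights n d. if \<nu> = \<mu> + weight b then q \<nu> * ?w [] w else 0)"
        by (intro sum.cong) auto
      also have "\<dots> = ?c * ?w [] w" using finite_weights[of n d] by simp
      finally show "(\<Sum>\<nu>\<in>weights n d. q \<nu> * (?w [SI \<nu>] w - (if \<nu> = \<mu> + weight b then ?w [] w else 0))) =
        ((\<lambda>w. \<Sum>\<nu>\<in>weights n d. q \<nu> * ?w [SI \<nu>] w) - (\<lambda>w. ?c * ?w [] w)) w"
        by (simp add: right_diff_distrib sum_subtractf)
    qed
    finally show ?thesis .
  qed
  have wv: "word_vec \<mu> (a @ x @ b) = ?w x" if "set x \<subseteq> letters n" for x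
    using that True by (simp add: word_vec_def)
  have wv0: "word_vec \<mu> (a @ b) = ?w []" using wv[of "[]"] by simp
  have "?w [SE i, SF j] - ?w [SF j, SE i] - (\<lambda>w. ?c * ?w [] w) \<in> J" by (rule J_trans[OF 1 2])
  then show ?thesis
    using wv[of "[SE i, SF j]"] wv[of "[SF j, SE i]"] mem unfolding wv0 by (intro exI[of _ ?c]) simp
qed

lemma schur_words_J:
  assumes \<mu>: "\<mu> \<in> weights n d"
  shows "schur_words (\<lambda>c p w. c * p w) J (word_vec \<mu>) n (v + inverse v) \<mu>"
proof (intro schur_words.intro schur_words_axioms.intro word_span.intro word_span_axioms.intro)
  show "vector_space (\<lambda>c (p :: sgen list \<Rightarrow> Qv) w. c * p w)" by (rule fun_space.vector_space_axioms)
  show "fun_space.subspace J" by (rule J_subspace)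
  show "serre_words (\<lambda>c p w. c * p w) J (word_vec \<mu>) SE n (v + inverse v)"
  proof (rule serre_words_J[OF \<mu>])
    fix l r assume "(l, r) \<in> serre_rels F n (free_gen \<circ> SE)"
    then have "(l, r) \<in> S_rels n d" unfolding S_rels_eq by blast
    then show "l - r \<in> J" by (rule P.rel_in_ideal)
  qed (auto simp: letters_def)
  show "serre_words (\<lambda>c p w. c * p w) J (word_vec \<mu>) SF n (v + inverse v)"
  proof (rule serre_words_J[OF \<mu>])
    fix l r assume "(l, r) \<in> serre_rels F n (free_gen \<circ> SF)"
    then have "(l, r) \<in> S_rels n d" unfolding S_rels_eq by blast
    then show "l - r \<in> J" by (rule P.rel_in_ideal)
  qed (auto simp: letters_def)
  show "\<exists>c. word_vec \<mu> (a @ [SE i, SF j] @ b) - word_vec \<mu> (a @ [SF j, SE i] @ b)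
    - (\<lambda>w. c * word_vec \<mu> (a @ b) w) \<in> J" if "i \<in> {1..<n}" "j \<in> {1..<n}" for i j a b
    by (rule commutator_J[OF \<mu> that])
next
  fix j a b assume j: "j \<in> {1..n}" "(\<mu> + weight b) j < 0"
  show "word_vec \<mu> (a @ b) \<in> J"
  proof (cases "set (a @ b) \<subseteq> letters n")
    case True
    have "\<mu> + weight b \<notin> weights n d"
    proof
      assume "\<mu> + weight b \<in> weights n d"
      then have "0 \<le> (\<mu> + weight b) j" unfolding weights_def by blast
      then show False using j(2) by simp
    qed
    then have "basis_word (b @ [SI \<mu>]) \<in> J" using word_weight[OF \<mu>, of b] True by simp
    from J_word_ctx0[OF this, of a "[]"] show ?thesis
      using True letters_S by (auto simp: word_vec_def)
  next
    case False
    then show ?thesis using J_zero by (simp only: word_vec_def if_False)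
  qed
qed

lemma word_in_span:
  assumes \<mu>: "\<mu> \<in> weights n d" and w: "set w \<subseteq> S"
  shows "basis_word (w @ [SI \<mu>]) \<in> fun_space.span (J \<union> (\<lambda>A. basis_word (xword n A @ [SI \<mu>])) ` col_mats n \<mu>)"
    (is "_ \<in> ?Sp")
proof -
  interpret W: schur_words "\<lambda>c p w. c * p w" J "word_vec \<mu>" n "v + inverse v" \<mu>
    by (rule schur_words_J[OF \<mu>])
  have letters: "basis_word (b @ [SI \<mu>]) \<in> ?Sp" if b: "set b \<subseteq> letters n" for b
  proof -
    have "word_vec \<mu> ([] @ b @ []) \<in> fun_space.span (J \<union> (\<lambda>u. word_vec \<mu> ([] @ u @ [])) `
      {xword n A |A. A \<in> col_mats n (\<mu> + weight [])})"
      using W.word_reduces_xword[OF order_refl b, of "[]"] unfolding W.reduces_def by blast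
    moreover have "(\<lambda>u. word_vec \<mu> ([] @ u @ [])) ` {xword n A |A. A \<in> col_mats n (\<mu> + weight [])} =
      (\<lambda>A. basis_word (xword n A @ [SI \<mu>])) ` col_mats n \<mu>"
      using set_xword by (auto simp: word_vec_def weight_Nil)
    ultimately show ?thesis using b by (simp add: word_vec_def)
  qed
  \<comment> \<open>Idempotents inside the word are removed from the right: each acts as the
    identity on the weight it meets or kills the word.\<close>
  have "\<exists>x. basis_word (w @ [SI \<mu>]) - x \<in> J \<and> (x = 0 \<or> (\<exists>b. set b \<subseteq> letters n \<and> x = basis_word (b @ [SI \<mu>])))"
    using w
  proof (induction w)
    case Nil
    have "basis_word ([] @ [SI \<mu>]) - basis_word ([] @ [SI \<mu>]) \<in> J" by (simp only: diff_self J_zero)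
    then show ?case by (intro exI[of _ "basis_word ([] @ [SI \<mu>])"] conjI disjI2 exI[of _ "[]"]) (assumption | simp)+
  next
    case (Cons g w)
    have g: "g \<in> S" and w: "set w \<subseteq> S" using Cons.prems by simp_all
    obtain x where x: "basis_word (w @ [SI \<mu>]) - x \<in> J"
      "x = 0 \<or> (\<exists>b. set b \<subseteq> letters n \<and> x = basis_word (b @ [SI \<mu>]))" using Cons.IH[OF w] by blast
    have gx: "basis_word ((g # w) @ [SI \<mu>]) - conv (basis_word [g]) x \<in> J"
      using J_conv(1)[OF x(1) basis_word_closed[of "[g]"]] g by (simp add: conv_minus conv_basis_word)
    from x(2) show ?case
    proof (elim disjE exE conjE)
      assume "x = 0"
      then show ?thesis using gx by (intro exI[of _ 0]) simp
    next
      fix b assume b: "set b \<subseteq> letters n" "x = basis_word (b @ [SI \<mu>])"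
      have gx': "basis_word ((g # w) @ [SI \<mu>]) - basis_word (g # b @ [SI \<mu>]) \<in> J"
        using gx unfolding b(2) by (simp add: conv_basis_word)
      show ?thesis
      proof (cases "g \<in> letters n")
        case True
        then have "set (g # b) \<subseteq> letters n" using b by simp
        moreover have "basis_word ((g # w) @ [SI \<mu>]) - basis_word ((g # b) @ [SI \<mu>]) \<in> J"
          using gx' by (simp only: append_Cons)
        ultimately show ?thesis by blast
      next
        case False
        then obtain \<nu> where \<nu>: "g = SI \<nu>" "\<nu> \<in> weights n d" using g by (auto simp: S_gens_def letters_def)
        let ?x = "if \<nu> = \<mu> + weight b then basis_word (b @ [SI \<mu>]) else 0"
        have "basis_word (g # b @ [SI \<mu>]) - ?x \<in> J"
          unfolding \<nu>(1) by (rule word_idem[OF \<mu> \<nu>(2) b(1)])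
        then have "basis_word ((g # w) @ [SI \<mu>]) - ?x \<in> J" by (rule J_trans[OF gx'])
        moreover have "?x = 0 \<or> (\<exists>b. set b \<subseteq> letters n \<and> ?x = basis_word (b @ [SI \<mu>]))"
          using b(1) by auto
        ultimately show ?thesis by blast
      qed
    qed
  qed
  then obtain x where x: "basis_word (w @ [SI \<mu>]) - x \<in> J"
    "x = 0 \<or> (\<exists>b. set b \<subseteq> letters n \<and> x = basis_word (b @ [SI \<mu>]))" by blast
  have "x \<in> ?Sp" using x(2) letters fun_space.span_zero by blast
  moreover have "basis_word (w @ [SI \<mu>]) - x \<in> ?Sp" using x(1) by (intro fun_space.span_base) blast
  ultimately have "(basis_word (w @ [SI \<mu>]) - x) + x \<in> ?Sp" by (rule fun_space.span_add[rotated])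
  then show ?thesis by simp
qed

definition spanning_index :: "((nat \<Rightarrow> int) \<times> (nat \<Rightarrow> nat \<Rightarrow> nat)) set"
  where "spanning_index = (SIGMA \<mu>:weights n d. col_mats n \<mu>)"

text \<open>A word acquires a weight on its right by inserting the unit as the sum of all
  idempotents.\<close>

lemma free_in_span:
  assumes p: "p \<in> carrier F"
  shows "p \<in> fun_space.span (J \<union> (\<lambda>(\<mu>, A). basis_word (xword n A @ [SI \<mu>])) ` spanning_index)"
    (is "_ \<in> fun_space.span (J \<union> ?G)")
proof -
  have sub: "fun_space.span (J \<union> (\<lambda>A. basis_word (xword n A @ [SI \<mu>])) ` col_mats n \<mu>) \<subseteq> fun_space.span (J \<union> ?G)"
    if "\<mu> \<in> weights n d" for \<mu>
    by (rule fun_space.span_mono) (use that in \<open>force simp: spanning_index_def\<close>)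
  have word: "basis_word w \<in> fun_space.span (J \<union> ?G)" if w: "set w \<subseteq> S" for w
  proof -
    have "((\<lambda>u. \<Sum>\<mu>\<in>weights n d. basis_word [SI \<mu>] u) - basis_word []) \<in> J"
      by (rule P.rel_in_ideal) (unfold S_rels_eq, blast)
    from J_conv(1)[OF this basis_word_closed[OF w]]
    have "conv (basis_word w) (\<lambda>u. \<Sum>\<mu>\<in>weights n d. basis_word [SI \<mu>] u) - basis_word w \<in> J"
      by (simp add: conv_minus conv_basis_word)
    also have "conv (basis_word w) (\<lambda>u. \<Sum>\<mu>\<in>weights n d. basis_word [SI \<mu>] u) =
      (\<Sum>\<mu>\<in>weights n d. basis_word (w @ [SI \<mu>]) :: _ \<Rightarrow> Qv)"
    proof
      fix u
      have "conv (basis_word w) (\<lambda>u. \<Sum>\<mu>\<in>weights n d. basis_word [SI \<mu>] u) u =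
        (\<Sum>\<mu>\<in>weights n d. conv (basis_word w) (basis_word [SI \<mu>]) u :: Qv)"
        unfolding conv_def sum_distrib_left by (rule sum.swap)
      also have "\<dots> = (\<Sum>\<mu>\<in>weights n d. basis_word (w @ [SI \<mu>]) :: _ \<Rightarrow> Qv) u"
        by (simp add: conv_basis_word sum_apply)
      finally show "conv (basis_word w) (\<lambda>u. \<Sum>\<mu>\<in>weights n d. basis_word [SI \<mu>] u) u =
        (\<Sum>\<mu>\<in>weights n d. basis_word (w @ [SI \<mu>]) :: _ \<Rightarrow> Qv) u" .
    qed
    finally have 1: "(\<Sum>\<mu>\<in>weights n d. basis_word (w @ [SI \<mu>])) - basis_word w \<in> fun_space.span (J \<union> ?G)"
      by (intro fun_space.span_base) blast
    have 2: "(\<Sum>\<mu>\<in>weights n d. basis_word (w @ [SI \<mu>])) \<in> fun_space.span (J \<union> ?G)"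
      by (rule fun_space.span_sum) (use word_in_span[OF _ w] sub in blast)
    show ?thesis using fun_space.span_diff[OF 2 1] by simp
  qed
  have "p = (\<Sum>w\<in>{w. p w \<noteq> 0}. (\<lambda>u. p w * basis_word w u))"
  proof
    fix u
    have "(\<Sum>w\<in>{w. p w \<noteq> 0}. (\<lambda>u. p w * basis_word w u)) u = (\<Sum>w\<in>{w. p w \<noteq> 0}. if w = u then p u else 0)"
      unfolding sum_apply by (auto simp: basis_word_def intro!: sum.cong)
    also have "\<dots> = p u" using p by (auto simp: carrier_free_alg)
    finally show "p u = (\<Sum>w\<in>{w. p w \<noteq> 0}. (\<lambda>u. p w * basis_word w u)) u" by simp
  qed
  also have "\<dots> \<in> fun_space.span (J \<union> ?G)"
    using p word by (intro fun_space.span_sum fun_space.span_scale) (auto simp: carrier_free_alg)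
  finally show ?thesis .
qed

text \<open>Modulo the ideal \<open>p\<close> is a combination of the spanning words, and evaluation
  gives a vanishing combination of matrices. A column indexed by a list of weight \<mu> sees only
  the words ending in \<open>SI \<mu>\<close>; this separates the weights and leaves the situation
  of \<open>xword_independent\<close>.\<close>

lemma kernel_le_ideal:
  assumes p: "p \<in> carrier F" and zero: "eval_mat (tensor_basis n d) (schur_elem n d) p = 0"
  shows "p \<in> J"
proof -
  let ?B = "tensor_basis n d" and ?f = "schur_elem n d"
  have fin: "finite spanning_index"
    unfolding spanning_index_def using finite_weights finite_col_mats by (intro finite_SigmaI) auto
  obtain r c where r: "r \<in> J" and p_eq: "p = r + (\<lambda>w. \<Sum>(\<mu>, A)\<in>spanning_index. c (\<mu>, A) * basis_word (xword n A @ [SI \<mu>]) w)"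
    using span_image_sum[OF J_subspace fin free_in_span[OF p]] by (auto simp: case_prod_unfold)
  have cl: "(\<lambda>w. c i * basis_word (xword n (snd i) @ [SI (fst i)]) w) \<in> carrier F" if "i \<in> spanning_index" for i
  proof (intro free_scale_closed basis_word_closed)
    show "set (xword n (snd i) @ [SI (fst i)]) \<subseteq> S"
      using set_xword[of n "snd i"] letters_S that by (auto simp: spanning_index_def S_gens_def)
  qed
  let ?s = "\<lambda>w. \<Sum>i\<in>spanning_index. c i * basis_word (xword n (snd i) @ [SI (fst i)]) w"
  have s: "?s \<in> carrier F" "p = r + ?s"
    using finsum_free[OF fin cl] p_eq by (auto simp: case_prod_unfold)
  have "eval_mat ?B ?f p = eval_mat ?B ?f r + eval_mat ?B ?f ?s"
    unfolding s(2) using r P.rel_ideal_closed s(1) by (intro eval_mat_add free_fin_support) auto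
  also have "eval_mat ?B ?f r = 0" by (rule P.rel_ideal_le_kernel[OF r])
  also have "eval_mat ?B ?f ?s = (\<lambda>a b. \<Sum>i\<in>spanning_index. c i *
    word_prod (mat_alg ?B) ?f (xword n (snd i) @ [SI (fst i)]) a b)"
  proof -
    have "eval_mat ?B ?f ?s = (\<lambda>a b. \<Sum>i\<in>spanning_index.
        eval_mat ?B ?f (\<lambda>w. c i * basis_word (xword n (snd i) @ [SI (fst i)]) w) a b)"
      by (rule eval_mat_sum) (rule fin, erule cl)
    then show ?thesis by (simp only: eval_mat_scale eval_mat_basis_word)
  qed
  finally have sum0: "(\<Sum>i\<in>spanning_index. c i * word_prod (mat_alg ?B) ?f (xword n (snd i) @ [SI (fst i)]) a b) = 0" for a b
    using zero by (simp add: fun_eq_iff)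
  have "c (\<mu>, A) = 0" if \<mu>: "\<mu> \<in> weights n d" and A: "A \<in> col_mats n \<mu>" for \<mu> A
  proof -
    obtain base where base: "base \<in> ?B" "cnt base = \<mu>" using exists_base[OF \<mu>] by blast
    have entry: "word_prod (mat_alg ?B) ?f (xword n A @ [SI \<nu>]) u base =
      (if \<nu> = \<mu> then word_prod (mat_alg ?B) ?f (xword n A) u base else 0)" if "\<nu> \<in> weights n d" for \<nu> A u
    proof -
      have mon: "monoid (mat_alg ?B :: (Qv, nat list \<Rightarrow> nat list \<Rightarrow> Qv) module)"
        by (rule ring.is_monoid[OF ring_mat_alg[OF finite_tensor_basis]])
      have f: "?f ` (set (xword n A) \<union> set [SI \<nu>]) \<subseteq> carrier (mat_alg ?B)"
        using schur_elem_closed[of n d] set_xword[of n A] letters_S S_gens_mem(1)[OF that] by auto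
      have W: "word_prod (mat_alg ?B) ?f (xword n A) \<in> carrier (mat_alg ?B)"
        using f by (intro word_prod_closed mon) auto
      have "word_prod (mat_alg ?B) ?f (xword n A @ [SI \<nu>]) =
        mat_mult ?B (word_prod (mat_alg ?B) ?f (xword n A)) (diag ?B (\<lambda>bs. of_bool (cnt bs = \<nu>)))"
        using word_prod_append[OF mon f] schur_elem_eq(3)[OF that]
        by (simp add: mat_mult_one finite_tensor_basis diag_closed del: schur_elem.simps)
      then show ?thesis
        by (simp add: diag_mult_right[OF finite_tensor_basis W] base(2))
    qed
    show ?thesis
    proof (rule xword_independent[where c = "\<lambda>A. c (\<mu>, A)" and base = base and n = n and d = d])
      show "base \<in> ?B" by (rule base)
      show "finite (col_mats n (cnt base))" "A \<in> col_mats n (cnt base)"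
        using finite_col_mats[OF \<mu>] A base by simp_all
      fix u assume "u \<in> ?B"
      have "0 = (\<Sum>(\<nu>, A)\<in>spanning_index. c (\<nu>, A) * word_prod (mat_alg ?B) ?f (xword n A @ [SI \<nu>]) u base)"
        using sum0[of u base] by (simp add: case_prod_unfold)
      also have "\<dots> = (\<Sum>\<nu>\<in>weights n d. \<Sum>A\<in>col_mats n \<nu>. c (\<nu>, A) * word_prod (mat_alg ?B) ?f (xword n A @ [SI \<nu>]) u base)"
        unfolding spanning_index_def using finite_weights finite_col_mats by (subst sum.Sigma) auto
      also have "\<dots> = (\<Sum>\<nu>\<in>weights n d. if \<nu> = \<mu> then
        (\<Sum>A\<in>col_mats n \<mu>. c (\<mu>, A) * word_prod (mat_alg ?B) ?f (xword n A) u base) else 0)"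
        by (intro sum.cong) (auto simp: entry)
      also have "\<dots> = (\<Sum>A\<in>col_mats n \<mu>. c (\<mu>, A) * word_prod (mat_alg ?B) ?f (xword n A) u base)"
        using finite_weights[of n d] \<mu> by simp
      finally show "(\<Sum>A\<in>col_mats n (cnt base). c (\<mu>, A) * word_prod (mat_alg ?B) ?f (xword n A) u base) = 0"
        using base(2) by simp
    qed
  qed
  then have "?s = 0" by (auto simp: fun_eq_iff spanning_index_def intro!: sum.neutral)
  then show ?thesis using s(2) r by simp
qed

end

theorem theorem2p4:
  fixes n d :: nat
  assumes "n \<ge> 1"
  shows "\<exists>\<phi> \<in> alg_iso (presented_alg (S_gens n d) (S_rels n d)) (schur_alg n d).
    \<forall>g \<in> S_gens n d. \<phi> (presented_gen (S_gens n d) (S_rels n d) g) = schur_elem n d g"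
proof -
  interpret P: matrix_presentation "tensor_basis n d" "schur_elem n d" "S_gens n d" "S_rels n d"
    by (rule S_presentation)
  show ?thesis
    unfolding schur_alg_eq
    by (rule P.presented_alg_iso) (use gen_alg_schur_elem kernel_le_ideal in \<open>auto simp: gen_alg_def\<close>)
qed

end
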